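(* Let $\Delta$ and $\Gamma$ be finite simplicial graphs with $|V(\Delta)|=n$ and $|V(\Gamma)|=m$. Then $\mathbb{G}(\Delta)$ and $\mathbb{G}(\Gamma)$ are universally equivalent if and only if there exist tame embeddings $\varphi:\mathbb{G}(\Delta)\to\mathbb{G}(\Gamma_n)$ and $\psi:\mathbb{G}(\Gamma)\to\mathbb{G}(\Delta_m)$.
   Context: $\mathbb{G}(\Gamma)=\langle V(\Gamma)\mid [x,y]=1 \text{ for } (x,y)\in E(\Gamma)\rangle$. Two groups are universally equivalent if they satisfy the same universal sentences in the language of groups. The $k$-inflation $\Gamma_k$ has vertices $v_1,\dots,v_k$ for each $v\in V(\Gamma)$; $v_i,v_j$ adjacent for $i\ne j$, and $v_i,w_l$ ($v\ne w$) adjacent iff $(v,w)\in E(\Gamma)$; so $\mathbb{G}(\Gamma_k)$ is the graph product over $\Gamma$ with vertex groups $\mathbb{Z}^k$. An embedding $\varphi:\mathbb{G}(\Delta)\to\mathbb{G}(\Lambda)$ is tame if for each $x_i\in V(\Delta)$, $\varphi(x_i)=y_{i1}\cdots y_{ir_i}$ where $y_{ij}=g_{ij}^{-1}x_{ij}'^{\,n_{ij}}g_{ij}$ with $x'_{ij}\in V(\Lambda)$, $n_{ij}\in\mathbb{Z}$, $g_{ij}\in\mathbb{G}(\Lambda)$, the $y_{i1},\dots,y_{ir_i}$ pairwise commute, and the conjugates $g_{ij}^{-1}x'_{ij}g_{ij}$ are pairwise distinct over all pairs $(i,j)$. *)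

theory Defs
  imports "HOL-Algebra.Group"
begin

section \<open>Finite simplicial graphs\<close>

definition simple_graph :: "'a set \<Rightarrow> ('a \<Rightarrow> 'a \<Rightarrow> bool) \<Rightarrow> bool" where
  "simple_graph V E \<longleftrightarrow> finite V \<and> (\<forall>x y. E x y \<longrightarrow> x \<in> V \<and> y \<in> V)
     \<and> (\<forall>x y. E x y \<longrightarrow> E y x) \<and> (\<forall>x. \<not> E x x)"

section \<open>Right-angled Artin groups via the presentation\<close>

text \<open>Words over the generators: a letter (v, True) is v, a letter (v, False) is v inverse.\<close>

definition raag_words :: "'a set \<Rightarrow> ('a \<times> bool) list set" where
  "raag_words V = lists (V \<times> UNIV)"

inductive raag_step :: "('a \<Rightarrow> 'a \<Rightarrow> bool) \<Rightarrow> ('a \<times> bool) list \<Rightarrow> ('a \<times> bool) list \<Rightarrow> bool"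
  for E where
  cancel: "raag_step E (xs @ [(v, b), (v, \<not> b)] @ ys) (xs @ ys)"
| commute: "E v w \<Longrightarrow> raag_step E (xs @ [(v, b), (w, c)] @ ys) (xs @ [(w, c), (v, b)] @ ys)"

definition raag_eq :: "'a set \<Rightarrow> ('a \<Rightarrow> 'a \<Rightarrow> bool) \<Rightarrow> (('a \<times> bool) list \<times> ('a \<times> bool) list) set" where
  "raag_eq V E =
     (let R = {(p, q). p \<in> raag_words V \<and> q \<in> raag_words V \<and> raag_step E p q}
      in ((R \<union> R\<inverse>)\<^sup>*) \<inter> (raag_words V \<times> raag_words V))"

definition RAAG :: "'a set \<Rightarrow> ('a \<Rightarrow> 'a \<Rightarrow> bool) \<Rightarrow> ('a \<times> bool) list set monoid" where
  "RAAG V E =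
     \<lparr> carrier = raag_words V // raag_eq V E,
       mult = (\<lambda>A B. \<Union>a\<in>A. \<Union>b\<in>B. raag_eq V E `` {a @ b}),
       one = raag_eq V E `` {[]} \<rparr>"

definition raag_gen :: "'a set \<Rightarrow> ('a \<Rightarrow> 'a \<Rightarrow> bool) \<Rightarrow> 'a \<Rightarrow> ('a \<times> bool) list set" where
  "raag_gen V E v = raag_eq V E `` {[(v, True)]}"

section \<open>k-inflation of a graph\<close>

definition inflate_V :: "'a set \<Rightarrow> nat \<Rightarrow> ('a \<times> nat) set" where
  "inflate_V V k = V \<times> {1..k}"

definition inflate_E :: "'a set \<Rightarrow> ('a \<Rightarrow> 'a \<Rightarrow> bool) \<Rightarrow> nat \<Rightarrow> ('a \<times> nat) \<Rightarrow> ('a \<times> nat) \<Rightarrow> bool" where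
  "inflate_E V E k p q \<longleftrightarrow> p \<in> inflate_V V k \<and> q \<in> inflate_V V k \<and>
     ((fst p = fst q \<and> snd p \<noteq> snd q) \<or> (fst p \<noteq> fst q \<and> E (fst p) (fst q)))"

section \<open>Universal theory of groups\<close>

datatype gterm = Var nat | One | Mul gterm gterm | Inv gterm

text \<open>Quantifier-free formulas in the language of groups.\<close>
datatype gform = Eq gterm gterm | Neg gform | Conj gform gform | Disj gform gform

fun eval_gterm :: "('g, 'm) monoid_scheme \<Rightarrow> (nat \<Rightarrow> 'g) \<Rightarrow> gterm \<Rightarrow> 'g" where
  "eval_gterm G s (Var i) = s i"
| "eval_gterm G s One = \<one>\<^bsub>G\<^esub>"
| "eval_gterm G s (Mul t u) = eval_gterm G s t \<otimes>\<^bsub>G\<^esub> eval_gterm G s u"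
| "eval_gterm G s (Inv t) = inv\<^bsub>G\<^esub> (eval_gterm G s t)"

fun sat_gform :: "('g, 'm) monoid_scheme \<Rightarrow> (nat \<Rightarrow> 'g) \<Rightarrow> gform \<Rightarrow> bool" where
  "sat_gform G s (Eq t u) = (eval_gterm G s t = eval_gterm G s u)"
| "sat_gform G s (Neg f) = (\<not> sat_gform G s f)"
| "sat_gform G s (Conj f g) = (sat_gform G s f \<and> sat_gform G s g)"
| "sat_gform G s (Disj f g) = (sat_gform G s f \<or> sat_gform G s g)"

text \<open>A universal sentence is the universal closure of a quantifier-free formula;
  it holds in G iff the formula holds under every assignment into G.\<close>
definition holds_universally :: "('g, 'm) monoid_scheme \<Rightarrow> gform \<Rightarrow> bool" where
  "holds_universally G f \<longleftrightarrow> (\<forall>s. (\<forall>i. s i \<in> carrier G) \<longrightarrow> sat_gform G s f)"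

definition universally_equivalent :: "('g, 'm) monoid_scheme \<Rightarrow> ('h, 'n) monoid_scheme \<Rightarrow> bool" where
  "universally_equivalent G H \<longleftrightarrow> (\<forall>f. holds_universally G f \<longleftrightarrow> holds_universally H f)"

section \<open>Tame embeddings\<close>

definition gprod :: "('g, 'm) monoid_scheme \<Rightarrow> 'g list \<Rightarrow> 'g" where
  "gprod G ys = foldr (\<lambda>y acc. y \<otimes>\<^bsub>G\<^esub> acc) ys \<one>\<^bsub>G\<^esub>"

text \<open>The factor g^{-1} x'^n g in RAAG(VL,EL).\<close>
definition tame_factor :: "'b set \<Rightarrow> ('b \<Rightarrow> 'b \<Rightarrow> bool) \<Rightarrow> 'b \<times> int \<times> ('b \<times> bool) list set \<Rightarrow> ('b \<times> bool) list set" where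
  "tame_factor VL EL t = (case t of (x', k, g) \<Rightarrow>
     inv\<^bsub>RAAG VL EL\<^esub> g \<otimes>\<^bsub>RAAG VL EL\<^esub> (raag_gen VL EL x' [^]\<^bsub>RAAG VL EL\<^esub> k) \<otimes>\<^bsub>RAAG VL EL\<^esub> g)"

text \<open>The conjugate g^{-1} x' g of the generator.\<close>
definition tame_conj :: "'b set \<Rightarrow> ('b \<Rightarrow> 'b \<Rightarrow> bool) \<Rightarrow> 'b \<times> int \<times> ('b \<times> bool) list set \<Rightarrow> ('b \<times> bool) list set" where
  "tame_conj VL EL t = (case t of (x', k, g) \<Rightarrow>
     inv\<^bsub>RAAG VL EL\<^esub> g \<otimes>\<^bsub>RAAG VL EL\<^esub> raag_gen VL EL x' \<otimes>\<^bsub>RAAG VL EL\<^esub> g)"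

definition tame_embedding ::
  "'a set \<Rightarrow> ('a \<Rightarrow> 'a \<Rightarrow> bool) \<Rightarrow> 'b set \<Rightarrow> ('b \<Rightarrow> 'b \<Rightarrow> bool)
   \<Rightarrow> (('a \<times> bool) list set \<Rightarrow> ('b \<times> bool) list set) \<Rightarrow> bool" where
  "tame_embedding VD ED VL EL \<phi> \<longleftrightarrow>
     \<phi> \<in> hom (RAAG VD ED) (RAAG VL EL) \<and> inj_on \<phi> (carrier (RAAG VD ED)) \<and>
     (\<exists>L :: 'a \<Rightarrow> ('b \<times> int \<times> ('b \<times> bool) list set) list.
        (\<forall>x\<in>VD.
           (\<forall>(x', k, g) \<in> set (L x). x' \<in> VL \<and> g \<in> carrier (RAAG VL EL)) \<and>
           \<phi> (raag_gen VD ED x) = gprod (RAAG VL EL) (map (tame_factor VL EL) (L x)) \<and>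
           (\<forall>j < length (L x). \<forall>l < length (L x).
              tame_factor VL EL (L x ! j) \<otimes>\<^bsub>RAAG VL EL\<^esub> tame_factor VL EL (L x ! l) =
              tame_factor VL EL (L x ! l) \<otimes>\<^bsub>RAAG VL EL\<^esub> tame_factor VL EL (L x ! j))) \<and>
        inj_on (\<lambda>(x, j). tame_conj VL EL (L x ! j)) {(x, j). x \<in> VD \<and> j < length (L x)})"

end

theory Submission
  imports Defs Complex_Main
begin

text \<open>
  If every universal sentence true in \<open>RAAG VG EG\<close> holds in \<open>RAAG VD ED\<close>, then for finitely many nontrivial
  words there is a homomorphism \<open>y\<close> from \<open>RAAG VD ED\<close> to \<open>RAAG VG EG\<close> that kills none of them. For such \<open>y\<close>
  each image \<open>y x\<close> is a product of commuting blocks, one for every join factor of its parabolic closure. If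
  two blocks commute, their parabolic closures centralise each other or coincide; in the latter case the
  blocks act on a common axis in the Bass-Serre tree of a vertex, so commutation is transitive among them.
  Replacing each block by a generic conjugate of a vertex inside its closure keeps the commutation graph.
  There are only finitely many such graphs, so for a suitable finite set of words the map from
  \<open>RAAG VD ED\<close> to the group of the commutation graph is injective. The latter group embeds in the inflation: one
  colour is kept for conjugators, the others separate conjugates that coincide, and the conjugates of vertices
  freely generate (subject to their commutations) a normal factor of a semidirect product.
  Conversely, sending \<open>(v, c)\<close> to the power \<open>N ^ c\<close> of \<open>v\<close> discriminates the group of the inflation by \<open>RAAG VG EG\<close>,
  by Britton's lemma, so an embedding transfers universal sentences.
\<close>

section \<open>Right-angled Artin groups as a type\<close>

text \<open>The map \<open>y\<close> itself cannot serve as the embedding: it need not be injective,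
  and its blocks need not be conjugates of vertex powers. Only the commutation graph of its blocks
  is kept. Since commuting replacements \<open>U\<close> come from commuting blocks,
  \<open>y\<close> factors through the group of that graph, so a word killed by the canonical map is
  killed by \<open>y\<close>; one witness word for each non-injective canonical map therefore
  suffices.

  The number \<open>n = card VD\<close> of colours arises as follows. Equal values of
  \<open>U\<close> belong to one vertex, and a single \<open>x\<close> in \<open>VD\<close>
  contributes at most one block with a given value, so a value occurs at most \<open>n\<close>
  times. If it occurs \<open>n\<close> times, it uses up all colours, including the one reserved for
  conjugators. But then it also occurs among the blocks of a fixed \<open>x0\<close>, whose values
  have been turned into bare vertices by a global conjugation, and it commutes with every other
  value. So it is a vertex that no conjugator needs, and its copy of colour \<open>n\<close> is
  free.\<close>

class graph =
  fixes adj :: "'a \<Rightarrow> 'a \<Rightarrow> bool"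
  assumes adj_sym: "adj x y \<Longrightarrow> adj y x" and adj_irrefl [simp]: "\<not> adj x x"

lemma adj_commute: "adj x y = adj y (x :: 'a :: graph)"
  using adj_sym by blast

definition word_equiv :: "('v::graph \<times> bool) list \<Rightarrow> ('v \<times> bool) list \<Rightarrow> bool" where
  "word_equiv = equivclp (raag_step adj)"

lemma equivp_word_equiv: "equivp word_equiv"
  by (simp add: word_equiv_def)

lemma raag_step_context: "raag_step E p q \<Longrightarrow> raag_step E (u @ p @ w) (u @ q @ w)"
proof (induction rule: raag_step.induct)
  case (cancel xs v b ys)
  show ?case using raag_step.cancel[of E "u @ xs" v b "ys @ w"] by simp
next
  case (commute v v' xs b c ys)
  then show ?case using raag_step.commute[of E v v' "u @ xs" b c "ys @ w"] by simp
qed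

lemma word_equiv_step: "raag_step adj p q \<Longrightarrow> word_equiv p q"
  by (simp add: word_equiv_def r_into_equivclp)

lemma word_equiv_sym: "word_equiv p q \<Longrightarrow> word_equiv q p"
  by (metis equivp_symp equivp_word_equiv)

lemma word_equiv_trans: "word_equiv p q \<Longrightarrow> word_equiv q r \<Longrightarrow> word_equiv p r"
  by (metis equivp_transp equivp_word_equiv)

lemma word_equiv_refl [simp]: "word_equiv p p"
  by (simp add: equivp_reflp equivp_word_equiv)

lemma word_equiv_induct [consumes 1, case_names refl step sym_step]:
  assumes "word_equiv p q"
    and "\<And>p. P p p"
    and "\<And>p q r. P p q \<Longrightarrow> raag_step adj q r \<Longrightarrow> P p r"
    and "\<And>p q r. P p q \<Longrightarrow> raag_step adj r q \<Longrightarrow> P p r"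
  shows "P p q"
  using assms(1) unfolding word_equiv_def
  by (induction rule: equivclp_induct) (use assms(2-) in blast)+

lemma word_equiv_map:
  assumes "word_equiv p q" and "\<And>p q. raag_step adj p q \<Longrightarrow> word_equiv (f p) (f q)"
  shows "word_equiv (f p) (f q)"
  using assms(1)
  by (induction rule: word_equiv_induct)
    (use assms(2) word_equiv_trans word_equiv_sym in \<open>blast intro: word_equiv_refl\<close>)+

lemma word_equiv_append:
  assumes "word_equiv p p'" "word_equiv q q'"
  shows "word_equiv (p @ q) (p' @ q')"
proof -
  have "word_equiv (p @ q) (p' @ q)"
    using assms(1) raag_step_context[of adj _ _ "[]" q]
    by (intro word_equiv_map[of p p' "\<lambda>p. p @ q"]) (auto intro: word_equiv_step)
  moreover have "word_equiv (p' @ q) (p' @ q')"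
    using assms(2) raag_step_context[of adj _ _ p' "[]"]
    by (intro word_equiv_map[of q q' "\<lambda>q. p' @ q"]) (auto intro: word_equiv_step)
  ultimately show ?thesis by (rule word_equiv_trans)
qed

definition inv_word :: "('v \<times> bool) list \<Rightarrow> ('v \<times> bool) list" where
  "inv_word w = rev (map (\<lambda>(v, b). (v, \<not> b)) w)"

lemma inv_word_append [simp]: "inv_word (p @ q) = inv_word q @ inv_word p"
  and inv_word_Cons: "inv_word ((v, b) # q) = inv_word q @ [(v, \<not> b)]"
  and inv_word_Nil [simp]: "inv_word [] = []"
  by (simp_all add: inv_word_def)

lemma raag_step_inv_word:
  assumes "raag_step adj p q"
  shows "raag_step adj (inv_word p) (inv_word q)"
  using assms
proof (induction rule: raag_step.induct)
  case (cancel xs v b ys)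
  show ?case using raag_step.cancel[of adj "inv_word ys" v b "inv_word xs"]
    by (simp add: inv_word_Cons)
next
  case (commute v w xs b c ys)
  show ?case using raag_step.commute[where E = adj and v = w and w = v and xs = "inv_word ys" and b = "\<not> c"
        and c = "\<not> b" and ys = "inv_word xs"] adj_sym[OF commute]
    by (simp add: inv_word_Cons)
qed

lemma word_equiv_inv_word: "word_equiv p q \<Longrightarrow> word_equiv (inv_word p) (inv_word q)"
  by (rule word_equiv_map) (auto intro: word_equiv_step raag_step_inv_word)

lemma word_equiv_left_inverse: "word_equiv (inv_word p @ p) []"
proof (induction p)
  case (Cons a p)
  obtain v b where a: "a = (v, b)" by (cases a)
  have "raag_step adj (inv_word p @ [(v, \<not> b), (v, \<not> \<not> b)] @ p) (inv_word p @ p)"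
    by (rule raag_step.cancel)
  then have "word_equiv (inv_word (a # p) @ a # p) (inv_word p @ p)"
    by (auto simp: a inv_word_Cons intro: word_equiv_step)
  then show ?case using Cons word_equiv_trans by blast
qed simp

quotient_type (overloaded) 'v raag = "('v::graph \<times> bool) list" / word_equiv
  by (rule equivp_word_equiv)

instantiation raag :: (graph) group_add
begin

lift_definition zero_raag :: "'a raag" is "[]" .
lift_definition plus_raag :: "'a raag \<Rightarrow> 'a raag \<Rightarrow> 'a raag" is "(@)"
  by (rule word_equiv_append)
lift_definition uminus_raag :: "'a raag \<Rightarrow> 'a raag" is inv_word
  by (rule word_equiv_inv_word)
definition minus_raag :: "'a raag \<Rightarrow> 'a raag \<Rightarrow> 'a raag" where
  "minus_raag a b = a + - b"

instance
proof
  fix a b c :: "'a raag"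
  show "a + b + c = a + (b + c)" by transfer simp
  show "0 + a = a" by transfer simp
  show "a + 0 = a" by transfer simp
  show "- a + a = 0" by transfer (rule word_equiv_left_inverse)
  show "a + - b = a - b" by (simp add: minus_raag_def)
qed

end

declare add_uminus_conv_diff [simp del]

definition comm :: "'g::group_add \<Rightarrow> 'g \<Rightarrow> bool" where
  "comm a b \<longleftrightarrow> a + b = b + a"

definition signed :: "'g::group_add \<Rightarrow> bool \<Rightarrow> 'g" where
  "signed g b = (if b then g else - g)"

lift_definition gen :: "'v::graph \<Rightarrow> 'v raag" is "\<lambda>v. [(v, True)]" .

definition word_sum :: "('a \<Rightarrow> 'g::group_add) \<Rightarrow> ('a \<times> bool) list \<Rightarrow> 'g" where
  "word_sum \<phi> w = sum_list (map (\<lambda>(v, b). signed (\<phi> v) b) w)"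

lemma word_sum_simps [simp]:
  "word_sum \<phi> [] = 0"
  "word_sum \<phi> ((v, b) # w) = signed (\<phi> v) b + word_sum \<phi> w"
  "word_sum \<phi> (u @ w) = word_sum \<phi> u + word_sum \<phi> w"
  by (simp_all add: word_sum_def)

lemma abs_raag_eq_word_sum: "abs_raag w = word_sum gen w"
proof (induction w)
  case Nil
  show ?case by (simp add: zero_raag_def)
next
  case (Cons a w)
  obtain v b where a: "a = (v, b)" by (cases a)
  have "abs_raag (a # w) = abs_raag [(v, b)] + abs_raag w"
    by (simp add: a plus_raag.abs_eq)
  also have "abs_raag [(v, b)] = signed (gen v) b"
    by (simp add: signed_def gen.abs_eq uminus_raag.abs_eq inv_word_def)
  finally show ?case by (simp add: Cons a)
qed

lemma raag_exhaust_word: obtains w where "g = word_sum gen w"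
proof -
  obtain w where "g = abs_raag w" by (induction g) blast
  then show ?thesis using that by (simp add: abs_raag_eq_word_sum)
qed

lemma raag_induct [case_names zero plus]:
  assumes "P 0" and "\<And>v b g. P g \<Longrightarrow> P (signed (gen v) b + g)"
  shows "P g"
proof -
  obtain w where "g = word_sum gen w" by (rule raag_exhaust_word)
  moreover have "P (word_sum gen w)" by (induction w) (use assms in auto)
  ultimately show ?thesis by simp
qed

lemma word_sum_gen_eq_iff: "word_sum gen p = word_sum gen q \<longleftrightarrow> word_equiv p q"
  by (metis abs_raag_eq_word_sum raag.abs_eq_iff)

section \<open>Actions given letter by letter, and the universal property\<close>

definition word_act :: "('v \<Rightarrow> bool \<Rightarrow> 'x \<Rightarrow> 'x) \<Rightarrow> ('v \<times> bool) list \<Rightarrow> 'x \<Rightarrow> 'x" where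
  "word_act \<phi> w x = foldr (\<lambda>(v, b). \<phi> v b) w x"

lemma word_act_simps [simp]:
  "word_act \<phi> [] x = x"
  "word_act \<phi> ((v, b) # w) x = \<phi> v b (word_act \<phi> w x)"
  "word_act \<phi> (u @ w) x = word_act \<phi> u (word_act \<phi> w x)"
  by (simp_all add: word_act_def)

text \<open>The word is an arbitrary choice; independence of it is what \<open>letter_action\<close>
  provides. The relations are demanded only on a set \<open>T\<close>, so that an action can be
  defined on normal forms inside a larger type of sequences.\<close>

definition raag_act :: "('v::graph \<Rightarrow> bool \<Rightarrow> 'x \<Rightarrow> 'x) \<Rightarrow> 'v raag \<Rightarrow> 'x \<Rightarrow> 'x" where
  "raag_act \<phi> g = word_act \<phi> (SOME w. g = word_sum gen w)"

locale letter_action =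
  fixes \<phi> :: "'v::graph \<Rightarrow> bool \<Rightarrow> 'x \<Rightarrow> 'x" and T :: "'x set"
  assumes closed: "x \<in> T \<Longrightarrow> \<phi> v b x \<in> T"
    and cancels: "x \<in> T \<Longrightarrow> \<phi> v b (\<phi> v (\<not> b) x) = x"
    and commutes: "x \<in> T \<Longrightarrow> adj v w \<Longrightarrow> \<phi> v b (\<phi> w c x) = \<phi> w c (\<phi> v b x)"
begin

lemma word_act_closed: "x \<in> T \<Longrightarrow> word_act \<phi> w x \<in> T"
  by (induction w) (auto intro: closed)

lemma word_act_step: "raag_step adj p q \<Longrightarrow> x \<in> T \<Longrightarrow> word_act \<phi> p x = word_act \<phi> q x"
proof (induction rule: raag_step.induct)
  case (commute v w xs b c ys)
  then show ?case using commutes[of "word_act \<phi> ys x" v w b c] by (simp add: word_act_closed)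
qed (simp add: cancels word_act_closed)

lemma word_act_equiv: "word_equiv p q \<Longrightarrow> x \<in> T \<Longrightarrow> word_act \<phi> p x = word_act \<phi> q x"
  by (induction rule: word_equiv_induct) (simp_all add: word_act_step)

lemma raag_act_word_sum: "x \<in> T \<Longrightarrow> raag_act \<phi> (word_sum gen w) x = word_act \<phi> w x"
proof -
  assume x: "x \<in> T"
  let ?w = "SOME u. word_sum gen w = word_sum gen u"
  have "word_sum gen w = word_sum gen ?w" by (rule someI) (rule refl)
  then show ?thesis using x word_act_equiv[of w ?w] by (simp add: raag_act_def word_sum_gen_eq_iff)
qed

lemma raag_act_zero: "x \<in> T \<Longrightarrow> raag_act \<phi> 0 x = x"
  using raag_act_word_sum[of x "[]"] by simp

lemma raag_act_closed: "x \<in> T \<Longrightarrow> raag_act \<phi> g x \<in> T"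
proof -
  assume x: "x \<in> T"
  obtain w where "g = word_sum gen w" by (rule raag_exhaust_word)
  then show ?thesis using x by (simp add: raag_act_word_sum word_act_closed)
qed

lemma raag_act_plus: "x \<in> T \<Longrightarrow> raag_act \<phi> (g + h) x = raag_act \<phi> g (raag_act \<phi> h x)"
proof -
  assume x: "x \<in> T"
  obtain p q where "g = word_sum gen p" "h = word_sum gen q" by (meson raag_exhaust_word)
  then show ?thesis
    using x raag_act_word_sum[OF x, of "p @ q"] by (simp add: raag_act_word_sum word_act_closed)
qed

lemma raag_act_signed_gen: "x \<in> T \<Longrightarrow> raag_act \<phi> (signed (gen v) b) x = \<phi> v b x"
  using raag_act_word_sum[of x "[(v, b)]"] by simp

end

text \<open>The universal property is an instance of \<open>letter_action\<close>: letters act on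
  the target by left addition, and the homomorphism is the orbit map of \<open>0\<close>. It is
  meaningful for \<open>adj_compatible\<close> assignments.\<close>

definition lift :: "('v::graph \<Rightarrow> 'g::group_add) \<Rightarrow> 'v raag \<Rightarrow> 'g" where
  "lift \<phi> g = raag_act (\<lambda>v b x. signed (\<phi> v) b + x) g 0"

definition adj_compatible :: "('v::graph \<Rightarrow> 'g::group_add) \<Rightarrow> bool" where
  "adj_compatible \<phi> \<longleftrightarrow> (\<forall>v w. adj v w \<longrightarrow> comm (\<phi> v) (\<phi> w))"

lemma comm_sym: "comm a b \<Longrightarrow> comm b a"
  by (simp add: comm_def)

lemma comm_zero [simp]: "comm 0 a" "comm a 0"
  by (simp_all add: comm_def)

lemma comm_self [simp]: "comm a a"
  by (simp add: comm_def)

lemma comm_uminus: "comm a b \<Longrightarrow> comm (- a) b"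
proof -
  assume "comm a b"
  then have "- a + (a + b) + - a = - a + (b + a) + - a" by (simp add: comm_def)
  then show ?thesis by (simp add: comm_def add.assoc)
qed

lemma comm_uminus_iff [simp]: "comm (- a) b \<longleftrightarrow> comm a b" "comm a (- b) \<longleftrightarrow> comm a b"
proof -
  show *: "comm (- a) b \<longleftrightarrow> comm a b" for a b :: 'a
    using comm_uminus[of a b] comm_uminus[of "- a" b] by auto
  show "comm a (- b) \<longleftrightarrow> comm a b"
    using *[of b a] comm_sym by blast
qed

lemma comm_plus: "comm a c \<Longrightarrow> comm b c \<Longrightarrow> comm (a + b) c"
  unfolding comm_def by (metis add.assoc)

lemma comm_plus': "comm c a \<Longrightarrow> comm c b \<Longrightarrow> comm c (a + b)"
  using comm_plus comm_sym by blast

lemma comm_signed [simp]: "comm (signed a b) c \<longleftrightarrow> comm a c" "comm c (signed a b) \<longleftrightarrow> comm c a"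
  by (simp_all add: signed_def)

lemma signed_cancel [simp]: "signed a b + signed a (\<not> b) = 0" "signed a (\<not> b) + signed a b = 0"
  "signed a b + (signed a (\<not> b) + x) = x" "signed a (\<not> b) + (signed a b + x) = x"
  by (simp_all add: signed_def)

lemma uminus_signed [simp]: "- signed a b = signed a (\<not> b)"
  by (simp add: signed_def)

lemma lift_word_sum: "adj_compatible \<phi> \<Longrightarrow> lift \<phi> (word_sum gen w) = word_sum \<phi> w"
proof -
  assume r: "adj_compatible \<phi>"
  interpret letter_action "\<lambda>v b x. signed (\<phi> v) b + x" UNIV
  proof
    fix x :: 'b and v w :: 'a and b c assume "adj v w"
    then have "comm (signed (\<phi> v) b) (signed (\<phi> w) c)"
      using r by (simp add: adj_compatible_def)
    then show "signed (\<phi> v) b + (signed (\<phi> w) c + x) = signed (\<phi> w) c + (signed (\<phi> v) b + x)"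
      by (simp add: comm_def add.assoc[symmetric])
  qed auto
  have "word_act (\<lambda>v b x. signed (\<phi> v) b + x) w 0 = word_sum \<phi> w"
    by (induction w) auto
  then show ?thesis by (simp add: lift_def raag_act_word_sum)
qed

lemma lift_zero: "adj_compatible \<phi> \<Longrightarrow> lift \<phi> 0 = 0"
  using lift_word_sum[of \<phi> "[]"] by simp

lemma lift_plus: "adj_compatible \<phi> \<Longrightarrow> lift \<phi> (g + h) = lift \<phi> g + lift \<phi> h"
proof -
  assume r: "adj_compatible \<phi>"
  obtain p q where "g = word_sum gen p" "h = word_sum gen q" by (meson raag_exhaust_word)
  then show ?thesis using lift_word_sum[OF r, of "p @ q"] by (simp add: lift_word_sum[OF r])
qed

lemma lift_uminus: "adj_compatible \<phi> \<Longrightarrow> lift \<phi> (- g) = - lift \<phi> g"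
  using lift_plus[of \<phi> g "- g"] by (simp add: lift_zero eq_neg_iff_add_eq_0 minus_unique)

lemma lift_gen: "adj_compatible \<phi> \<Longrightarrow> lift \<phi> (gen v) = \<phi> v"
  using lift_word_sum[of \<phi> "[(v, True)]"] by (simp add: signed_def)

lemma lift_signed: "adj_compatible \<phi> \<Longrightarrow> lift \<phi> (signed g b) = signed (lift \<phi> g) b"
  by (simp add: signed_def lift_uminus)

lemmas lift_simps = lift_zero lift_plus lift_uminus lift_gen lift_signed

lemma comm_gen: "adj v w \<Longrightarrow> comm (gen v) (gen w)"
  unfolding comm_def
proof transfer
  fix v w :: 'a assume "adj v w"
  then have "raag_step adj ([] @ [(v, True), (w, True)] @ []) ([] @ [(w, True), (v, True)] @ [])"
    by (rule raag_step.commute)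
  then show "word_equiv ([(v, True)] @ [(w, True)]) ([(w, True)] @ [(v, True)])"
    by (auto intro: word_equiv_step)
qed

section \<open>Retractions and parabolic subgroups\<close>

definition cj :: "'g::group_add \<Rightarrow> 'g \<Rightarrow> 'g" where
  "cj h g = - h + g + h"

lemma cj_simps [simp]:
  "cj h (a + b) = cj h a + cj h b" "cj h 0 = 0" "cj h (- a) = - cj h a"
  "cj 0 a = a" "cj k (cj h a) = cj (h + k) a"
  by (simp_all add: cj_def add.assoc minus_add)

lemma cj_eq_iff [simp]: "cj h a = cj h b \<longleftrightarrow> a = b"
  by (simp add: cj_def)

lemma comm_cj [simp]: "comm (cj h a) (cj h b) \<longleftrightarrow> comm a b"
  unfolding comm_def cj_simps(1)[symmetric] cj_eq_iff ..

lemma comm_iff_cj: "comm a b \<longleftrightarrow> cj b a = a"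
proof -
  have "- b + (a + b) = a \<longleftrightarrow> b + (- b + (a + b)) = b + a"
    by (simp only: add_left_cancel)
  then show ?thesis by (simp add: comm_def cj_def add.assoc)
qed

lemma cj_comm: "comm a b \<Longrightarrow> cj b a = a"
  by (simp add: comm_iff_cj)

lemma cj_signed: "cj h (signed a b) = signed (cj h a) b"
  by (simp add: signed_def)

lemma adj_compatible_restrict:
  "adj_compatible (\<lambda>v. if v \<in> X then gen v else 0)"
  by (simp add: adj_compatible_def comm_gen)

definition rho :: "'v::graph set \<Rightarrow> 'v raag \<Rightarrow> 'v raag" where
  "rho X = lift (\<lambda>v. if v \<in> X then gen v else 0)"

lemma rho_simps [simp]:
  "rho X 0 = 0" "rho X (a + b) = rho X a + rho X b" "rho X (- a) = - rho X a"
  "rho X (signed a s) = signed (rho X a) s"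
  "rho X (gen v) = (if v \<in> X then gen v else 0)"
  by (simp_all add: rho_def lift_simps adj_compatible_restrict)

lemma rho_cj [simp]: "rho X (cj h a) = cj (rho X h) (rho X a)"
  by (simp add: cj_def)

lemma signed_zero [simp]: "signed 0 b = 0"
  by (simp add: signed_def)

lemma rho_rho [simp]: "rho X (rho Y g) = rho (X \<inter> Y) g"
  by (induction g rule: raag_induct) auto

lemma comm_rho: "comm a b \<Longrightarrow> comm (rho X a) (rho X b)"
  unfolding comm_def by (metis rho_simps(2))

text \<open>The standard parabolic on \<open>X\<close> is encoded by the fixed points of a
  retraction instead of by generators. Membership becomes an equation, and intersections come for
  free because the retractions to \<open>X\<close> and \<open>Y\<close> compose to the one to
  \<open>X \<inter> Y\<close>; \<open>par_induct\<close> recovers the generators.\<close>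

definition par :: "'v::graph set \<Rightarrow> 'v raag set" where
  "par X = {g. rho X g = g}"

lemma rho_par: "g \<in> par X \<Longrightarrow> rho X g = g"
  by (simp add: par_def)

lemma par_simps [simp]: "0 \<in> par X" "rho X g \<in> par X" "- g \<in> par X \<longleftrightarrow> g \<in> par X"
  by (simp_all add: par_def)

lemma par_plus [simp]: "a \<in> par X \<Longrightarrow> b \<in> par X \<Longrightarrow> a + b \<in> par X"
  by (simp add: par_def)

lemma par_signed [simp]: "signed a s \<in> par X \<longleftrightarrow> a \<in> par X"
  by (simp add: signed_def)

lemma par_cj [simp]: "h \<in> par X \<Longrightarrow> cj h a \<in> par X \<longleftrightarrow> a \<in> par X"
  by (simp add: par_def)

lemma par_add_left_iff: "a \<in> par X \<Longrightarrow> a + b \<in> par X \<longleftrightarrow> b \<in> par X"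
  by (simp add: par_def)

lemma par_add_right_iff: "b \<in> par X \<Longrightarrow> a + b \<in> par X \<longleftrightarrow> a \<in> par X"
  by (simp add: par_def)

lemma gen_in_par [simp]: "v \<in> X \<Longrightarrow> gen v \<in> par X"
  by (simp add: par_def)

lemma rho_in_par_Int: "g \<in> par Y \<Longrightarrow> rho X g \<in> par (X \<inter> Y)"
  by (metis par_simps(2) rho_par rho_rho)

lemma rho_par_Int: "g \<in> par Y \<Longrightarrow> rho X g = rho (X \<inter> Y) g"
  by (metis rho_par rho_rho)

lemma par_Int: "g \<in> par X \<Longrightarrow> g \<in> par Y \<Longrightarrow> g \<in> par (X \<inter> Y)"
  by (metis rho_in_par_Int rho_par)

lemma par_mono: "g \<in> par X \<Longrightarrow> X \<subseteq> Y \<Longrightarrow> g \<in> par Y"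
  by (metis inf.absorb2 mem_Collect_eq par_def rho_par_Int)

lemma par_induct [consumes 1, case_names zero plus]:
  assumes "g \<in> par X" and "P 0"
    and "\<And>v b g. v \<in> X \<Longrightarrow> g \<in> par X \<Longrightarrow> P g \<Longrightarrow> P (signed (gen v) b + g)"
  shows "P g"
proof -
  have "P (rho X a)" for a
    by (induction a rule: raag_induct) (use assms(2,3) in auto)
  then show ?thesis using assms(1) by (metis rho_par)
qed

lemma par_empty: "par {} = {0}"
proof -
  have "g = 0" if "g \<in> par {}" for g :: "'a raag"
    using that by (induction rule: par_induct) auto
  then show ?thesis by auto
qed

lemma par_finite: obtains X where "finite X" "g \<in> par X"
proof -
  have "\<exists>X. finite X \<and> g \<in> par X"
  proof (induction g rule: raag_induct)
    case (plus v b g)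
    then obtain X where "finite X" "g \<in> par X" by blast
    then have "finite (insert v X)" "g \<in> par (insert v X)" by (auto intro: par_mono)
    then show ?case by (intro exI[of _ "insert v X"]) simp
  qed auto
  then show ?thesis using that by blast
qed

text \<open>An element involves finitely many vertices, and the unwanted ones can be removed one at
  a time by intersecting. This reduces membership in a parabolic to a single vertex
  \<open>a\<close>, hence to the Bass-Serre tree of \<open>a\<close>, where
  \<open>par (- {a})\<close> is a vertex stabiliser.\<close>

lemma par_avoid:
  assumes "\<And>a. a \<notin> Y \<Longrightarrow> g \<in> par (- {a})"
  shows "g \<in> par Y"
proof -
  obtain X where X: "finite X" "g \<in> par X" by (rule par_finite)
  have "g \<in> par (X - F)" if "finite F" "F \<inter> Y = {}" for F
    using that
  proof (induction F rule: finite_induct)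
    case empty
    show ?case using X by simp
  next
    case (insert a F)
    then have "g \<in> par ((X - F) \<inter> - {a})" using assms par_Int by auto
    moreover have "(X - F) \<inter> - {a} = X - insert a F" by blast
    ultimately show ?case by simp
  qed
  from this[of "X - Y"] X have "g \<in> par (X - (X - Y))" by blast
  then show ?thesis by (rule par_mono) blast
qed

text \<open>The exponent sum of \<open>v\<close>. Being invariant under conjugation, it reads off
  the vertex of a conjugate and excludes membership in conjugates of parabolics that omit
  \<open>v\<close>.\<close>

definition expo :: "'v::graph \<Rightarrow> 'v raag \<Rightarrow> int" where
  "expo v = lift (\<lambda>w. if w = v then 1 else 0)"

lemma expo_simps [simp]:
  "expo v 0 = 0" "expo v (a + b) = expo v a + expo v b" "expo v (- a) = - expo v a"
  "expo v (gen w) = (if w = v then 1 else 0)"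
proof -
  have "adj_compatible (\<lambda>w. if w = v then 1 else 0 :: int)"
    by (simp add: adj_compatible_def comm_def)
  then show "expo v 0 = 0" "expo v (a + b) = expo v a + expo v b" "expo v (- a) = - expo v a"
    "expo v (gen w) = (if w = v then 1 else 0)"
    by (simp_all add: expo_def lift_simps)
qed

lemma expo_signed [simp]: "expo v (signed a b) = (if b then expo v a else - expo v a)"
  by (simp add: signed_def)

lemma expo_cj [simp]: "expo v (cj h a) = expo v a"
  by (simp add: cj_def)

lemma expo_par: "g \<in> par X \<Longrightarrow> v \<notin> X \<Longrightarrow> expo v g = 0"
  by (induction rule: par_induct) auto

lemma gen_in_par_iff [simp]: "gen v \<in> par X \<longleftrightarrow> v \<in> X"
  using expo_par[of "gen v" X v] by auto

lemma gen_eq_iff [simp]: "gen v = gen w \<longleftrightarrow> v = w"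
proof
  assume "gen v = gen w"
  then have "expo v (gen v) = expo v (gen w)" by simp
  then show "v = w" by (simp split: if_splits)
qed simp

lemma comm_par:
  assumes "\<And>x. x \<in> X \<Longrightarrow> comm c (gen x)" "g \<in> par X"
  shows "comm c g"
  using assms(2) by (induction rule: par_induct) (auto intro!: comm_plus' simp: assms(1))

definition joined :: "'v::graph set \<Rightarrow> 'v set \<Rightarrow> bool" where
  "joined X Y \<longleftrightarrow> (\<forall>x\<in>X. \<forall>y\<in>Y. adj x y)"

lemma joined_sym: "joined X Y \<Longrightarrow> joined Y X"
  unfolding joined_def using adj_sym by blast

lemma joined_disjoint: "joined X Y \<Longrightarrow> X \<inter> Y = {}"
  unfolding joined_def using adj_irrefl by blast

lemma comm_joined:
  assumes "joined X Y" "g \<in> par X" "h \<in> par Y"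
  shows "comm g h"
proof (rule comm_par[OF _ assms(3)])
  fix y assume "y \<in> Y"
  have "comm (gen y) g"
  proof (rule comm_par[OF _ assms(2)])
    fix x assume "x \<in> X"
    then have "adj x y" using assms(1) \<open>y \<in> Y\<close> by (simp add: joined_def)
    then show "comm (gen y) (gen x)" by (rule comm_sym[OF comm_gen])
  qed
  then show "comm g (gen y)" by (rule comm_sym)
qed

lemma joined_split:
  assumes j: "joined X Y" and g: "g \<in> par (X \<union> Y)"
  shows "g = rho X g + rho Y g"
  using g
proof (induction rule: par_induct)
  case (plus v b g)
  show ?case
  proof (cases "v \<in> X")
    case True
    then have "v \<notin> Y" using joined_disjoint[OF j] by blast
    then show ?thesis using True plus by (simp add: add.assoc)
  next
    case False
    then have "v \<in> Y" using plus by blast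
    then have "comm (signed (gen v) b) (rho X g)"
      using comm_joined[OF joined_sym[OF j]] by simp
    then have "signed (gen v) b + (rho X g + rho Y g) = rho X g + (signed (gen v) b + rho Y g)"
      by (simp add: comm_def add.assoc[symmetric])
    with arg_cong[OF plus(3), of "(+) (signed (gen v) b)"]
    have "signed (gen v) b + g = rho X g + (signed (gen v) b + rho Y g)" by (rule trans)
    moreover have "rho X (signed (gen v) b + g) = rho X g"
      "rho Y (signed (gen v) b + g) = signed (gen v) b + rho Y g"
      using False \<open>v \<in> Y\<close> by simp_all
    ultimately show ?thesis by (simp only:)
  qed
qed simp

definition lk :: "'v::graph \<Rightarrow> 'v set" where "lk v = {w. adj v w}"
definition st :: "'v::graph \<Rightarrow> 'v set" where "st v = insert v (lk v)"
definition perp :: "'v::graph set \<Rightarrow> 'v set" where "perp X = {w. \<forall>x\<in>X. adj w x}"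

lemma lk_irrefl [simp]: "v \<notin> lk v" and st_self [simp]: "v \<in> st v"
  by (simp_all add: lk_def st_def)

lemma joined_perp: "joined X (perp X)"
  unfolding joined_def perp_def using adj_sym by blast

lemma comm_gen_lk: "g \<in> par (lk v) \<Longrightarrow> comm g (gen v)"
  using comm_joined[of "lk v" "{v}" g "gen v"] by (simp add: joined_def lk_def adj_sym)

lemma comm_gen_st: "g \<in> par (st v) \<Longrightarrow> comm g (gen v)"
  by (rule comm_sym, rule comm_par[of "st v"]) (auto simp: st_def lk_def intro: comm_gen)

section \<open>The Bass-Serre tree of a vertex\<close>

context
  fixes t :: "'v::graph"
begin

text \<open>The group is viewed as an HNN extension with base group \<open>tbase\<close>, stable
  letter \<open>t\<close> and associated subgroup \<open>tedge\<close>, which \<open>t\<close>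
  centralises. For this reason one family of coset representatives serves both directions of
  \<open>t\<close>.\<close>

abbreviation (input) "tbase \<equiv> par (- {t})"
abbreviation (input) "tedge \<equiv> par (lk t)"

lemma tedge_subset: "a \<in> tedge \<Longrightarrow> a \<in> tbase"
  by (rule par_mono) auto

text \<open>A transversal of the left cosets of \<open>tedge\<close>. The coset \<open>tedge\<close>
  itself is represented by \<open>0\<close>, so that possible backtracking can be recognised by
  \<open>r = 0\<close>.\<close>

definition crep :: "'v raag \<Rightarrow> 'v raag" where
  "crep b = (if b \<in> tedge then 0 else SOME r. - b + r \<in> tedge)"

lemma crep_diff: "- b + crep b \<in> tedge"
proof (cases "b \<in> tedge")
  case False
  have "- b + b \<in> tedge" by simp
  then show ?thesis using False unfolding crep_def by (simp only: if_False) (rule someI)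
qed (simp add: crep_def)

lemma crep_diff': "- crep b + b \<in> tedge"
  using crep_diff[of b] par_simps(3)[of "- b + crep b" "lk t"] by (simp add: minus_add)

lemma crep_cong:
  assumes "- b + c \<in> tedge"
  shows "crep b = crep c"
proof -
  have *: "- b + x \<in> tedge \<longleftrightarrow> - c + x \<in> tedge" for x
  proof -
    have "- b + x = (- b + c) + (- c + x)" by (simp add: add.assoc)
    then show ?thesis using par_add_left_iff[OF assms] by metis
  qed
  have "b \<in> tedge \<longleftrightarrow> c \<in> tedge" using *[of 0] by simp
  then show ?thesis unfolding crep_def * by simp
qed

lemma crep_eq_zero_iff: "crep b = 0 \<longleftrightarrow> b \<in> tedge"
  using crep_diff[of b] by (auto simp: crep_def)

lemma crep_crep [simp]: "crep (crep b) = crep b"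
  using crep_cong[OF crep_diff] by simp

lemma crep_base: "b \<in> tbase \<Longrightarrow> crep b \<in> tbase"
  using tedge_subset[OF crep_diff[of b]] par_add_left_iff[of "- b" "- {t}"] by simp

lemma crep_tedge_left: "a \<in> tedge \<Longrightarrow> crep (a + b) = 0 \<longleftrightarrow> crep b = 0"
  by (simp add: crep_eq_zero_iff par_add_left_iff)

text \<open>A vertex of the tree is encoded by the path leading to it from the base vertex: the coset representatives
  modulo the edge group, each with the sign of the following power of the stable letter \<open>t\<close>.\<close>

type_synonym 'w tseq = "('w raag \<times> bool) list"

fun valid :: "'v tseq \<Rightarrow> bool" where
  "valid [] = True"
| "valid ((r, e) # s) \<longleftrightarrow> r \<in> tbase \<and> crep r = r \<and> valid s \<and>
     (case s of [] \<Rightarrow> True | (r', e') # _ \<Rightarrow> \<not> (r' = 0 \<and> e' = (\<not> e)))"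

text \<open>Left multiplication on a normal form: \<open>b + r\<close> is split into its
  representative and a remainder in \<open>tedge\<close>; the remainder commutes with
  \<open>t\<close> and is passed on to the next entry.\<close>

fun base_act :: "'v raag \<Rightarrow> 'v tseq \<Rightarrow> 'v tseq" where
  "base_act b [] = []"
| "base_act b ((r, e) # s) = (crep (b + r), e) # base_act (- crep (b + r) + (b + r)) s"

fun shift :: "bool \<Rightarrow> 'v tseq \<Rightarrow> 'v tseq" where
  "shift e [] = [(0, e)]"
| "shift e ((r, e') # s) = (if r = 0 \<and> e' = (\<not> e) then s else (0, e) # (r, e') # s)"

lemma base_act_valid: "valid s \<Longrightarrow> b \<in> tbase \<Longrightarrow> valid (base_act b s)"
proof (induction s arbitrary: b)
  case (Cons x s)
  obtain r e where x: "x = (r, e)" by (cases x)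
  let ?a = "- crep (b + r) + (b + r)"
  have a: "?a \<in> tedge" by (rule crep_diff')
  have br: "b + r \<in> tbase" using Cons.prems by (simp add: x)
  show ?case
    using Cons.IH[of ?a] Cons.prems a br
    by (cases s) (auto simp: x crep_base tedge_subset crep_tedge_left)
qed simp

lemma base_act_plus:
  "valid s \<Longrightarrow> b \<in> tbase \<Longrightarrow> c \<in> tbase \<Longrightarrow> base_act (b + c) s = base_act b (base_act c s)"
proof (induction s arbitrary: b c)
  case (Cons x s)
  obtain r e where x: "x = (r, e)" by (cases x)
  let ?a = "- crep (c + r) + (c + r)"
  have a: "?a \<in> tedge" by (rule crep_diff')
  have e: "crep (b + (c + r)) = crep (b + crep (c + r))"
    by (rule crep_cong) (use crep_diff[of "c + r"] in \<open>simp add: minus_add add.assoc\<close>)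
  let ?b = "- crep (b + crep (c + r)) + (b + crep (c + r))"
  have b: "?b \<in> tedge" by (rule crep_diff')
  have "base_act (?b + ?a) s = base_act ?b (base_act ?a s)"
    using Cons.IH[of ?b ?a] Cons.prems a b tedge_subset by (simp add: x)
  moreover have "?b + ?a = - crep (b + (c + r)) + (b + (c + r))"
    unfolding e by (simp add: add.assoc)
  ultimately show ?case by (simp add: x e add.assoc)
qed simp

lemma base_act_zero: "valid s \<Longrightarrow> base_act 0 s = s"
  by (induction s) auto

lemma shift_valid: "valid s \<Longrightarrow> valid (shift e s)"
  by (cases s) (auto simp: crep_eq_zero_iff)

lemma shift_shift: "valid s \<Longrightarrow> shift e (shift (\<not> e) s) = s"
proof (cases s)
  case (Cons x s')
  obtain r e' where x: "x = (r, e')" by (cases x)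
  assume "valid s"
  then show ?thesis by (cases s') (auto simp: Cons x)
qed simp

lemma base_act_shift: "valid s \<Longrightarrow> a \<in> tedge \<Longrightarrow> base_act a (shift e s) = shift e (base_act a s)"
proof (cases s)
  case (Cons x s')
  obtain r e' where x: "x = (r, e')" by (cases x)
  assume v: "valid s" and a: "a \<in> tedge"
  have "crep a = 0" using a by (simp add: crep_eq_zero_iff)
  moreover have "crep (a + r) = 0 \<longleftrightarrow> r = 0" using crep_tedge_left[OF a, of r] v by (simp add: Cons x)
  ultimately show ?thesis by (auto simp: Cons x)
qed (auto simp: crep_eq_zero_iff)

definition tletter :: "'v \<Rightarrow> bool \<Rightarrow> 'v tseq \<Rightarrow> 'v tseq" where
  "tletter v e s = (if v = t then shift e s else base_act (signed (gen v) e) s)"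

lemma tletter_commute:
  assumes "valid s" "adj v w" "v \<noteq> t"
  shows "tletter v b (tletter w c s) = tletter w c (tletter v b s)"
proof (cases "w = t")
  case True
  then have "signed (gen v) b \<in> tedge" using assms by (simp add: lk_def adj_sym)
  then show ?thesis using assms True by (simp add: tletter_def base_act_shift)
next
  case False
  have "comm (signed (gen v) b) (signed (gen w) c)" using assms by (simp add: comm_gen)
  then have "signed (gen v) b + signed (gen w) c = signed (gen w) c + signed (gen v) b"
    by (simp add: comm_def)
  then show ?thesis
    using assms False base_act_plus[of s "signed (gen v) b" "signed (gen w) c"]
      base_act_plus[of s "signed (gen w) c" "signed (gen v) b"]
    by (simp add: tletter_def)
qed

interpretation tree: letter_action tletter "Collect valid"
proof
  fix s :: "'v tseq" and v :: 'v and b assume s: "s \<in> Collect valid"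
  then show "tletter v b s \<in> Collect valid"
    by (simp add: tletter_def shift_valid base_act_valid)
  show "tletter v b (tletter v (\<not> b) s) = s"
    using s base_act_plus[of s "signed (gen v) b" "signed (gen v) (\<not> b)"]
    by (auto simp: tletter_def shift_shift base_act_zero)
next
  fix s :: "'v tseq" and v w :: 'v and b c assume s: "s \<in> Collect valid" and "adj v w"
  then have "v \<noteq> w" by auto
  then consider "v \<noteq> t" | "w \<noteq> t" by blast
  then show "tletter v b (tletter w c s) = tletter w c (tletter v b s)"
    using s tletter_commute[of s v w b c] tletter_commute[of s w v c b] \<open>adj v w\<close> adj_sym[of v w]
    by cases auto
qed

definition tact :: "'v raag \<Rightarrow> 'v tseq \<Rightarrow> 'v tseq" where
  "tact = raag_act tletter"

lemma tact_plus: "valid s \<Longrightarrow> tact (g + h) s = tact g (tact h s)"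
  and tact_valid: "valid s \<Longrightarrow> valid (tact g s)"
  and tact_zero: "valid s \<Longrightarrow> tact 0 s = s"
  and tact_signed_gen: "valid s \<Longrightarrow> tact (signed (gen v) e) s = tletter v e s"
  using tree.raag_act_plus tree.raag_act_closed tree.raag_act_zero tree.raag_act_signed_gen
  by (simp_all add: tact_def)

lemma tact_base: "b \<in> tbase \<Longrightarrow> valid s \<Longrightarrow> tact b s = base_act b s"
proof (induction arbitrary: s rule: par_induct)
  case (plus v c b)
  then show ?case
    by (simp add: tact_plus tact_signed_gen base_act_valid tletter_def base_act_plus)
qed (simp add: tact_zero base_act_zero)

fun tval :: "'v tseq \<Rightarrow> 'v raag" where
  "tval [] = 0"
| "tval ((r, e) # s) = r + (signed (gen t) e + tval s)"

lemma tval_append: "tval (s @ s') = tval s + tval s'"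
  by (induction s rule: tval.induct) (auto simp: add.assoc)

lemma tval_base_act:
  "valid s \<Longrightarrow> b \<in> tbase \<Longrightarrow> - tval (base_act b s) + (b + tval s) \<in> tbase"
proof (induction s arbitrary: b)
  case (Cons x s)
  obtain r e where x: "x = (r, e)" by (cases x)
  let ?a = "- crep (b + r) + (b + r)"
  have a: "?a \<in> tedge" by (rule crep_diff')
  then have "comm ?a (signed (gen t) e)" by (simp add: comm_gen_lk)
  then have "?a + (signed (gen t) e + tval s) = signed (gen t) e + (?a + tval s)"
    by (simp add: comm_def add.assoc[symmetric])
  then have "- tval (base_act b (x # s)) + (b + tval (x # s)) = - tval (base_act ?a s) + (?a + tval s)"
    by (simp add: x minus_add add.assoc)
  then show ?case using Cons.IH[of ?a] Cons.prems a tedge_subset by (simp add: x)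
qed simp

lemma tval_shift: "tval (shift e s) = signed (gen t) e + tval s"
  by (cases "(e, s)" rule: shift.cases) auto

text \<open>The path records \<open>g\<close> up to right multiplication by the base group, that is,
  the vertex of the tree belonging to the coset of \<open>g\<close>. The stabiliser of the base
  vertex is computed from this.\<close>

lemma tval_tact: "- tval (tact g []) + g \<in> tbase"
proof (induction g rule: raag_induct)
  case (plus v b g)
  let ?s = "tact g []"
  have v: "valid ?s" by (simp add: tact_valid)
  have "tact (signed (gen v) b + g) [] = tletter v b ?s"
    using v by (simp add: tact_plus tact_signed_gen)
  moreover have "- tval (tletter v b ?s) + (signed (gen v) b + g) \<in> tbase"
  proof (cases "v = t")
    case True
    then show ?thesis using plus by (simp add: tletter_def tval_shift minus_add add.assoc)
  next
    case False
    let ?b = "signed (gen v) b"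
    have "- tval (base_act ?b ?s) + (?b + g)
        = (- tval (base_act ?b ?s) + (?b + tval ?s)) + (- tval ?s + g)"
      by (simp add: add.assoc)
    moreover have "- tval (base_act ?b ?s) + (?b + tval ?s) \<in> tbase"
      using False v by (intro tval_base_act) auto
    ultimately show ?thesis using plus False by (simp add: tletter_def)
  qed
  ultimately show ?case by simp
qed (simp add: tact_zero)

lemma tact_Nil_iff: "tact g [] = [] \<longleftrightarrow> g \<in> tbase"
proof
  assume "tact g [] = []"
  then show "g \<in> tbase" using tval_tact[of g] by simp
qed (simp add: tact_base)

lemma tact_eq_iff: "tact g [] = tact h [] \<longleftrightarrow> - g + h \<in> tbase"
proof -
  have "tact h [] = tact g (tact (- g + h) [])"
    using tact_plus[of "[]" g "- g + h"] by simp
  moreover have "tact (- g + h) [] = tact (- g) (tact h [])" by (simp add: tact_plus)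
  moreover have "tact (- g) (tact g []) = []"
    using tact_plus[of "[]" "- g" g] by (simp add: tact_zero)
  ultimately show ?thesis by (metis tact_Nil_iff)
qed

lemma valid_appendD: "valid (s @ s') \<Longrightarrow> valid s \<and> valid s'"
proof (induction s)
  case (Cons x s)
  then show ?case by (cases x; cases s) auto
qed simp

lemma tact_tval: "valid (s @ s') \<Longrightarrow> tact (tval s) s' = s @ s'"
proof (induction s)
  case (Cons x s)
  obtain r e where x: "x = (r, e)" by (cases x)
  have v: "valid (s @ s')" "valid s'" and r: "r \<in> tbase" "crep r = r"
    using Cons.prems valid_appendD[of s s'] by (simp_all add: x)
  have "shift e (s @ s') = (0, e) # s @ s'"
    using Cons.prems by (cases "s @ s'") (auto simp: x)
  moreover have "valid ((0, e) # s @ s')"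
    using Cons.prems by (simp add: x crep_eq_zero_iff)
  ultimately show ?case using Cons.IH v r
    by (simp add: x tact_plus tact_valid tact_signed_gen tletter_def tact_base base_act_zero)
qed (simp add: tact_zero)

text \<open>A base element that also fixes the vertex \<open>k\<close> of the tree fixes the first edge on the way.\<close>

lemma tree_first_edge:
  assumes "k \<notin> tbase"
  obtains h where "h \<in> tbase" "\<And>w. w \<in> tbase \<Longrightarrow> cj k w \<in> tbase \<Longrightarrow> cj h w \<in> tedge"
proof -
  have "tact k [] \<noteq> []" using assms by (simp add: tact_Nil_iff)
  then obtain r e s where s: "tact k [] = (r, e) # s" by (metis neq_Nil_conv surj_pair)
  have v: "valid ((r, e) # s)" using tact_valid[of "[]" k] by (simp add: s)
  have "cj r w \<in> tedge" if w: "w \<in> tbase" "cj k w \<in> tbase" for w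
  proof -
    have "tact (w + k) [] = tact k []"
      using w(2) by (subst tact_eq_iff) (simp add: cj_def minus_add add.assoc
          flip: par_simps(3)[of "- k + (w + k)" "- {t}"])
    then have "crep (w + r) = r"
      using w v by (simp add: tact_plus s tact_base tact_valid)
    then show ?thesis using crep_diff'[of "w + r"] by (simp add: cj_def add.assoc)
  qed
  then show ?thesis using that[of r] v by simp
qed

end

section \<open>Translations in 0-hyperbolic metrics\<close>

definition npow :: "nat \<Rightarrow> 'g::group_add \<Rightarrow> 'g" where
  "npow n g = ((+) g ^^ n) 0"

lemma npow_0 [simp]: "npow 0 g = 0"
  and npow_Suc: "npow (Suc n) g = g + npow n g"
  by (simp_all add: npow_def)

lemma npow_1 [simp]: "npow (Suc 0) g = g"
  by (simp add: npow_Suc)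

lemma npow_add: "npow (m + n) g = npow m g + npow n g"
  by (induction m) (simp_all add: npow_Suc add.assoc)

lemma comm_npow: "comm a b \<Longrightarrow> comm a (npow n b)"
  by (induction n) (simp_all add: npow_Suc comm_plus')

lemma expo_npow [simp]: "expo v (npow n g) = int n * expo v g"
  by (induction n) (simp_all add: npow_Suc algebra_simps)

lemma rho_npow [simp]: "rho X (npow n g) = npow n (rho X g)"
  by (induction n) (simp_all add: npow_Suc)

lemma par_npow [simp]: "g \<in> par X \<Longrightarrow> npow n g \<in> par X"
  by (simp add: par_def)

lemma cj_npow [simp]: "cj h (npow n g) = npow n (cj h g)"
  by (induction n) (simp_all add: npow_Suc)

text \<open>On the centraliser of a translation \<open>b\<close> the position along
  the axis of \<open>b\<close> is additive, so commutators of the centraliser fix the axis.\<close>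

locale tree_metric =
  fixes d :: "'g::group_add \<Rightarrow> 'g \<Rightarrow> int"
  assumes left_inv: "d (k + g) (k + h) = d g h"
    and sym: "d g h = d h g"
    and refl: "d g g = 0"
    and tri: "d g k \<le> d g h + d h k"
    and four: "d x y + d z w \<le> max (d x z + d y w) (d x w + d y z)"
begin

lemma nonneg: "0 \<le> d g h"
  using tri[of g g h] sym[of g h] refl[of g] by simp

end

locale tree_translation = tree_metric d for d :: "'g::group_add \<Rightarrow> 'g \<Rightarrow> int" +
  fixes b :: 'g and r :: int
  assumes r_pos: "r > 0" and translation: "d 0 (npow n b) = int n * r"
begin

abbreviation "p n \<equiv> npow n b"

text \<open>\<open>\<tau>\<close> is the position of \<open>c\<close> on the axis of
  \<open>b\<close>, read off as a Busemann coordinate: far out at both ends the distances differ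
  from \<open>int N * r\<close> by \<open>\<tau>\<close> with opposite signs. That the two
  equalities are exact also says that \<open>c\<close> lies on the axis.\<close>

definition on_line :: "'g \<Rightarrow> int \<Rightarrow> bool" where
  "on_line c \<tau> \<longleftrightarrow> (\<exists>N0. \<forall>N\<ge>N0. d c (p N) = int N * r - \<tau> \<and> d c (- p N) = int N * r + \<tau>)"

lemma d_neg: "d (- p n) 0 = int n * r"
  using left_inv[of "p n" "- p n" 0] translation[of n] by simp

lemma d_opposite: "d (- p n) (p n) = 2 * (int n * r)"
  using left_inv[of "p n" "- p n" "p n"] translation[of "n + n"] by (simp add: npow_add algebra_simps)

text \<open>\<open>c\<close> is the midpoint of \<open>c + - p N\<close> and \<open>c + p N\<close>,
  and because \<open>c\<close> commutes with \<open>b\<close> these points are at distance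
  \<open>d 0 c\<close> from \<open>- p N\<close> and \<open>p N\<close>. Once the segment is long
  compared with \<open>d 0 c\<close>, the four-point condition transfers the betweenness to the
  segment from \<open>- p N\<close> to \<open>p N\<close>.\<close>

lemma between:
  assumes c: "comm c b" and N: "int N * r > d 0 c"
  shows "d (- p N) c + d c (p N) = 2 * (int N * r)"
proof -
  let ?a = "c + - p N" and ?e = "c + p N"
  have cp: "comm c (p N)" using c by (rule comm_npow)
  have 1: "d ?a c = int N * r" "d c ?e = int N * r" "d ?a ?e = 2 * (int N * r)"
    using left_inv[of c "- p N" 0] left_inv[of c 0 "p N"] left_inv[of c "- p N" "p N"]
    by (simp_all add: d_neg translation d_opposite)
  have "c + p N = p N + c" "c + - p N = - p N + c"
    using cp comm_uminus_iff(2)[of c "p N"] by (simp_all add: comm_def)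
  then have 2: "d ?e (p N) = d 0 c" "d ?a (- p N) = d 0 c"
    using left_inv[of "p N" c 0] left_inv[of "- p N" c 0] by (simp_all add: sym[of 0 c])
  have nn: "0 \<le> d c (p N)" "0 \<le> d (- p N) c" by (simp_all add: nonneg)
  have "d ?a ?e + d c (p N) \<le> max (d ?a c + d ?e (p N)) (d ?a (p N) + d ?e c)"
    by (rule four)
  then have 3: "d ?a (p N) \<ge> int N * r + d c (p N)"
    using 1 2 N nn sym[of ?e c] by (auto simp: max_def mult.commute[of r] split: if_splits)
  have "d ?a (p N) + d c (- p N) \<le> max (d ?a c + d (p N) (- p N)) (d ?a (- p N) + d (p N) c)"
    by (rule four)
  then have "d c (- p N) + d c (p N) \<le> 2 * (int N * r)"
    using 1 2 3 N nn sym[of "p N" c] sym[of c "- p N"] sym[of "p N" "- p N"] d_opposite[of N]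
    by (auto simp: max_def mult.commute[of r] split: if_splits)
  moreover have "2 * (int N * r) \<le> d (- p N) c + d c (p N)"
    using tri[of "- p N" "p N" c] d_opposite[of N] by simp
  ultimately show ?thesis using sym[of c "- p N"] by simp
qed

lemma on_line_exists:
  assumes "comm c b"
  obtains \<tau> where "on_line c \<tau>"
proof -
  define N0 where "N0 = Suc (nat (d 0 c))"
  have big: "int N * r > d 0 c" if "N \<ge> N0" for N
  proof -
    have "d 0 c < int N" using that by (simp add: N0_def)
    also have "\<dots> \<le> int N * r" using r_pos by (simp add: mult_le_cancel_left1)
    finally show ?thesis .
  qed
  have step: "d g (p (Suc N)) \<le> d g (p N) + r" "d g (- p (Suc N)) \<le> d g (- p N) + r" for g N
  proof -
    have 1: "p (Suc N) = p N + b" "- p (Suc N) = - p N + - b"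
      using npow_add[of N 1 b] by simp (simp add: npow_Suc minus_add)
    have "d (p N) (p (Suc N)) = r"
      unfolding 1(1) using left_inv[of "p N" 0 b] translation[of 1] by simp
    moreover have "d (- p N) (- p (Suc N)) = r"
      unfolding 1(2) using left_inv[of "- p N" 0 "- b"] d_neg[of 1] by (simp add: sym[of 0])
    ultimately show "d g (p (Suc N)) \<le> d g (p N) + r" "d g (- p (Suc N)) \<le> d g (- p N) + r"
      using tri[of g "p (Suc N)" "p N"] tri[of g "- p (Suc N)" "- p N"] by simp_all
  qed
  \<comment> \<open>The two distances add up to \<open>2 * (int N * r)\<close> and each grows by at
    most \<open>r\<close> per step, so each grows by exactly \<open>r\<close>. The offset at
    \<open>N0\<close> is therefore valid for all later \<open>N\<close>.\<close>
  define \<tau> where "\<tau> = int N0 * r - d c (p N0)"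
  have "d c (p N) = int N * r - \<tau> \<and> d c (- p N) = int N * r + \<tau>" if "N \<ge> N0" for N
    using that
  proof (induction N rule: dec_induct)
    case base
    show ?case using between[OF assms big[of N0, OF le_refl]] sym[of c "- p N0"]
      unfolding \<tau>_def by linarith
  next
    case (step N)
    have "d (- p (Suc N)) c + d c (p (Suc N)) = 2 * (int (Suc N) * r)"
      using step by (intro between assms big) simp
    then show ?case
      using step(3) \<open>\<And>g N. d g (p (Suc N)) \<le> d g (p N) + r\<close>[of c N]
        \<open>\<And>g N. d g (- p (Suc N)) \<le> d g (- p N) + r\<close>[of c N] sym[of c "- p (Suc N)"]
      by (simp add: algebra_simps)
  qed
  then show ?thesis using that[of \<tau>] unfolding on_line_def by blast
qed

lemma on_line_dist:
  assumes "on_line c \<tau>" "on_line c' \<tau>'"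
  shows "d c c' = \<bar>\<tau> - \<tau>'\<bar>"
proof -
  obtain N where N: "d c (p N) = int N * r - \<tau>" "d c (- p N) = int N * r + \<tau>"
    "d c' (p N) = int N * r - \<tau>'" "d c' (- p N) = int N * r + \<tau>'"
    
  proof -
    obtain N1 N2 where "\<And>N. N \<ge> N1 \<Longrightarrow> d c (p N) = int N * r - \<tau> \<and> d c (- p N) = int N * r + \<tau>"
      "\<And>N. N \<ge> N2 \<Longrightarrow> d c' (p N) = int N * r - \<tau>' \<and> d c' (- p N) = int N * r + \<tau>'"
      using assms unfolding on_line_def by blast
    then show ?thesis using that[of "max N1 N2"] by simp
  qed
  have "d c c' + d (p N) (- p N) \<le> max (d c (p N) + d c' (- p N)) (d c (- p N) + d c' (p N))"
    by (rule four)
  then have "d c c' \<le> \<bar>\<tau> - \<tau>'\<bar>"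
    using N d_opposite[of N] sym[of "p N" "- p N"] by (auto simp: max_def mult.commute[of r] split: if_splits)
  moreover have "\<bar>\<tau> - \<tau>'\<bar> \<le> d c c'"
    using tri[of c "p N" c'] tri[of c' "p N" c] N sym[of c c'] by simp
  ultimately show ?thesis by simp
qed

lemma on_line_shift:
  assumes "comm c b" "on_line c \<tau>"
  shows "on_line (c + p M) (\<tau> + int M * r)"
proof -
  obtain N0 where N0: "\<And>N. N \<ge> N0 \<Longrightarrow> d c (p N) = int N * r - \<tau> \<and> d c (- p N) = int N * r + \<tau>"
    using assms(2) unfolding on_line_def by blast
  have cp: "c + p M = p M + c" using comm_npow[OF assms(1)] by (simp add: comm_def)
  have "d (c + p M) (p N) = int N * r - (\<tau> + int M * r)"
    "d (c + p M) (- p N) = int N * r + (\<tau> + int M * r)" if "N \<ge> N0 + M" for N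
  proof -
    have "p N = p M + p (N - M)" using npow_add[of M "N - M" b] that by simp
    then have "d (c + p M) (p N) = d c (p (N - M))" unfolding cp by (simp add: left_inv)
    then show "d (c + p M) (p N) = int N * r - (\<tau> + int M * r)"
      using N0[of "N - M"] that by (simp add: of_nat_diff algebra_simps)
    have "- p N = p M + - p (N + M)" by (simp add: npow_add minus_add)
    then have "d (c + p M) (- p N) = d c (- p (N + M))" unfolding cp by (simp only: left_inv)
    then show "d (c + p M) (- p N) = int N * r + (\<tau> + int M * r)"
      using N0[of "N + M"] that by (simp add: algebra_simps)
  qed
  then show ?thesis unfolding on_line_def by blast
qed

lemma on_line_zero: "on_line 0 0"
  unfolding on_line_def using translation d_neg sym[of 0] by simp

text \<open>Applying \<open>- z\<close> turns the distance from \<open>z + z'\<close> to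
  \<open>p N\<close> into the distance from \<open>z'\<close> to \<open>- z + p N\<close>, whose
  position is known from \<open>on_line_shift\<close>. For large \<open>N\<close> the sign of the
  difference of positions is known, so the absolute value disappears.\<close>

lemma on_line_add_aux:
  assumes z: "comm z b" "comm z' b"
    and l: "on_line (- z) \<mu>" "on_line z' \<tau>'" "on_line (z + z') \<sigma>"
  shows "\<sigma> = \<tau>' - \<mu>"
proof -
  obtain N0 where N0: "\<And>N. N \<ge> N0 \<Longrightarrow> d (z + z') (p N) = int N * r - \<sigma>"
    using l(3) unfolding on_line_def by blast
  define N where "N = N0 + nat \<bar>\<tau>' - \<mu>\<bar>"
  have "int N \<le> int N * r" using r_pos by (simp add: mult_le_cancel_left1)
  then have big: "\<bar>\<tau>' - \<mu>\<bar> \<le> int N * r" by (simp add: N_def)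
  have "d (z + z') (p N) = d z' (- z + p N)"
    using left_inv[of "- z" "z + z'" "p N"] by simp
  also have "\<dots> = \<bar>\<tau>' - (\<mu> + int N * r)\<bar>"
    using on_line_dist[OF l(2) on_line_shift[OF _ l(1), of N]] z by simp
  finally show ?thesis using N0[of N] big by (simp add: N_def)
qed

theorem commutator_fixes:
  assumes "comm z b" "comm z' b"
  shows "d (z + z') (z' + z) = 0"
proof -
  have add: "\<sigma> = \<tau> + \<tau>'" if "comm x b" "comm x' b" "on_line x \<tau>" "on_line x' \<tau>'" "on_line (x + x') \<sigma>"
    for x x' \<tau> \<tau>' \<sigma>
  proof -
    obtain \<mu> where "on_line (- x) \<mu>" using on_line_exists[of "- x"] \<open>comm x b\<close> by auto
    \<comment> \<open>The instance with \<open>0\<close> in place of \<open>x'\<close> gives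
      \<open>\<tau> = - \<mu>\<close>, which eliminates the unknown position of
      \<open>- x\<close>.\<close>
    then show ?thesis
      using on_line_add_aux[of x x' \<mu> \<tau>' \<sigma>] on_line_add_aux[of x 0 \<mu> 0 \<tau>] that on_line_zero by simp
  qed
  obtain \<tau> where l1: "on_line z \<tau>" using on_line_exists assms(1) .
  obtain \<tau>' where l2: "on_line z' \<tau>'" using on_line_exists assms(2) .
  obtain \<sigma> where l3: "on_line (z + z') \<sigma>" using on_line_exists[OF comm_plus[OF assms]] .
  obtain \<sigma>' where l4: "on_line (z' + z) \<sigma>'" using on_line_exists[OF comm_plus[OF assms(2,1)]] .
  have "\<sigma> = \<tau> + \<tau>'" "\<sigma>' = \<tau>' + \<tau>" 
    using add[OF assms l1 l2 l3] add[OF assms(2,1) l2 l1 l4] by auto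
  then have "\<sigma> = \<sigma>'" by linarith
  then show ?thesis using on_line_dist[OF l3 l4] by simp
qed

end

section \<open>The path metric of the tree in terms of common prefixes\<close>

fun lcp :: "'x list \<Rightarrow> 'x list \<Rightarrow> nat" where
  "lcp (x # xs) (y # ys) = (if x = y then Suc (lcp xs ys) else 0)"
| "lcp _ _ = 0"

lemma lcp_sym: "lcp xs ys = lcp ys xs"
  by (induction xs ys rule: lcp.induct) auto

lemma lcp_self [simp]: "lcp xs xs = length xs"
  by (induction xs) auto

lemma lcp_Nil [simp]: "lcp [] xs = 0"
  by (cases xs; simp)

lemma lcp_le: "lcp xs ys \<le> length xs"
  by (induction xs ys rule: lcp.induct) auto

lemma lcp_ultra: "lcp xs ys \<le> lcp xs zs \<or> lcp ys zs \<le> lcp xs zs"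
proof (induction xs arbitrary: ys zs)
  case (Cons x xs)
  then show ?case by (cases ys; cases zs) auto
qed simp

lemma lcp_eq_length: "lcp xs ys = length xs \<Longrightarrow> lcp xs ys = length ys \<Longrightarrow> xs = ys"
  by (induction xs ys rule: lcp.induct) (auto split: if_splits)

definition tdist :: "'x list \<Rightarrow> 'x list \<Rightarrow> int" where
  "tdist s s' = int (length s) + int (length s') - 2 * int (lcp s s')"

lemma tdist_sym: "tdist s s' = tdist s' s"
  by (simp add: tdist_def lcp_sym[of s s'])

text \<open>The length of the common prefix is the Gromov product based at the root; the four-point
  condition is its ultrametric inequality \<open>lcp_ultra\<close>.\<close>

lemma tdist_four: "tdist x y + tdist z w \<le> max (tdist x z + tdist y w) (tdist x w + tdist y z)"
proof -
  have "lcp x z + lcp y w \<le> lcp x y + lcp z w \<or> lcp x w + lcp y z \<le> lcp x y + lcp z w"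
    using lcp_ultra[of x z y] lcp_ultra[of x w y] lcp_ultra[of z x w] lcp_ultra[of z y w]
    unfolding lcp_sym[of z x] lcp_sym[of z y] lcp_sym[of w y] by linarith
  then show ?thesis by (auto simp: tdist_def max_def)
qed

lemma tdist_refl [simp]: "tdist x x = 0"
  by (simp add: tdist_def)

lemma tdist_tri: "tdist x z \<le> tdist x y + tdist y z"
  using lcp_ultra[of x y z] lcp_le[of y x] lcp_le[of y z] lcp_sym[of x y]
  by (auto simp: tdist_def)

lemma tdist_eq_0: "tdist x y = 0 \<longleftrightarrow> x = y"
  using lcp_eq_length[of x y] lcp_le[of x y] lcp_le[of y x] lcp_sym[of x y] by (auto simp: tdist_def)

context
  fixes t :: "'v::graph"
begin

lemma crep_left_cancel:
  assumes "crep t (b + r) = crep t (b + r')"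
  shows "crep t r = crep t r'"
proof (rule crep_cong)
  have "- (b + r) + (b + r') = (- (b + r) + crep t (b + r)) + (- crep t (b + r') + (b + r'))"
    using assms by (simp add: add.assoc)
  also have "\<dots> \<in> par (lk t)" by (rule par_plus[OF crep_diff crep_diff'])
  finally show "- r + r' \<in> par (lk t)" by (simp add: minus_add add.assoc)
qed

lemma base_act_length [simp]: "length (base_act t b s) = length s"
  by (induction s arbitrary: b) auto

lemma base_act_lcp:
  "valid t s \<Longrightarrow> valid t s' \<Longrightarrow> lcp (base_act t b s) (base_act t b s') = lcp s s'"
proof (induction s s' arbitrary: b rule: lcp.induct)
  case (1 x xs y ys)
  obtain r e r' e' where xy: "x = (r, e)" "y = (r', e')" by (cases x; cases y)
  have "crep t (b + r) = crep t (b + r') \<longleftrightarrow> r = r'"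
    using crep_left_cancel[of b r r'] 1(2,3) by (auto simp: xy)
  then show ?case using 1 by (auto simp: xy)
qed auto

lemma tletter_tdist:
  assumes "valid t s" "valid t s'"
  shows "tdist (tletter t v e s) (tletter t v e s') = tdist s s'"
proof (cases "v = t")
  case False
  then show ?thesis using assms by (simp add: tletter_def tdist_def base_act_lcp)
next
  case True
  have shift: "shift e s = (case s of [] \<Rightarrow> [(0, e)] | x # u \<Rightarrow> if x = (0, \<not> e) then u else (0, e) # s)"
    for s :: "'v tseq"
  proof (cases s)
    case (Cons x u)
    then show ?thesis by (cases x) simp
  qed simp
  \<comment> \<open>An entry removed by \<open>shift e\<close> cannot have been followed by
    \<open>(0, e)\<close>. So a sequence that is shortened and one that is prolonged by
    \<open>(0, e)\<close> have no common prefix afterwards.\<close>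
  have start: "x \<noteq> (0, e)" if "valid t ((0, \<not> e) # x # u)" for x and u :: "'v tseq"
    using that by (cases x) auto
  show ?thesis
    using assms start unfolding tletter_def shift
    by (auto simp: True tdist_def split: list.splits)
qed

lemma tact_tdist:
  "valid t s \<Longrightarrow> valid t s' \<Longrightarrow> tdist (tact t g s) (tact t g s') = tdist s s'"
proof (induction g rule: raag_induct)
  case (plus v b g)
  then show ?case by (simp add: tact_plus tact_valid tact_signed_gen tletter_tdist)
qed (simp add: tact_zero)

definition vdist :: "'v raag \<Rightarrow> 'v raag \<Rightarrow> int" where
  "vdist g h = tdist (tact t g []) (tact t h [])"

lemma tree_metric_vdist: "tree_metric vdist"
proof
  show "vdist g h = vdist h g" for g h unfolding vdist_def by (rule tdist_sym)
qed (simp_all add: vdist_def tact_plus tact_tdist tact_valid tdist_tri tdist_four)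

lemma vdist_eq_0: "vdist g h = 0 \<longleftrightarrow> - g + h \<in> par (- {t})"
  by (simp add: vdist_def tdist_eq_0 tact_eq_iff)

lemma vdist_0: "vdist 0 g = int (length (tact t g []))"
  by (simp add: vdist_def tact_zero tdist_def)

text \<open>A conjugate of minimal displacement moves the base vertex along its axis.\<close>

lemma minimal_displacement_translation:
  assumes min: "\<And>h. length (tact t b []) \<le> length (tact t (cj h b) [])"
    and ne: "tact t b [] \<noteq> []"
  shows "length (tact t (npow n b) []) = n * length (tact t b [])"
proof -
  define S where "S = tact t b []"
  obtain r e S1 where S: "S = (r, e) # S1" using ne unfolding S_def by (metis neq_Nil_conv surj_pair)
  have v: "valid t S" by (simp add: S_def tact_valid)
  define h where "h = - tval t S + b"
  have h: "h \<in> par (- {t})" unfolding h_def S_def by (rule tval_tact)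
  have b: "b = tval t S + h" by (simp add: h_def)
  \<comment> \<open>If the last step of the path of \<open>b\<close> were undone by the first step
    of its translate, conjugating by that first step would remove both ends of the path and shorten
    the displacement by two, against minimality. Without such a pinch the translates of the path
    concatenate to normal forms.\<close>
  have no_pinch: "\<not> (snd (last S) = (\<not> e) \<and> crep t (h + r) = 0)"
  proof
    assume pinch: "snd (last S) = (\<not> e) \<and> crep t (h + r) = 0"
    then have "S1 \<noteq> []" by (auto simp: S)
    then obtain S2 r' where S1: "S1 = S2 @ [(r', \<not> e)]"
      using pinch by (cases S1 rule: rev_cases) (auto simp: S)
    have a: "h + r \<in> par (lk t)" using pinch by (simp add: crep_eq_zero_iff)
    then have "comm (h + r) (signed (gen t) e)" by (simp add: comm_gen_lk)
    then have "h + r + signed (gen t) e = signed (gen t) e + (h + r)" by (simp add: comm_def)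
    then have *: "h + (r + signed (gen t) e) = signed (gen t) e + (h + r)" by (simp add: add.assoc)
    have "cj (r + signed (gen t) e) b = tval t S2 + (r' + (h + r))"
      unfolding b by (simp add: cj_def S S1 tval_append minus_add add.assoc *)
    moreover have "r' + (h + r) \<in> par (- {t})"
      using v tedge_subset[OF a] valid_appendD[of t "(r, e) # S2" "[(r', \<not> e)]"] by (simp add: S S1)
    ultimately have "tact t (cj (r + signed (gen t) e) b) [] = tact t (tval t S2) []"
      by (simp add: tact_plus[where s = "[]"] tact_Nil_iff[THEN iffD2])
    moreover have "valid t (S2 @ [])"
      using v valid_appendD[of t "[(r, e)]" S1] valid_appendD[of t S2 "[(r', \<not> e)]"] by (simp add: S S1)
    ultimately have "length (tact t (cj (r + signed (gen t) e) b) []) = length S2"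
      using tact_tval[of t S2 "[]"] by simp
    then show False using min[of "r + signed (gen t) e"] by (simp add: S_def[symmetric] S S1)
  qed
  have "length (tact t (npow n b) []) = n * length S \<and> (\<exists>s. n > 0 \<longrightarrow> tact t (npow n b) [] = (r, e) # s)"
  proof (induction n)
    case (Suc n)
    show ?case
    proof (cases "n = 0")
      case True
      then show ?thesis by (simp add: S_def[symmetric] S)
    next
      case False
      then obtain s where s: "tact t (npow n b) [] = (r, e) # s" using Suc by blast
      let ?s = "base_act t h ((r, e) # s)"
      have vs: "valid t ((r, e) # s)" using tact_valid[of t "[]" "npow n b"] by (simp add: s)
      have vs': "valid t ?s" using vs h by (rule base_act_valid)
      have junction: "valid t (u @ ?s)" if "valid t u" "u \<noteq> [] \<Longrightarrow> snd (last u) = snd (last S)" for u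
        using that
      proof (induction u)
        case (Cons x u)
        then show ?case using no_pinch vs' by (cases x; cases u) auto
      qed (use vs' in simp)
      have "tact t (npow (Suc n) b) [] = tact t (tval t S + h) ((r, e) # s)"
        by (simp add: npow_Suc tact_plus s b[symmetric])
      also have "\<dots> = tact t (tval t S) ?s"
        using vs h by (simp only: tact_plus tact_base)
      also have "\<dots> = S @ ?s" using v junction by (intro tact_tval) blast
      finally have "tact t (npow (Suc n) b) [] = S @ ?s" .
      moreover have "length ?s = n * length S" using Suc s by simp
      ultimately show ?thesis by (simp add: S)
    qed
  qed (simp add: tact_zero)
  then show ?thesis by (simp add: S_def)
qed

text \<open>A conjugate of minimal displacement has the base vertex on its axis, so
  \<open>tree_translation\<close> applies to it. Distance \<open>0\<close> in \<open>vdist\<close>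
  then means that the commutator of the conjugated elements fixes the base vertex.\<close>

theorem centralizer_commutator_elliptic:
  assumes hyp: "\<And>h. cj h b \<notin> par (- {t})" and z: "comm z b" "comm z' b"
  obtains h where "cj h (- (z + z') + (z' + z)) \<in> par (- {t})"
proof -
  define h where "h = arg_min (\<lambda>h. length (tact t (cj h b) [])) (\<lambda>_. True)"
  have h: "length (tact t (cj h b) []) \<le> length (tact t (cj k b) [])" for k
    unfolding h_def by (rule arg_min_nat_le) simp
  let ?b = "cj h b"
  have ne: "tact t ?b [] \<noteq> []" using hyp by (simp add: tact_Nil_iff)
  have len: "length (tact t (npow n ?b) []) = n * length (tact t ?b [])" for n
    using h ne by (intro minimal_displacement_translation) simp_all
  interpret tree_metric vdist by (rule tree_metric_vdist)
  interpret tree_translation vdist ?b "int (length (tact t ?b []))"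
    by standard (use ne len in \<open>simp_all add: vdist_0\<close>)
  have "vdist (cj h z + cj h z') (cj h z' + cj h z) = 0"
    using z by (intro commutator_fixes) simp_all
  then have "cj h (- (z + z') + (z' + z)) \<in> par (- {t})" by (simp add: vdist_eq_0 minus_add)
  then show ?thesis by (rule that)
qed

end

text \<open>For \<open>a\<close> outside the star of \<open>t\<close>, the power of \<open>t\<close>
  fixes the base vertex in the tree of \<open>a\<close>, and so does its conjugate by
  \<open>w\<close>. If \<open>w\<close> moved that vertex, the power would fix an edge and be
  conjugate into \<open>par (lk a)\<close>, which the exponent sum of \<open>t\<close>
  excludes.\<close>

lemma centralizer_gen:
  assumes "n > 0" "comm (npow n (gen t)) w"
  shows "w \<in> par (st t)"
proof (rule par_avoid)
  fix a assume a: "a \<notin> st t"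
  then have ta: "t \<noteq> a" "t \<notin> lk a" using adj_sym by (auto simp: st_def lk_def)
  let ?T = "npow n (gen t)"
  show "w \<in> par (- {a})"
  proof (rule ccontr)
    assume "w \<notin> par (- {a})"
    then obtain h where h: "\<And>u. u \<in> par (- {a}) \<Longrightarrow> cj w u \<in> par (- {a}) \<Longrightarrow> cj h u \<in> par (lk a)"
      by (rule tree_first_edge) blast
    have "cj w ?T = ?T" using assms(2) by (rule cj_comm)
    then have "cj h ?T \<in> par (lk a)" using h[of ?T] ta by simp
    then have "expo t (cj h ?T) = 0" using ta by (intro expo_par)
    then show False using assms(1) by (simp del: cj_npow)
  qed
qed

lemma centralizer_gen_iff: "comm w (gen t) \<longleftrightarrow> w \<in> par (st t)"
  using centralizer_gen[of 1 t w] comm_gen_st[of w t] comm_sym by auto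

section \<open>Parabolic closures\<close>

definition cpar :: "'v::graph set \<Rightarrow> 'v raag \<Rightarrow> 'v raag set" where
  "cpar X g = cj g ` par X"

lemma cpar_iff: "y \<in> cpar X g \<longleftrightarrow> cj (- g) y \<in> par X"
proof -
  have "y = cj g (cj (- g) y)" by simp
  then show ?thesis unfolding cpar_def by (auto simp del: cj_simps(5))
qed

lemma cpar_zero [simp]: "cpar X 0 = par X"
  by (simp add: cpar_def)

lemma cj_cpar: "cj k y \<in> cpar X (g + k) \<longleftrightarrow> y \<in> cpar X g"
  by (simp add: cpar_iff minus_add add.assoc[symmetric])

lemma cpar_vertices:
  assumes "cpar X g \<subseteq> cpar Y h"
  shows "X \<subseteq> Y"
proof
  fix x assume "x \<in> X"
  then have "cj g (gen x) \<in> cpar Y h" using assms by (auto simp: cpar_def)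
  then have "cj (- h) (cj g (gen x)) \<in> par Y" by (simp only: cpar_iff)
  then show "x \<in> Y" using expo_par[of "cj (- h) (cj g (gen x))" Y x] by fastforce
qed

text \<open>Minimality is by the number of vertices, which makes existence immediate; that the
  subgroup is least under inclusion is the content of \<open>pcl_least\<close>. The conjugator
  \<open>g\<close> is not determined by \<open>y\<close>, only the subgroup \<open>cpar X g\<close>
  is.\<close>

definition pcl :: "'v::graph raag \<Rightarrow> 'v set \<Rightarrow> 'v raag \<Rightarrow> bool" where
  "pcl y X g \<longleftrightarrow> finite X \<and> y \<in> cpar X g \<and> (\<forall>Y h. finite Y \<longrightarrow> y \<in> cpar Y h \<longrightarrow> card X \<le> card Y)"

lemma pcl_exists: obtains X g where "pcl y X g"
proof -
  let ?Q = "\<lambda>(X, g). finite X \<and> y \<in> cpar X g"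
  obtain X0 where X0: "finite X0" "y \<in> par X0" by (rule par_finite)
  then have q: "?Q (X0, 0)" by simp
  obtain X g where Xg: "arg_min (card \<circ> fst) ?Q = (X, g)" by (cases "arg_min (card \<circ> fst) ?Q")
  have "?Q (X, g)" using arg_min_natI[of ?Q, OF q, of "card \<circ> fst"] Xg by simp
  moreover have "card X \<le> card Y" if "finite Y" "y \<in> cpar Y h" for Y h
    using arg_min_nat_le[of ?Q "(Y, h)" "card \<circ> fst"] that Xg by simp
  ultimately show ?thesis using that[of X g] unfolding pcl_def by auto
qed

lemma pcl_cj: "pcl y X g \<Longrightarrow> pcl (cj k y) X (g + k)"
proof -
  assume p: "pcl y X g"
  have "card X \<le> card Y" if "finite Y" "cj k y \<in> cpar Y h" for Y h
  proof -
    have "y \<in> cpar Y (h + - k)" using that(2) cj_cpar[of k y Y "h + - k"] by (simp add: add.assoc)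
    then show ?thesis using p that(1) unfolding pcl_def by blast
  qed
  then show ?thesis using p by (simp add: pcl_def cj_cpar)
qed

lemma pcl_base: "pcl y X g \<longleftrightarrow> pcl (cj (- g) y) X 0"
  using pcl_cj[of y X g "- g"] pcl_cj[of "cj (- g) y" X 0 g] by auto

text \<open>\<open>cj (- h) y\<close> lies in \<open>par Y\<close> and hence equals its own
  retraction; this exhibits \<open>y\<close> as a conjugate of \<open>rho Y y\<close>, an element of
  \<open>par (X \<inter> Y)\<close>. Retracting once more to \<open>X\<close> moves the conjugator
  into \<open>par X\<close>.\<close>

lemma cpar_shrink:
  assumes y: "y \<in> par X" "y \<in> cpar Y h"
  defines "k \<equiv> - rho Y h + h"
  shows "y = cj k (rho Y y)" "rho Y y \<in> par (X \<inter> Y)" "y \<in> cpar (X \<inter> Y) k" "y \<in> cpar (X \<inter> Y) (rho X k)"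
proof -
  have "cj (- h) y = rho Y (cj (- h) y)" using y(2) by (simp add: cpar_iff rho_par del: rho_cj)
  then have "cj h (cj (- h) y) = cj h (cj (- rho Y h) (rho Y y))" by simp
  then show 1: "y = cj k (rho Y y)" by (simp add: k_def)
  show 2: "rho Y y \<in> par (X \<inter> Y)" using rho_in_par_Int[OF y(1), of Y] by (simp add: Int_commute)
  show "y \<in> cpar (X \<inter> Y) k" using 1 2 unfolding cpar_def by blast
  have "y = rho X y" using y(1) by (simp add: rho_par)
  also have "rho X y = rho X (cj k (rho Y y))" using 1 by simp
  also have "\<dots> = cj (rho X k) (rho (X \<inter> Y) y)" by simp
  finally show "y \<in> cpar (X \<inter> Y) (rho X k)" unfolding cpar_def by (metis image_eqI par_simps(2))
qed

lemma pcl_vertices: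
  assumes "pcl y X 0" "y \<in> cpar Y h"
  shows "X \<subseteq> Y"
proof -
  have y: "y \<in> par X" and X: "finite X" using assms(1) by (simp_all add: pcl_def)
  have "card X \<le> card (X \<inter> Y)"
    using assms(1) cpar_shrink(3)[OF y assms(2)] X unfolding pcl_def by blast
  then show ?thesis using X by (metis card_seteq inf.cobounded1 inf.absorb_iff1)
qed

text \<open>Modulo \<open>par Y\<close> the conjugator becomes a \<open>k\<close> commuting with
  \<open>y\<close>; splitting off its part in \<open>par X\<close> leaves \<open>k'\<close> with
  trivial retraction to \<open>X\<close>. Let \<open>a\<close> be outside \<open>X\<close> and
  \<open>perp X\<close>. In the tree of \<open>a\<close>, \<open>y\<close> fixes the base vertex and
  its translate by \<open>k'\<close>; if these differed, \<open>y\<close> would be conjugate into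
  \<open>par (lk a)\<close>, and minimality of \<open>X\<close> would put \<open>a\<close> into
  \<open>perp X\<close>. So \<open>k'\<close> lies in \<open>par (perp X)\<close> and centralises
  all of \<open>par X\<close>.\<close>

lemma pcl_zero_least:
  assumes c: "pcl y X 0" and y2: "y \<in> cpar Y h"
  shows "par X \<subseteq> cpar Y h"
proof
  have y: "y \<in> par X" using c by (simp add: pcl_def)
  have XY: "X \<subseteq> Y" using c y2 by (rule pcl_vertices)
  define k where "k = - rho Y h + h"
  define k' where "k' = - rho X k + k"
  have "rho Y y = y" using par_mono[OF y XY] by (rule rho_par)
  then have "cj k y = y" using cpar_shrink(1)[OF y y2] by (simp add: k_def)
  then have ky: "comm y k" by (simp add: comm_iff_cj)
  have "comm y (rho X k)" using comm_rho[OF ky, of X] y by (simp add: rho_par)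
  then have k'y: "comm y k'" using ky by (simp add: k'_def comm_plus')
  have rk': "rho X k' = 0" by (simp add: k'_def)
  have "k' \<in> par (X \<union> perp X)"
  proof (rule par_avoid)
    fix a assume a: "a \<notin> X \<union> perp X"
    have ya: "y \<in> par (- {a})" using y by (rule par_mono) (use a in blast)
    show "k' \<in> par (- {a})"
    proof (rule ccontr)
      assume "k' \<notin> par (- {a})"
      then obtain u where u: "\<And>w. w \<in> par (- {a}) \<Longrightarrow> cj k' w \<in> par (- {a}) \<Longrightarrow> cj u w \<in> par (lk a)"
        by (rule tree_first_edge) blast
      have "cj u y \<in> par (lk a)" using u[of y] ya cj_comm[OF k'y] by simp
      then have "y \<in> cpar (lk a) (- u)" by (simp add: cpar_iff)
      then have "X \<subseteq> lk a" by (rule pcl_vertices[OF c])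
      then have "a \<in> perp X" by (auto simp: perp_def lk_def)
      then show False using a by blast
    qed
  qed
  then have "k' = rho (perp X) k'" using joined_split[OF joined_perp, of k' X] rk' by simp
  then have k'p: "k' \<in> par (perp X)" using par_simps(2)[of "perp X" k'] by simp
  fix p assume p: "p \<in> par X"
  have "comm p k'" by (rule comm_joined[OF joined_perp p k'p])
  then have cp: "cj (- k') p = p" by (simp add: cj_comm)
  have "- h = - k' + (- rho X k + - rho Y h)" by (simp add: k'_def k_def minus_add add.assoc)
  then have "cj (- h) p = cj (- rho X k + - rho Y h) (cj (- k') p)" by simp
  also have "\<dots> \<in> par Y" using p XY by (simp add: cp par_mono[of _ X Y])
  finally show "p \<in> cpar Y h" by (simp add: cpar_iff)
qed

lemma pcl_least:
  assumes "pcl y X g" "y \<in> cpar Y h"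
  shows "cpar X g \<subseteq> cpar Y h"
proof
  fix p assume "p \<in> cpar X g"
  then have "cj (- g) p \<in> par X" by (simp add: cpar_iff)
  moreover have "par X \<subseteq> cpar Y (h + - g)"
    using assms by (intro pcl_zero_least[of "cj (- g) y"]) (simp_all add: cj_cpar flip: pcl_base)
  ultimately show "p \<in> cpar Y h" using cj_cpar[of "- g" p Y h] by blast
qed

lemma pcl_in: "pcl y X g \<Longrightarrow> y \<in> cpar X g" "pcl y X g \<Longrightarrow> finite X"
  by (simp_all add: pcl_def)

lemma pcl_cong:
  assumes "pcl y X g" "cpar X g = cpar X' g'"
  shows "X = X'" "pcl y X g'"
proof -
  show 1: "X = X'" using cpar_vertices[of X g X' g'] cpar_vertices[of X' g' X g] assms(2) by simp
  show "pcl y X g'" using assms unfolding pcl_def 1 by simp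
qed

lemma centralizer_par:
  assumes "\<And>p. p \<in> par X \<Longrightarrow> comm e p"
  shows "e = rho X e + rho (perp X) e" "e \<in> par (X \<union> perp X)"
proof -
  let ?Y = "\<Inter>x\<in>X. st x"
  have Ysub: "?Y \<subseteq> (?Y \<inter> X) \<union> perp X" by (auto simp: st_def lk_def perp_def adj_commute)
  have "e \<in> par ?Y"
  proof (rule par_avoid)
    fix a assume "a \<notin> ?Y"
    then obtain x where x: "x \<in> X" "a \<notin> st x" by blast
    then have "e \<in> par (st x)" using assms by (simp add: centralizer_gen_iff[symmetric])
    then show "e \<in> par (- {a})" using x by (auto intro: par_mono)
  qed
  then show e: "e \<in> par (X \<union> perp X)" using Ysub by (auto intro: par_mono)
  show "e = rho X e + rho (perp X) e" by (rule joined_split[OF joined_perp e])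
qed

text \<open>On \<open>par X\<close>, conjugation by \<open>z\<close> agrees with conjugation by
  \<open>rho X z\<close>, because the result is fixed by the retraction. So
  \<open>z + - rho X z\<close> centralises \<open>par X\<close>, and \<open>centralizer_par\<close>
  applies.\<close>

lemma normalizer_par:
  assumes "\<And>p. p \<in> par X \<Longrightarrow> cj z p \<in> par X"
  shows "z \<in> par (X \<union> perp X)"
proof -
  have "comm (z + - rho X z) p" if p: "p \<in> par X" for p
  proof -
    have "cj z p = cj (rho X z) p" using rho_par[OF assms[OF p]] p by (simp add: rho_par)
    then have "cj (- rho X z) (cj z p) = p" by simp
    then show ?thesis by (metis cj_simps(5) comm_iff_cj comm_sym)
  qed
  then have "z + - rho X z \<in> par (X \<union> perp X)" by (rule centralizer_par(2))
  moreover have "- rho X z \<in> par (X \<union> perp X)" by (rule par_mono[of _ X]) auto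
  ultimately show ?thesis by (simp add: par_add_right_iff)
qed

text \<open>Conjugation by \<open>z\<close> fixes \<open>y\<close>, hence preserves the least
  parabolic containing it.\<close>

lemma centralizer_normalizes:
  assumes "pcl y X 0" "comm z y"
  shows "z \<in> par (X \<union> perp X)"
proof (rule normalizer_par)
  have "cj (- z) y = y" using assms(2) comm_sym[of z y] by (simp add: cj_comm)
  then have "y \<in> cpar X (- z)" using assms(1) cj_cpar[of "- z" y X 0] by (simp add: pcl_def)
  then have "par X \<subseteq> cpar X (- z)" by (rule pcl_zero_least[OF assms(1)])
  then show "cj z p \<in> par X" if "p \<in> par X" for p using that by (auto simp: cpar_iff)
qed

section \<open>Join factors of a support: connected components of the complement graph\<close>

definition irr :: "'v::graph set \<Rightarrow> bool" where
  "irr X \<longleftrightarrow> X \<noteq> {} \<and> (\<forall>Y\<subseteq>X. Y \<noteq> {} \<longrightarrow> joined Y (X - Y) \<longrightarrow> Y = X)"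

definition cocomp :: "'v::graph set \<Rightarrow> 'v \<Rightarrow> 'v set" where
  "cocomp X v = {w. (v, w) \<in> {(a, b). a \<in> X \<and> b \<in> X \<and> \<not> adj a b}\<^sup>*}"

lemma cocomp_self [simp]: "v \<in> cocomp X v"
  by (simp add: cocomp_def)

lemma cocomp_subset: "v \<in> X \<Longrightarrow> cocomp X v \<subseteq> X"
proof
  fix w assume "v \<in> X" "w \<in> cocomp X v"
  then show "w \<in> X" unfolding cocomp_def mem_Collect_eq by (metis (no_types, lifting) case_prodD mem_Collect_eq rtranclE)
qed

lemma cocomp_joined: "v \<in> X \<Longrightarrow> joined (cocomp X v) (X - cocomp X v)"
  unfolding joined_def
proof (intro ballI)
  fix a b assume v: "v \<in> X" and a: "a \<in> cocomp X v" and b: "b \<in> X - cocomp X v"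
  have "a \<in> X" using v a cocomp_subset by blast
  then show "adj a b" using a b unfolding cocomp_def by (auto intro: rtrancl_into_rtrancl)
qed

lemma cocomp_eq: "w \<in> cocomp X v \<Longrightarrow> cocomp X w = cocomp X v"
proof -
  let ?R = "{(a, b). a \<in> X \<and> b \<in> X \<and> \<not> adj a b}"
  have "sym ?R" unfolding sym_def by (simp add: adj_commute)
  then have s: "sym (?R\<^sup>*)" by (rule sym_rtrancl)
  assume "w \<in> cocomp X v"
  then have "(v, w) \<in> ?R\<^sup>*" "(w, v) \<in> ?R\<^sup>*" using s by (simp_all add: cocomp_def symD)
  then show ?thesis unfolding cocomp_def by (auto intro: rtrancl_trans)
qed

lemma irr_cocomp:
  assumes v: "v \<in> X"
  shows "irr (cocomp X v)"
  unfolding irr_def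
proof (intro conjI allI impI)
  fix Y assume Y: "Y \<subseteq> cocomp X v" "Y \<noteq> {}" "joined Y (cocomp X v - Y)"
  then obtain y where y: "y \<in> Y" by blast
  have C: "cocomp X y = cocomp X v" using Y y by (intro cocomp_eq) blast
  have "b \<in> Y" if "(y, b) \<in> {(a, b). a \<in> X \<and> b \<in> X \<and> \<not> adj a b}\<^sup>*" for b
    using that
  proof (induction rule: rtrancl_induct)
    case (step a b)
    have "b \<in> cocomp X y" using step(1,2) unfolding cocomp_def by (auto intro: rtrancl_into_rtrancl)
    then show ?case using step Y C unfolding joined_def by blast
  qed (rule y)
  then have "cocomp X y \<subseteq> Y" by (auto simp: cocomp_def)
  then show "Y = cocomp X v" using Y C by blast
qed (use cocomp_self in blast)

text \<open>If \<open>rho C y\<close> lay in a conjugate of a smaller parabolic, the conjugator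
  could be taken in \<open>par C\<close>, where it does not disturb the factor on
  \<open>X - C\<close>; recombining the factors would contradict the minimality of
  \<open>X\<close>.\<close>

lemma pcl_component:
  assumes c: "pcl y X 0" and C: "C \<subseteq> X" "joined C (X - C)"
  shows "pcl (rho C y) C 0"
proof -
  have y: "y \<in> par X" and X: "finite X" using c by (simp_all add: pcl_def)
  have CX: "C \<union> (X - C) = X" using C by blast
  have split: "y = rho C y + rho (X - C) y" by (rule joined_split[OF C(2)]) (simp only: CX y)
  have "card C \<le> card Y" if Y: "finite Y" "rho C y \<in> cpar Y h" for Y h
  proof -
    define k where "k = rho C (- rho Y h + h)"
    have 1: "cj (- k) (rho C y) \<in> par (C \<inter> Y)"
      using cpar_shrink(4)[of "rho C y" C Y h] Y(2) by (simp add: cpar_iff k_def)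
    have "comm (rho (X - C) y) (- k)"
      by (rule comm_sym, rule comm_joined[OF C(2)]) (simp_all only: k_def par_simps)
    then have 2: "cj (- k) (rho (X - C) y) = rho (X - C) y" by (rule cj_comm)
    let ?Z = "(C \<inter> Y) \<union> (X - C)"
    have "cj (- k) y = cj (- k) (rho C y) + cj (- k) (rho (X - C) y)"
      unfolding cj_simps(1)[symmetric] using split by simp
    also have "\<dots> \<in> par ?Z"
      unfolding 2 using par_mono[OF 1, of ?Z] par_mono[OF par_simps(2), of "X - C" ?Z y]
      by (intro par_plus) auto
    finally have "y \<in> cpar ?Z k" by (simp only: cpar_iff)
    then have "card X \<le> card ?Z" using c X Y(1) unfolding pcl_def by (metis finite_Diff finite_Int finite_Un)
    moreover have "card ?Z = card (C \<inter> Y) + card (X - C)"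
      using X C by (intro card_Un_disjoint) (auto intro: finite_subset)
    moreover have "card X = card C + card (X - C)"
      using X C by (metis CX Diff_disjoint card_Un_disjoint finite_Diff finite_subset)
    ultimately have "card C \<le> card (C \<inter> Y)" by simp
    also have "\<dots> \<le> card Y" using Y(1) by (intro card_mono) auto
    finally show ?thesis .
  qed
  then show ?thesis using finite_subset[OF C(1) X] by (simp add: pcl_def)
qed

text \<open>\<open>z\<close> is a product of components in the parabolics on \<open>C\<close>,
  \<open>X - C\<close> and \<open>perp X\<close>. The last two commute with \<open>par C\<close>,
  and the first commutes with \<open>rho C y\<close> because a retraction preserves
  commutation.\<close>

lemma comm_component:
  assumes c: "pcl y X 0" and C: "C \<subseteq> X" "joined C (X - C)" and z: "comm z y"
  shows "comm z (rho C y)"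
proof -
  have "z \<in> par (X \<union> perp X)" by (rule centralizer_normalizes[OF c z])
  then have "z = rho X z + rho (perp X) z" by (rule joined_split[OF joined_perp])
  moreover have "rho X z = rho C z + rho (X - C) z"
    using joined_split[OF C(2), of "rho X z"] C(1) by (simp add: Un_absorb1 Int_absorb2 Diff_Int_distrib2)
  ultimately have z3: "z = rho C z + rho (X - C) z + rho (perp X) z" by simp
  have "comm (rho C z) (rho C y)" using z by (rule comm_rho)
  moreover have "comm (rho (X - C) z) (rho C y)" by (rule comm_joined[OF joined_sym[OF C(2)]]) simp_all
  moreover have "comm (rho (perp X) z) (rho C y)"
    by (rule comm_joined[OF joined_sym[OF joined_perp[of X]]]) (simp, rule par_mono[OF _ C(1)], simp)
  ultimately have "comm (rho C z + rho (X - C) z + rho (perp X) z) (rho C y)" by (intro comm_plus)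
  then show ?thesis using z3 by simp
qed

section \<open>Commuting elements with irreducible closures\<close>

definition comm_sets :: "'g::group_add set \<Rightarrow> 'g set \<Rightarrow> bool" where
  "comm_sets P Q \<longleftrightarrow> (\<forall>p\<in>P. \<forall>q\<in>Q. comm p q)"

lemma comm_sets_sym: "comm_sets P Q \<Longrightarrow> comm_sets Q P"
  unfolding comm_sets_def using comm_sym by blast

lemma irr_dichotomy:
  assumes "irr X'" "X' \<subseteq> X \<union> Y" "joined X Y"
  shows "X' \<subseteq> X \<or> X' \<subseteq> Y"
proof (cases "X' \<inter> X = {}")
  case False
  have "joined (X' \<inter> X) (X' - X' \<inter> X)" using assms(2,3) unfolding joined_def by blast
  then have "X' \<inter> X = X'" using assms(1) False unfolding irr_def by blast
  then show ?thesis by blast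
qed (use assms(2) in blast)

text \<open>\<open>b'\<close> normalises the closure of \<open>b\<close>, so its own closure lies in
  \<open>par (X \<union> perp X)\<close>. An irreducible support cannot straddle a join: inside
  \<open>X\<close> it yields containment, inside \<open>perp X\<close> commutation. In either case
  the part of the conjugator coming from the other factor acts trivially.\<close>

lemma commuting_closures_aux:
  assumes b: "pcl b X 0" and b': "pcl b' X' g'" "irr X'" and c: "comm b b'"
  shows "cpar X' g' \<subseteq> par X \<or> comm_sets (par X) (cpar X' g')"
proof -
  let ?Y = "X \<union> perp X"
  have "b' \<in> par ?Y" using centralizer_normalizes[OF b] c comm_sym by blast
  then have sub: "cpar X' g' \<subseteq> par ?Y" using pcl_least[OF b'(1), of ?Y 0] by simp
  then have X'Y: "X' \<subseteq> ?Y" using cpar_vertices[of X' g' ?Y 0] by simp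
  define \<alpha> \<beta> where "\<alpha> = rho X g'" and "\<beta> = rho (perp X) g'"
  have "rho ?Y g' = \<alpha> + \<beta>"
    using joined_split[OF joined_perp, of "rho ?Y g'" X] by (simp add: \<alpha>_def \<beta>_def Int_absorb2 Int_commute)
  then have el: "cj g' p = cj (\<alpha> + \<beta>) p" if "p \<in> par X'" for p
    using that sub rho_par[of "cj g' p" ?Y] rho_par[OF par_mono[OF that X'Y]] unfolding cpar_def by auto
  consider "X' \<subseteq> X" | "X' \<subseteq> perp X" using irr_dichotomy[OF b'(2) X'Y joined_perp] by blast
  then show ?thesis
  proof cases
    case 1
    have "cj g' p \<in> par X" if p: "p \<in> par X'" for p
    proof -
      have "cj \<alpha> p \<in> par X" using par_mono[OF p 1] by (simp add: \<alpha>_def)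
      moreover from this have "comm (cj \<alpha> p) \<beta>"
        by (rule comm_joined[OF joined_perp]) (simp add: \<beta>_def)
      ultimately show ?thesis using el[OF p] cj_comm[of "cj \<alpha> p" \<beta>] by simp
    qed
    then show ?thesis unfolding cpar_def by blast
  next
    case 2
    have "cj g' p \<in> par (perp X)" if p: "p \<in> par X'" for p
    proof -
      have pp: "p \<in> par (perp X)" using par_mono[OF p 2] .
      then have "comm p \<alpha>" by (intro comm_sym[OF comm_joined[OF joined_perp]]) (simp_all add: \<alpha>_def)
      then have "cj (\<alpha> + \<beta>) p = cj \<beta> p" using cj_comm[of p \<alpha>] by (metis cj_simps(5))
      then show ?thesis using pp el[OF p] by (simp add: \<beta>_def)
    qed
    then show ?thesis unfolding cpar_def comm_sets_def using comm_joined[OF joined_perp] by blast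
  qed
qed

lemma comm_sets_cj: "comm_sets (cj k ` P) (cj k ` Q) \<longleftrightarrow> comm_sets P Q"
  by (simp add: comm_sets_def)

lemma cj_image_cpar: "cj k ` cpar X g = cpar X (g + k)"
  by (simp add: cpar_def image_image)

lemma commuting_closures_le:
  assumes b: "pcl b X g" and b': "pcl b' X' g'" "irr X'" and c: "comm b b'"
  shows "cpar X' g' \<subseteq> cpar X g \<or> comm_sets (cpar X g) (cpar X' g')"
proof -
  have "cpar X' (g' + - g) \<subseteq> par X \<or> comm_sets (par X) (cpar X' (g' + - g))"
    using pcl_cj[OF b'(1), of "- g"] b b'(2) c
    by (intro commuting_closures_aux[of "cj (- g) b" X "cj (- g) b'"]) (simp_all flip: pcl_base)
  then have "cj g ` cpar X' (g' + - g) \<subseteq> cj g ` par X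
      \<or> comm_sets (cj g ` par X) (cj g ` cpar X' (g' + - g))"
    by (metis comm_sets_cj image_mono)
  then show ?thesis by (simp add: cj_image_cpar add.assoc cpar_def[of X g, symmetric])
qed

lemma commuting_closures:
  assumes "pcl b X g" "irr X" "pcl b' X' g'" "irr X'" "comm b b'"
  shows "cpar X g = cpar X' g' \<or> comm_sets (cpar X g) (cpar X' g')"
  using commuting_closures_le[OF assms(1,3,4,5)] commuting_closures_le[OF assms(3,1,2) comm_sym[OF assms(5)]]
    comm_sets_sym by blast

text \<open>The commutator \<open>x\<close> of \<open>b\<close> and \<open>b''\<close> commutes with
  \<open>b'\<close>, so \<open>b'\<close> normalises the closure of \<open>x\<close>, and
  irreducibility forces the support \<open>D\<close> of \<open>x\<close> to be all of
  \<open>X\<close>. But for \<open>t\<close> in \<open>X\<close> no vertex of the tree of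
  \<open>t\<close> is fixed by \<open>b'\<close>, so commutators of its centraliser do fix one,
  which removes \<open>t\<close> from \<open>D\<close>.\<close>

lemma irr_commute_trans_aux:
  assumes X: "irr X" and p: "pcl b X 0" "pcl b' X 0" "pcl b'' X 0" and c: "comm b b'" "comm b'' b'"
  shows "comm b b''"
proof (rule ccontr)
  assume "\<not> comm b b''"
  define x where "x = - (b + b'') + (b'' + b)"
  have x0: "x \<noteq> 0"
  proof
    assume "x = 0"
    then have "b + b'' + x = b + b''" by simp
    then show False using \<open>\<not> comm b b''\<close> by (simp add: x_def comm_def)
  qed
  have xc: "comm x b'" using c by (simp add: x_def comm_plus)
  have "x \<in> par X" using p by (simp add: x_def pcl_def)
  obtain D g where D: "pcl x D g" by (rule pcl_exists)
  have "cpar D g \<subseteq> par X" using pcl_least[OF D, of X 0] \<open>x \<in> par X\<close> by simp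
  then have DX: "D \<subseteq> X" using cpar_vertices[of D g X 0] by simp
  have "D \<noteq> {}" using D x0 by (auto simp: pcl_def cpar_def par_empty)
  have "cj (- g) b' \<in> par (D \<union> perp D)"
    using D comm_sym[OF xc] by (intro centralizer_normalizes[of "cj (- g) x"]) (simp_all flip: pcl_base)
  then have "b' \<in> cpar (D \<union> perp D) g" by (simp add: cpar_iff)
  then have "X \<subseteq> D \<union> perp D" by (rule pcl_vertices[OF p(2)])
  then have "X \<subseteq> D" using irr_dichotomy[OF X _ joined_perp] DX \<open>D \<noteq> {}\<close> joined_disjoint[OF joined_perp, of D] by blast
  obtain t where t: "t \<in> X" using X by (auto simp: irr_def)
  have "cj h b' \<notin> par (- {t})" for h
    using pcl_vertices[OF p(2), of "- {t}" "- h"] t by (auto simp: cpar_iff)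
  then obtain h where "cj h x \<in> par (- {t})"
    using centralizer_commutator_elliptic[of b' t b b''] c unfolding x_def by blast
  then have "x \<in> cpar (- {t}) (- h)" by (simp add: cpar_iff)
  then have "D \<subseteq> - {t}" using pcl_least[OF D] cpar_vertices by blast
  then show False using t \<open>X \<subseteq> D\<close> by blast
qed

lemma irr_commute_trans:
  assumes "irr X" "pcl b X g" "pcl b' X g" "pcl b'' X g" "comm b b'" "comm b'' b'"
  shows "comm b b''"
  using irr_commute_trans_aux[of X "cj (- g) b" "cj (- g) b'" "cj (- g) b''"] assms
  by (simp flip: pcl_base)

section \<open>Generic conjugates of a vertex inside an irreducible closure\<close>

lemma npow_zero [simp]: "npow n 0 = 0"
  by (induction n) (simp_all add: npow_Suc)

text \<open>At most one exponent is bad. Two of them would give an element of \<open>par Z\<close>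
  whose conjugate by a nontrivial power of \<open>a\<close> is again in \<open>par Z\<close>. As the
  retraction to \<open>Z\<close> kills \<open>a\<close>, the element commutes with that power, so it
  lies in \<open>par (Z \<inter> lk a)\<close>; conjugating back does not change it, hence
  \<open>w\<close> lies there too.\<close>

lemma finite_bad_powers:
  assumes a: "a \<notin> Z" and w: "w \<notin> par (Z \<inter> lk a)"
  shows "finite {N. cj (- npow N (gen a)) w \<in> par Z}"
proof -
  have uniq: "N = N'" if "cj (- npow N (gen a)) w \<in> par Z" "cj (- npow N' (gen a)) w \<in> par Z" and le: "N \<le> N'" for N N'
  proof (rule ccontr)
    assume "N \<noteq> N'"
    then obtain M where M: "N' = M + N" "M > 0"
      using le by (metis add.commute le_Suc_ex neq0_conv add_0)
    define w' where "w' = cj (- npow N (gen a)) w"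
    have w': "w' \<in> par Z" using that by (simp add: w'_def)
    have "cj (- npow M (gen a)) w' \<in> par Z"
      using that(2) by (simp add: w'_def M npow_add minus_add)
    then have "cj (- npow M (gen a)) w' = rho Z (cj (- npow M (gen a)) w')" by (simp only: rho_par)
    also have "\<dots> = w'" using a w' by (simp add: rho_par npow_zero)
    finally have "comm w' (npow M (gen a))" by (metis comm_iff_cj comm_uminus_iff(2))
    then have "w' \<in> par (st a)" using M comm_sym by (intro centralizer_gen[of M]) auto
    then have "w' \<in> par (Z \<inter> st a)" using w' par_Int by blast
    moreover have "Z \<inter> st a = Z \<inter> lk a" using a by (auto simp: st_def)
    ultimately have w'': "w' \<in> par (Z \<inter> lk a)" by simp
    then have "comm w' (gen a)" by (intro comm_gen_lk) (auto intro: par_mono)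
    then have "cj (npow N (gen a)) w' = w'" by (intro cj_comm comm_npow)
    then have "w' = w" by (simp add: w'_def)
    then show False using w w'' by simp
  qed
  show ?thesis
  proof (cases "\<exists>N. cj (- npow N (gen a)) w \<in> par Z")
    case True
    then obtain N where N: "cj (- npow N (gen a)) w \<in> par Z" by blast
    have "{N. cj (- npow N (gen a)) w \<in> par Z} \<subseteq> {N}"
    proof
      fix N' assume "N' \<in> {N. cj (- npow N (gen a)) w \<in> par Z}"
      then show "N' \<in> {N}" using uniq[OF N, of N'] uniq[of N' N] N by (cases "N \<le> N'") auto
    qed
    then show ?thesis using finite_subset by blast
  qed simp
qed

text \<open>\<open>Y\<close> is enlarged from \<open>{t}\<close> to \<open>X\<close>; the assumption
  \<open>step\<close> carries the solution for the current \<open>Y\<close>. The obstruction is the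
  parabolic on \<open>st t \<inter> (\<Inter>a\<in>Y - {t}. lk a)\<close>: it is
  \<open>par (st t)\<close> at the start and centralises \<open>par X\<close> at the end.
  Irreducibility supplies a vertex \<open>a\<close> not joined to \<open>Y\<close>, hence outside
  the obstruction set, and a suitable power of \<open>a\<close> pushes \<open>W\<close> off the
  obstruction.\<close>

lemma generic_conjugator_aux:
  assumes X: "irr X" "finite X" and t: "t \<in> X" and Y: "t \<in> Y" "Y \<subseteq> X"
    and W: "finite W"
    and step: "\<And>W. finite W \<Longrightarrow> (\<And>w. w \<in> W \<Longrightarrow> w \<notin> par (st t \<inter> (\<Inter>a\<in>Y - {t}. lk a)))
      \<Longrightarrow> \<exists>x\<in>par X. \<forall>w\<in>W. cj (- x) w \<notin> par (st t)"
    and w: "\<And>w. w \<in> W \<Longrightarrow> w \<notin> par (st t \<inter> (\<Inter>a\<in>X - {t}. lk a))"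
  shows "\<exists>x\<in>par X. \<forall>w\<in>W. cj (- x) w \<notin> par (st t)"
  using Y W step w
proof (induction "card (X - Y)" arbitrary: Y W)
  case 0
  then have "Y = X" using X by (simp add: card_eq_0_iff)
  then show ?case using 0 by blast
next
  case (Suc n)
  have "Y \<noteq> X" using Suc(2) by auto
  then have "\<not> joined Y (X - Y)" using X Suc.prems(1,2) unfolding irr_def by blast
  then obtain y a where ya: "y \<in> Y" "a \<in> X - Y" "\<not> adj y a" by (auto simp: joined_def)
  let ?Z = "st t \<inter> (\<Inter>a\<in>Y - {t}. lk a)"
  have a: "a \<notin> ?Z"
    using ya Suc.prems(1) by (cases "y = t") (auto simp: st_def lk_def)
  have IZ: "st t \<inter> (\<Inter>b\<in>insert a Y - {t}. lk b) = ?Z \<inter> lk a" using ya Suc.prems(1) by auto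
  have "card (X - insert a Y) = n" 
  proof -
    have "X - insert a Y = (X - Y) - {a}" by blast
    then show ?thesis using Suc(2) ya X(2) by simp
  qed
  moreover have "\<exists>x\<in>par X. \<forall>w\<in>W'. cj (- x) w \<notin> par (st t)"
    if W': "finite W'" "\<And>w. w \<in> W' \<Longrightarrow> w \<notin> par (st t \<inter> (\<Inter>b\<in>insert a Y - {t}. lk b))" for W'
  proof -
    have "finite (\<Union>w\<in>W'. {N. cj (- npow N (gen a)) w \<in> par ?Z})"
    proof (rule finite_UN_I[OF W'(1)])
      fix w assume "w \<in> W'"
      then have "w \<notin> par (?Z \<inter> lk a)" using W'(2)[of w] by (simp only: IZ) blast
      then show "finite {N. cj (- npow N (gen a)) w \<in> par ?Z}" by (rule finite_bad_powers[OF a])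
    qed
    from ex_new_if_finite[OF infinite_UNIV_nat this] obtain N where "N \<notin> (\<Union>w\<in>W'. {N. cj (- npow N (gen a)) w \<in> par ?Z})" by blast
    then have N: "\<And>w. w \<in> W' \<Longrightarrow> cj (- npow N (gen a)) w \<notin> par ?Z" by blast
    have "\<exists>x\<in>par X. \<forall>w\<in>cj (- npow N (gen a)) ` W'. cj (- x) w \<notin> par (st t)"
      by (rule Suc.prems(4)) (use W'(1) N in auto)
    then obtain x where x: "x \<in> par X" "\<forall>w\<in>cj (- npow N (gen a)) ` W'. cj (- x) w \<notin> par (st t)"
      by blast
    then have "\<forall>w\<in>W'. cj (- (x + npow N (gen a))) w \<notin> par (st t)" by (simp add: minus_add)
    then show ?thesis using x(1) ya by (intro bexI[of _ "x + npow N (gen a)"]) auto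
  qed
  moreover have "t \<in> insert a Y" "insert a Y \<subseteq> X" using Suc.prems(1,2) ya by auto
  ultimately show ?case using Suc(1)[of "insert a Y" W] Suc.prems(3,5) by (metis (no_types, lifting))
qed

lemma generic_conjugator:
  assumes X: "irr X" "finite X" and t: "t \<in> X" and W: "finite W"
    and w: "\<And>w. w \<in> W \<Longrightarrow> \<not> comm_sets {w} (par X)"
  obtains x where "x \<in> par X" "\<And>w. w \<in> W \<Longrightarrow> \<not> comm w (cj x (gen t))"
proof -
  have "w \<notin> par (st t \<inter> (\<Inter>a\<in>X - {t}. lk a))" if "w \<in> W" for w
  proof
    assume wp: "w \<in> par (st t \<inter> (\<Inter>a\<in>X - {t}. lk a))"
    have "comm w (gen x)" if "x \<in> X" for x
    proof (cases "x = t")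
      case True
      have "w \<in> par (st t)" using wp by (rule par_mono) blast
      then show ?thesis using True comm_gen_st by blast
    next
      case False
      have "w \<in> par (lk x)" using wp by (rule par_mono) (use that False in blast)
      then show ?thesis using comm_gen_lk by blast
    qed
    then have "comm_sets {w} (par X)" unfolding comm_sets_def using comm_par by blast
    then show False using w \<open>w \<in> W\<close> by blast
  qed
  moreover have "\<exists>x\<in>par X. \<forall>w\<in>W'. cj (- x) w \<notin> par (st t)"
    if "\<And>w. w \<in> W' \<Longrightarrow> w \<notin> par (st t \<inter> (\<Inter>a\<in>{t} - {t}. lk a))" for W'
    using that by (intro bexI[of _ 0]) simp_all
  ultimately obtain x where x: "x \<in> par X" "\<forall>w\<in>W. cj (- x) w \<notin> par (st t)"
    using generic_conjugator_aux[OF X t, of "{t}" W] t W by blast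
  have "\<not> comm w (cj x (gen t))" if "w \<in> W" for w
  proof
    assume "comm w (cj x (gen t))"
    then have "comm (cj (- x) w) (cj (- x) (cj x (gen t)))" by (simp only: comm_cj)
    then have "comm (cj (- x) w) (gen t)" by simp
    then show False using x that by (simp add: centralizer_gen_iff)
  qed
  then show ?thesis using that x(1) by blast
qed

section \<open>Resolving blocks into conjugates of vertices\<close>

lemma cj_sum_list: "cj g (sum_list xs) = sum_list (map (cj g) xs)"
  by (induction xs) simp_all

lemma sum_components:
  assumes "sorted_wrt joined Cs" "y \<in> par (\<Union>(set Cs))"
  shows "y = sum_list (map (\<lambda>C. rho C y) Cs)"
  using assms
proof (induction Cs arbitrary: y)
  case Nil
  then show ?case by (simp add: par_empty)
next
  case (Cons C Cs)
  let ?D = "\<Union>(set Cs)"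
  have j: "joined C ?D" using Cons.prems(1) by (auto simp: joined_def)
  have "rho ?D y = sum_list (map (\<lambda>C. rho C (rho ?D y)) Cs)"
    using Cons.prems(1) by (intro Cons.IH) simp_all
  also have "\<dots> = sum_list (map (\<lambda>C. rho C y) Cs)"
    by (rule arg_cong[of _ _ sum_list], rule map_cong) (auto simp: Int_absorb2 Sup_upper)
  finally have "rho ?D y = sum_list (map (\<lambda>C. rho C y) Cs)" .
  moreover have "y = rho C y + rho ?D y" using Cons.prems(2) by (intro joined_split[OF j]) simp
  ultimately show ?case by simp
qed

lemma sorted_wrt_distinctI:
  "distinct xs \<Longrightarrow> (\<And>a b. a \<in> set xs \<Longrightarrow> b \<in> set xs \<Longrightarrow> a \<noteq> b \<Longrightarrow> P a b) \<Longrightarrow> sorted_wrt P xs"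
  by (induction xs) auto

lemma cocomp_disjoint_joined:
  assumes "v \<in> X" "v' \<in> X" "cocomp X v \<noteq> cocomp X v'"
  shows "joined (cocomp X v) (cocomp X v')"
proof -
  have "cocomp X v' \<subseteq> X - cocomp X v"
    using cocomp_eq[of _ X v] cocomp_eq[of _ X v'] assms cocomp_subset[of v' X] by blast
  then show ?thesis using cocomp_joined[OF assms(1)] unfolding joined_def by blast
qed

lemma comm_block:
  assumes "pcl y X g" "v \<in> X" "comm z y"
  shows "comm z (cj g (rho (cocomp X v) (cj (- g) y)))"
proof -
  have "comm (cj (- g) z) (rho (cocomp X v) (cj (- g) y))"
    using assms cocomp_subset cocomp_joined
    by (intro comm_component[of _ X]) (simp_all flip: pcl_base del: rho_cj)
  then have "comm (cj g (cj (- g) z)) (cj g (rho (cocomp X v) (cj (- g) y)))"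
    by (simp only: comm_cj)
  then show ?thesis by simp
qed

text \<open>The conjugates are chosen one after the other. Besides the wanted statement for chosen
  pairs, the induction keeps that a chosen \<open>u k\<close> centralises \<open>P l\<close> only if
  \<open>P k\<close> does, also for \<open>l\<close> not yet treated. This is what allows the later
  choice in \<open>P l\<close> to avoid commuting with \<open>u k\<close>.\<close>

lemma generic_family:
  fixes X :: "'k \<Rightarrow> 'v::graph set"
  assumes K: "finite K" and X: "\<And>k. k \<in> K \<Longrightarrow> irr (X k) \<and> finite (X k) \<and> t k \<in> X k"
  obtains u where "\<And>k. k \<in> K \<Longrightarrow> \<exists>x\<in>par (X k). u k = cj (x + g k) (gen (t k))"
    "\<And>k l. k \<in> K \<Longrightarrow> l \<in> K \<Longrightarrow> k \<noteq> l \<Longrightarrow> comm (u k) (u l)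
      \<Longrightarrow> comm_sets (cpar (X k) (g k)) (cpar (X l) (g l))"
proof -
  define P where "P k = cpar (X k) (g k)" for k
  have pick: "\<exists>u x. x \<in> par (X k) \<and> u = cj (x + g k) (gen (t k)) \<and> (\<forall>w\<in>W. \<not> comm w u)"
    if k: "k \<in> K" and W: "finite W" "\<And>w. w \<in> W \<Longrightarrow> \<not> comm_sets {w} (P k)" for k W
  proof -
    have "\<not> comm_sets {w} (par (X k))" if wW: "w \<in> cj (- g k) ` W" for w
    proof
      assume c: "comm_sets {w} (par (X k))"
      obtain w' where w': "w' \<in> W" "w = cj (- g k) w'" using wW by blast
      have "comm_sets {w'} (P k)"
        unfolding comm_sets_def
      proof (intro ballI)
        fix p q assume p: "p \<in> {w'}" and q: "q \<in> P k"
        have "comm (cj (- g k) w') (cj (- g k) q)"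
          using c w' q by (simp add: comm_sets_def P_def cpar_iff del: comm_cj)
        then show "comm p q" using p by simp
      qed
      then show False using W w' by blast
    qed
    then obtain x where x: "x \<in> par (X k)" "\<And>w. w \<in> cj (- g k) ` W \<Longrightarrow> \<not> comm w (cj x (gen (t k)))"
      using generic_conjugator[of "X k" "t k" "cj (- g k) ` W"] X[OF k] W(1) by (metis finite_imageI)
    have "\<not> comm w (cj (x + g k) (gen (t k)))" if "w \<in> W" for w
    proof
      assume "comm w (cj (x + g k) (gen (t k)))"
      then have "comm (cj (- g k) w) (cj (- g k) (cj (x + g k) (gen (t k))))" by (simp only: comm_cj)
      then show False using x(2)[of "cj (- g k) w"] that by (simp add: add.assoc)
    qed
    then show ?thesis using x(1) by blast
  qed
  have "\<exists>u. (\<forall>k\<in>F. (\<exists>x\<in>par (X k). u k = cj (x + g k) (gen (t k)))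
      \<and> (\<forall>l\<in>K. comm_sets {u k} (P l) \<longrightarrow> comm_sets (P k) (P l))
      \<and> (\<forall>l\<in>F. k \<noteq> l \<longrightarrow> comm (u k) (u l) \<longrightarrow> comm_sets (P k) (P l)))" if "F \<subseteq> K" for F
    using finite_subset[OF that K] that
  proof (induction F rule: finite_induct)
    case (insert a F)
    then obtain u where u: "\<And>k. k \<in> F \<Longrightarrow> \<exists>x\<in>par (X k). u k = cj (x + g k) (gen (t k))"
      "\<And>k l. k \<in> F \<Longrightarrow> l \<in> K \<Longrightarrow> comm_sets {u k} (P l) \<Longrightarrow> comm_sets (P k) (P l)"
      "\<And>k l. k \<in> F \<Longrightarrow> l \<in> F \<Longrightarrow> k \<noteq> l \<Longrightarrow> comm (u k) (u l) \<Longrightarrow> comm_sets (P k) (P l)"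
      by auto
    have aK: "a \<in> K" using insert by blast
    define wit where "wit l = (SOME w. w \<in> P l \<and> \<not> comm_sets {w} (P a))" for l
    have wit: "wit l \<in> P l \<and> \<not> comm_sets {wit l} (P a)" if "\<not> comm_sets (P a) (P l)" for l
    proof -
      have "\<exists>w. w \<in> P l \<and> \<not> comm_sets {w} (P a)"
        using that comm_sets_sym[of "P l" "P a"] by (auto simp: comm_sets_def)
      then show ?thesis unfolding wit_def by (rule someI_ex)
    qed
    \<comment> \<open>The first part keeps the new element from commuting with earlier ones; the
      witnesses in the second part keep it from centralising a closure \<open>P l\<close> that does
      not commute with \<open>P a\<close>.\<close>
    define W where "W = u ` {k\<in>F. \<not> comm_sets (P k) (P a)} \<union> wit ` {l\<in>K. \<not> comm_sets (P a) (P l)}"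
    have W: "finite W" using insert(1) K by (simp add: W_def)
    have "\<not> comm_sets {w} (P a)" if "w \<in> W" for w
      using that u(2)[OF _ aK] wit unfolding W_def by blast
    then obtain v x where v: "x \<in> par (X a)" "v = cj (x + g a) (gen (t a))" "\<And>w. w \<in> W \<Longrightarrow> \<not> comm w v"
      using pick[OF aK W] by blast
    have v1: "comm_sets (P a) (P l)" if "l \<in> K" "comm_sets {v} (P l)" for l
    proof (rule ccontr)
      assume n: "\<not> comm_sets (P a) (P l)"
      then have "comm v (wit l)" using that wit by (simp add: comm_sets_def)
      moreover have "wit l \<in> W" using n that by (simp add: W_def)
      ultimately show False using v(3) comm_sym by blast
    qed
    have v2: "comm_sets (P l) (P a)" if "l \<in> F" "comm (u l) v" for l
    proof (rule ccontr)
      assume "\<not> comm_sets (P l) (P a)"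
      then have "u l \<in> W" using that by (simp add: W_def)
      then show False using v(3) that by blast
    qed
    show ?case
    proof (intro exI[of _ "u(a := v)"] ballI conjI impI)
      fix k assume k: "k \<in> insert a F"
      show "\<exists>x\<in>par (X k). (u(a := v)) k = cj (x + g k) (gen (t k))"
        using k u(1) v by (cases "k = a") auto
      fix l
      show "comm_sets (P k) (P l)" if "l \<in> K" "comm_sets {(u(a := v)) k} (P l)"
        using k that u(2) v1 by (cases "k = a") auto
      show "comm_sets (P k) (P l)" if "l \<in> insert a F" "k \<noteq> l" "comm ((u(a := v)) k) ((u(a := v)) l)"
      proof (cases "k = a")
        case True
        then have "l \<in> F" "comm (u l) v" using that comm_sym by auto
        then show ?thesis using v2 True comm_sets_sym by blast
      next
        case False
        then show ?thesis using k that u(3) v2 by (cases "l = a") auto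
      qed
    qed
  qed simp
  from this[of K] show ?thesis using that unfolding P_def by blast
qed

lemma cj_sum_joined:
  assumes "distinct vs" and "\<And>v w. v \<in> set vs \<Longrightarrow> w \<in> set vs \<Longrightarrow> v \<noteq> w \<Longrightarrow> joined (D v) (D w)"
    and "\<And>v. v \<in> set vs \<Longrightarrow> x v \<in> par (D v)" and "v \<in> set vs" and "p \<in> par (D v)"
  shows "cj (sum_list (map x vs)) p = cj (x v) p"
  using assms(1-4)
proof (induction vs)
  case (Cons a vs)
  have skip: "cj (sum_list (map x us)) q = q"
    if "set us \<subseteq> set (a # vs)" "v \<notin> set us" "q \<in> par (D v)" for us q
    using that
  proof (induction us)
    case (Cons c us)
    have "joined (D v) (D c)" "x c \<in> par (D c)"
      using Cons.prems \<open>v \<in> set (a # vs)\<close> \<open>\<And>v w. v \<in> set (a # vs) \<Longrightarrow> w \<in> set (a # vs) \<Longrightarrow> v \<noteq> w \<Longrightarrow> joined (D v) (D w)\<close>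
        \<open>\<And>v. v \<in> set (a # vs) \<Longrightarrow> x v \<in> par (D v)\<close> by auto
    then have "comm q (x c)" using Cons.prems(3) comm_joined by blast
    then have "cj (x c + sum_list (map x us)) q = cj (sum_list (map x us)) q"
      using cj_simps(5)[of "sum_list (map x us)" "x c" q] cj_comm[of q "x c"] by simp
    then show ?case using Cons by simp
  qed simp
  show ?case
  proof (cases "v = a")
    case True
    have "cj (x a) p \<in> par (D v)" using Cons.prems(3)[of a] assms(5) True by simp
    then have "cj (sum_list (map x vs)) (cj (x a) p) = cj (x a) p"
      using Cons.prems(1) True by (intro skip) auto
    then show ?thesis using True by simp
  next
    case False
    then have "cj (x a) p = p" using skip[of "[a]" p] Cons.prems assms(5) by simp
    then have "cj (x a + sum_list (map x vs)) p = cj (sum_list (map x vs)) p"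
      using cj_simps(5)[of "sum_list (map x vs)" "x a" p] by simp
    moreover have "cj (sum_list (map x vs)) p = cj (x v) p"
      using False Cons.prems by (intro Cons.IH) auto
    ultimately show ?thesis by simp
  qed
qed simp

text \<open>The two conjugators differ by an element normalising \<open>par C\<close>, which acts on
  \<open>par C\<close> like its retraction; the difference can therefore be absorbed into
  \<open>x\<close>.\<close>

lemma cpar_normalize:
  assumes "cpar C g' = cpar C g" "x \<in> par C" "p \<in> par C"
  obtains x' where "x' \<in> par C" "cj (x + g') p = cj (x' + g) p"
proof -
  define k where "k = g' + - g"
  have "cj g' (cj x p) \<in> cpar C g" using assms by (auto simp: cpar_def simp del: cj_simps(5))
  then have "cj k (cj x p) \<in> par C" by (simp add: cpar_iff k_def add.assoc)
  then have "cj k (cj x p) = rho C (cj k (cj x p))" by (simp only: rho_par)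
  also have "\<dots> = cj (x + rho C k) p" using assms(2,3) by (simp add: rho_par)
  finally have "cj g (cj k (cj x p)) = cj g (cj (x + rho C k) p)" by simp
  then have "cj (x + g') p = cj ((x + rho C k) + g) p" by (simp add: k_def add.assoc)
  then show ?thesis using that[of "x + rho C k"] assms(2) by simp
qed

text \<open>The blocks \<open>b\<close> of a family \<open>y\<close> are replaced by conjugates \<open>U\<close> of vertices with the same commutation
  graph. A block is indexed by the representative vertex of its support.\<close>

lemma resolution:
  fixes y :: "'a \<Rightarrow> 'v::graph raag"
  assumes fin: "finite VD" "distinct vl" and y: "\<And>x. x \<in> VD \<Longrightarrow> y x \<in> par (set vl)"
  obtains L :: "('a \<times> 'v) set" and U b where "L \<subseteq> VD \<times> set vl"
    "\<And>x v. (x, v) \<in> L \<Longrightarrow> U (x, v) \<in> par (set vl) \<and> (\<exists>h. U (x, v) = cj h (gen v))"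
    "\<And>x. x \<in> VD \<Longrightarrow> y x = sum_list (map (\<lambda>v. b (x, v)) (filter (\<lambda>v. (x, v) \<in> L) vl))"
    "\<And>l m. l \<in> L \<Longrightarrow> m \<in> L \<Longrightarrow> comm (U l) (U m) \<Longrightarrow> comm (b l) (b m)"
    "\<And>x v x' v'. (x, v) \<in> L \<Longrightarrow> (x', v') \<in> L \<Longrightarrow> comm (y x) (y x') \<Longrightarrow> comm (U (x, v)) (U (x', v'))"
    "\<And>v. (x0, v) \<in> L \<Longrightarrow> U (x0, v) = gen v"
proof -
  have "\<forall>x. \<exists>p. pcl (y x) (fst p) (snd p)" by (metis fst_conv pcl_exists snd_conv)
  then obtain Ag where Ag: "\<And>x. pcl (y x) (fst (Ag x)) (snd (Ag x))" by metis
  define A where "A x = fst (Ag x)" for x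
  define g where "g x = snd (Ag x)" for x
  have pcl: "pcl (y x) (A x) (g x)" for x using Ag by (simp add: A_def g_def)
  have Asub: "cpar (A x) (g x) \<subseteq> par (set vl)" "A x \<subseteq> set vl" if "x \<in> VD" for x
  proof -
    show "cpar (A x) (g x) \<subseteq> par (set vl)"
      using pcl_least[OF pcl, of x "set vl" 0] y[OF that] by simp
    then show "A x \<subseteq> set vl" using cpar_vertices[of "A x" "g x" "set vl" 0] by simp
  qed
  define rp :: "'v set \<Rightarrow> 'v" where "rp C = (SOME v. v \<in> C)" for C
  define C where "C l = cocomp (A (fst l)) (snd l)" for l
  define L where "L = {(x, v). x \<in> VD \<and> v \<in> A x \<and> rp (cocomp (A x) v) = v}"
  define b where "b l = cj (g (fst l)) (rho (C l) (cj (- g (fst l)) (y (fst l))))" for l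
  define P where "P l = cpar (C l) (g (fst l))" for l
  have Lsub: "L \<subseteq> VD \<times> set vl" using Asub(2) by (auto simp: L_def)
  have finL: "finite L" using Lsub fin finite_subset by blast
  have Lv: "fst l \<in> VD" "snd l \<in> A (fst l)" "rp (C l) = snd l" if "l \<in> L" for l
    using that by (auto simp: L_def C_def)
  have pb: "pcl (b l) (C l) (g (fst l))" and irrC: "irr (C l)" and vC: "snd l \<in> C l"
    and CA: "C l \<subseteq> A (fst l)" if "l \<in> L" for l
  proof -
    have v: "snd l \<in> A (fst l)" using Lv that by blast
    show CA: "C l \<subseteq> A (fst l)" unfolding C_def by (rule cocomp_subset[OF v])
    have "pcl (rho (C l) (cj (- g (fst l)) (y (fst l)))) (C l) 0"
    proof (rule pcl_component)
      show "pcl (cj (- g (fst l)) (y (fst l))) (A (fst l)) 0" using pcl pcl_base by blast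
      show "joined (C l) (A (fst l) - C l)" unfolding C_def by (rule cocomp_joined[OF v])
    qed (rule CA)
    from pcl_cj[OF this, of "g (fst l)"] show "pcl (b l) (C l) (g (fst l))" by (simp only: b_def add_0)
    show "irr (C l)" unfolding C_def by (rule irr_cocomp[OF v])
    show "snd l \<in> C l" by (simp add: C_def)
  qed
  have bP: "b l \<in> P l" if "l \<in> L" for l using pcl_in(1)[OF pb[OF that]] by (simp add: P_def)
  \<comment> \<open>Commuting blocks with the same closure are given the same conjugate, since
    separate generic choices in one closure need not commute. That this is an equivalence relation
    rests on \<open>irr_commute_trans\<close>.\<close>
  define cls where "cls l m \<longleftrightarrow> P l = P m \<and> comm (b l) (b m)" for l m
  have cls_sym: "cls m l" if "cls l m" for l m using that comm_sym by (auto simp: cls_def)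
  have cls_C: "C l = C m" if "cls l m" "l \<in> L" for l m
    using pcl_cong(1)[OF pb[OF that(2)]] that by (auto simp: cls_def P_def)
  have cls_trans: "cls l k" if "cls l m" "cls m k" "l \<in> L" "m \<in> L" "k \<in> L" for l m k
  proof -
    have P: "P m = P l" "P k = P l" using that by (simp_all add: cls_def)
    have pm: "pcl (b m) (C l) (g (fst l))" and pk: "pcl (b k) (C l) (g (fst l))"
      using pcl_cong[OF pb[OF that(4)], of "C l" "g (fst l)"] pcl_cong[OF pb[OF that(5)], of "C l" "g (fst l)"] P
      by (auto simp: P_def)
    have "comm (b l) (b m)" "comm (b k) (b m)" using that(1) cls_sym[OF that(2)] by (simp_all add: cls_def)
    then have "comm (b l) (b k)"
      by (rule irr_commute_trans[OF irrC[OF that(3)] pb[OF that(3)] pm pk])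
    then show ?thesis using P by (simp add: cls_def)
  qed
  define \<kappa> where "\<kappa> l = (SOME m. m \<in> L \<and> cls l m)" for l
  have \<kappa>: "\<kappa> l \<in> L" "cls l (\<kappa> l)" if "l \<in> L" for l
  proof -
    have "l \<in> L \<and> cls l l" using that by (simp add: cls_def)
    then have "\<kappa> l \<in> L \<and> cls l (\<kappa> l)" unfolding \<kappa>_def by (rule someI)
    then show "\<kappa> l \<in> L" "cls l (\<kappa> l)" by blast+
  qed
  have \<kappa>_eq: "\<kappa> l = \<kappa> m" if "cls l m" "l \<in> L" "m \<in> L" for l m
  proof -
    have "(\<lambda>k. k \<in> L \<and> cls l k) = (\<lambda>k. k \<in> L \<and> cls m k)"
      using that cls_trans cls_sym by blast
    then show ?thesis by (simp add: \<kappa>_def)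
  qed
  have \<kappa>_snd: "snd (\<kappa> l) = snd l" if "l \<in> L" for l
    using cls_C[OF \<kappa>(2) that] Lv(3)[OF that] Lv(3)[OF \<kappa>(1)[OF that]] that by simp
  have XL: "irr (C k) \<and> finite (C k) \<and> snd k \<in> C k" if "k \<in> L" for k
    using irrC vC pcl_in(2)[OF pb] that by blast
  obtain u where u: "\<And>k. k \<in> L \<Longrightarrow> \<exists>x\<in>par (C k). u k = cj (x + g (fst k)) (gen (snd k))"
    "\<And>k l. k \<in> L \<Longrightarrow> l \<in> L \<Longrightarrow> k \<noteq> l \<Longrightarrow> comm (u k) (u l) \<Longrightarrow> comm_sets (P k) (P l)"
    using generic_family[of L C snd "\<lambda>k. g (fst k)"] finL XL unfolding P_def by blast
  define U where "U l = u (\<kappa> l)" for l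
  have UP: "U l \<in> P l" if l: "l \<in> L" for l
  proof -
    obtain x where x: "x \<in> par (C (\<kappa> l))" "U l = cj (x + g (fst (\<kappa> l))) (gen (snd (\<kappa> l)))"
      using u(1)[OF \<kappa>(1)[OF l]] by (auto simp: U_def)
    have "gen (snd (\<kappa> l)) \<in> par (C (\<kappa> l))" using vC \<kappa>(1) that by simp
    then have "cj (g (fst (\<kappa> l))) (cj x (gen (snd (\<kappa> l)))) \<in> P (\<kappa> l)"
      unfolding P_def cpar_def using x(1) by (intro imageI) simp
    then show ?thesis using x(2) \<kappa>(2)[OF that] by (simp add: cls_def)
  qed
  have U4: "comm (b l) (b m)" if "l \<in> L" "m \<in> L" "comm (U l) (U m)" for l m
  proof (cases "\<kappa> l = \<kappa> m")
    case True
    then have "cls l m" using \<kappa>[OF that(1)] \<kappa>[OF that(2)] that cls_trans[of l "\<kappa> l" m] cls_sym by metis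
    then show ?thesis by (simp add: cls_def)
  next
    case False
    then have "comm_sets (P (\<kappa> l)) (P (\<kappa> m))" using u(2) that \<kappa>(1) by (simp add: U_def)
    then have "comm_sets (P l) (P m)" using \<kappa>(2) that by (simp add: cls_def)
    then show ?thesis using bP that by (simp add: comm_sets_def)
  qed
  have U5: "comm (U l) (U m)" if l: "l \<in> L" and m: "m \<in> L" and "comm (y (fst l)) (y (fst m))" for l m
  proof -
    have "comm (y (fst l)) (b m)"
      using comm_block[OF pcl Lv(2)[OF that(2)] that(3)] by (simp only: b_def C_def)
    from comm_block[OF pcl Lv(2)[OF that(1)] comm_sym[OF this]]
    have "comm (b l) (b m)" unfolding b_def C_def by (rule comm_sym)
    then consider "P l = P m" "comm (b l) (b m)" | "comm_sets (P l) (P m)"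
      using commuting_closures[OF pb[OF l] irrC[OF l] pb[OF m] irrC[OF m]]
      unfolding P_def by blast
    then show ?thesis
    proof cases
      case 1
      then show ?thesis using \<kappa>_eq that by (simp add: cls_def U_def)
    next
      case 2
      then show ?thesis using UP that by (simp add: comm_sets_def)
    qed
  qed
  have ULpar: "U l \<in> par (set vl)" if "l \<in> L" for l
  proof -
    have "P l \<subseteq> cpar (A (fst l)) (g (fst l))"
      unfolding P_def cpar_def using par_mono[OF _ CA[OF that]] by blast
    then show ?thesis using UP[OF that] Asub(1) Lv(1)[OF that] by blast
  qed
  let ?vs = "\<lambda>x. filter (\<lambda>v. (x, v) \<in> L) vl"
  have vsj: "joined (C (x, v)) (C (x, w))" if "v \<in> set (?vs x)" "w \<in> set (?vs x)" "v \<noteq> w" for x v w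
  proof -
    have L: "(x, v) \<in> L" "(x, w) \<in> L" using that by auto
    have "C (x, v) \<noteq> C (x, w)" using Lv(3)[OF L(1)] Lv(3)[OF L(2)] that(3) by auto
    then show ?thesis
      using Lv(2)[OF L(1)] Lv(2)[OF L(2)] cocomp_disjoint_joined[of v "A x" w] by (simp add: C_def)
  qed
  have sum: "y x = sum_list (map (\<lambda>v. b (x, v)) (?vs x))" if x: "x \<in> VD" for x
  proof -
    have cov: "A x \<subseteq> \<Union>(set (map (\<lambda>v. C (x, v)) (?vs x)))"
    proof
      fix w assume w: "w \<in> A x"
      define v where "v = rp (cocomp (A x) w)"
      have "v \<in> cocomp (A x) w" unfolding v_def rp_def using cocomp_self by (rule someI)
      then have c: "cocomp (A x) v = cocomp (A x) w" and "v \<in> A x"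
        using cocomp_eq cocomp_subset[OF w] by blast+
      then have "(x, v) \<in> L" using x by (simp add: L_def v_def)
      moreover have "w \<in> C (x, v)" using c by (simp add: C_def)
      ultimately show "w \<in> \<Union>(set (map (\<lambda>v. C (x, v)) (?vs x)))" using Lsub by auto
    qed
    have "cj (- g x) (y x) \<in> par (A x)" using pcl_in(1)[OF pcl, of x] by (simp add: cpar_iff)
    then have "cj (- g x) (y x) \<in> par (\<Union>(set (map (\<lambda>v. C (x, v)) (?vs x))))" using cov by (rule par_mono)
    moreover have "sorted_wrt joined (map (\<lambda>v. C (x, v)) (?vs x))"
      unfolding sorted_wrt_map using fin(2) vsj by (intro sorted_wrt_distinctI) auto
    ultimately have "cj (- g x) (y x)
        = sum_list (map (\<lambda>D. rho D (cj (- g x) (y x))) (map (\<lambda>v. C (x, v)) (?vs x)))"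
      by (intro sum_components)
    from arg_cong[OF this, of "cj (g x)"] have "cj (g x) (cj (- g x) (y x))
        = sum_list (map (\<lambda>v. b (x, v)) (?vs x))"
      by (simp only: cj_sum_list map_map o_def b_def fst_conv)
    then show ?thesis by simp
  qed
  have "\<exists>x'. x' \<in> par (C (x0, v)) \<and> U (x0, v) = cj (x' + g x0) (gen v)" if l: "(x0, v) \<in> L" for v
  proof -
    let ?k = "\<kappa> (x0, v)"
    obtain x where x: "x \<in> par (C ?k)" "U (x0, v) = cj (x + g (fst ?k)) (gen v)"
      using u(1)[OF \<kappa>(1)[OF l]] \<kappa>_snd[OF l] by (auto simp: U_def)
    have "C ?k = C (x0, v)" using cls_C[OF \<kappa>(2)] l by simp
    moreover have "cpar (C ?k) (g (fst ?k)) = cpar (C (x0, v)) (g x0)"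
      using \<kappa>(2)[OF l] by (simp add: cls_def P_def)
    ultimately show ?thesis
      using cpar_normalize[of "C (x0, v)" "g (fst ?k)" "g x0" x "gen v"] x vC[OF l] by (metis gen_in_par snd_conv)
  qed
  then obtain x' where x': "\<And>v. (x0, v) \<in> L \<Longrightarrow> x' v \<in> par (C (x0, v)) \<and> U (x0, v) = cj (x' v + g x0) (gen v)"
    by metis
  \<comment> \<open>The supports of the blocks of \<open>x0\<close> are pairwise joined, so the sum
    of the conjugators acts on each \<open>gen v\<close> like its own \<open>x' v\<close>. One
    global conjugation thus straightens all blocks of \<open>x0\<close> at once; retracting
    \<open>q0\<close> keeps it inside \<open>par (set vl)\<close>.\<close>
  define q0 where "q0 = sum_list (map x' (?vs x0)) + g x0"
  define q where "q = rho (set vl) q0"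
  have q: "U (x0, v) = cj q (gen v)" if l: "(x0, v) \<in> L" for v
  proof -
    have vvl: "v \<in> set vl" using l Lsub by auto
    have "cj (sum_list (map x' (?vs x0))) (gen v) = cj (x' v) (gen v)"
      using fin(2) x' vsj vC[OF l] l vvl by (intro cj_sum_joined[where D = "\<lambda>v. C (x0, v)"]) auto
    then have "cj (g x0) (cj (sum_list (map x' (?vs x0))) (gen v)) = cj (g x0) (cj (x' v) (gen v))" by simp
    then have "U (x0, v) = cj q0 (gen v)" using x'[OF l] by (simp add: q0_def)
    then have "rho (set vl) (U (x0, v)) = cj q (gen v)" using vvl by (simp add: q_def)
    then show ?thesis using ULpar[OF l] by (simp add: rho_par)
  qed
  have qp: "- q \<in> par (set vl)" by (simp add: q_def)
  have Uform: "\<exists>h. U (x, v) = cj h (gen v)" if "(x, v) \<in> L" for x v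
    using u(1)[OF \<kappa>(1)[OF that]] \<kappa>_snd[OF that] by (auto simp: U_def)
  show ?thesis
  proof (rule that[of L "\<lambda>l. cj (- q) (U l)" b])
    show "cj (- q) (U (x, v)) \<in> par (set vl) \<and> (\<exists>h. cj (- q) (U (x, v)) = cj h (gen v))"
      if "(x, v) \<in> L" for x v
      using ULpar[OF that] Uform[OF that] qp by auto
    show "cj (- q) (U (x0, v)) = gen v" if "(x0, v) \<in> L" for v using q[OF that] by simp
  qed (use Lsub sum U4 U5 in auto)
qed

text \<open>Vertices carry their graph, so every right-angled Artin group embeds in a single group type.\<close>

datatype 'a uv = UV "'a \<Rightarrow> 'a \<Rightarrow> bool" 'a

instantiation uv :: (type) graph
begin

fun adj_uv :: "'a uv \<Rightarrow> 'a uv \<Rightarrow> bool" where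
  "adj_uv (UV E x) (UV F y) \<longleftrightarrow> E = F \<and> x \<noteq> y \<and> E x y \<and> E y x"

instance
proof
  fix x y :: "'a uv"
  show "adj x y \<Longrightarrow> adj y x" by (cases x; cases y) auto
  show "\<not> adj x x" by (cases x) auto
qed

end

section \<open>Colouring\<close>

lemma cj_drop_central:
  assumes "h \<in> par Y" "p \<in> par Y" and Z: "\<And>z. z \<in> Z \<Longrightarrow> Y \<subseteq> st z"
  shows "cj (rho (- Z) h) p = cj h p"
  using assms(1,2)
proof (induction arbitrary: p rule: par_induct)
  case (plus v b h)
  have 1: "cj (signed (gen v) b) p \<in> par Y" using plus by simp
  show ?case
  proof (cases "v \<in> Z")
    case True
    have "p \<in> par (st v)" using plus(4) Z[OF True] by (rule par_mono)
    then have "cj (signed (gen v) b) p = p" by (intro cj_comm) (simp add: comm_gen_st)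
    then have "cj (signed (gen v) b + h) p = cj h p" using cj_simps(5)[of h "signed (gen v) b" p] by simp
    then show ?thesis using True plus by simp
  next
    case False
    have "cj (rho (- Z) h) (cj (signed (gen v) b) p) = cj h (cj (signed (gen v) b) p)"
      by (rule plus(3)[OF 1])
    then show ?thesis using False by simp
  qed
qed simp

text \<open>Each fibre of \<open>U\<close> is numbered from \<open>1\<close>, so colour
  \<open>n\<close> occurs only in a full fibre. There \<open>norm\<close> identifies the common
  value as a vertex of \<open>Z\<close>, \<open>clique\<close> makes it commute with every
  \<open>U m\<close>, and \<open>cj_drop_central\<close> removes such vertices from the
  conjugators.\<close>

lemma colouring:
  fixes U :: "'a \<times> 'v::graph \<Rightarrow> 'v raag"
  assumes fin: "finite VD" "finite VG" and n: "card VD = n" and x0: "x0 \<in> VD" and L: "L \<subseteq> VD \<times> VG"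
    and form: "\<And>x v. (x, v) \<in> L \<Longrightarrow> U (x, v) \<in> par VG \<and> (\<exists>h. U (x, v) = cj h (gen v))"
    and clique: "\<And>x v v'. (x, v) \<in> L \<Longrightarrow> (x, v') \<in> L \<Longrightarrow> comm (U (x, v)) (U (x, v'))"
    and norm: "\<And>v. (x0, v) \<in> L \<Longrightarrow> U (x0, v) = gen v"
  obtains Z col h where "inj_on (\<lambda>l. (col l, U l)) L"
    "\<And>l. l \<in> L \<Longrightarrow> col l \<in> {1..n} \<and> (col l = n \<longrightarrow> snd l \<in> Z)"
    "\<And>l. l \<in> L \<Longrightarrow> h l \<in> par (VG - Z) \<and> U l = cj (h l) (gen (snd l))"
proof -
  have finL: "finite L" using L fin finite_subset by blast
  define F where "F u = {l\<in>L. U l = u}" for u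
  have expoU: "expo w (U l) = (if snd l = w then 1 else 0)" if "l \<in> L" for l w
    using form[of "fst l" "snd l"] that by auto
  have snd_eq: "snd l = snd m" if "l \<in> L" "m \<in> L" "U l = U m" for l m
    using expoU[OF that(1), of "snd l"] expoU[OF that(2), of "snd l"] that(3) by (simp split: if_splits)
  have injF: "inj_on fst (F u)" for u
  proof (rule inj_onI)
    fix l m assume "l \<in> F u" "m \<in> F u" "fst l = fst m"
    then show "l = m" using snd_eq[of l m] by (auto simp: F_def prod_eq_iff)
  qed
  have finF: "finite (F u)" for u using finL by (simp add: F_def)
  have subF: "fst ` F u \<subseteq> VD" for u using L by (auto simp: F_def)
  have cardF: "card (F u) \<le> n" for u
    using card_mono[OF fin(1) subF, of u] card_image[OF injF, of u] n by simp
  have "\<exists>f. bij_betw f (F u) {1..card (F u)}" for u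
    using finF by (intro finite_same_card_bij) auto
  then obtain f where f: "\<And>u. bij_betw (f u) (F u) {1..card (F u)}" by metis
  define col where "col l = f (U l) l" for l
  define Z where "Z = {v. \<exists>l\<in>L. snd l = v \<and> card (F (U l)) = n}"
  have inj: "inj_on (\<lambda>l. (col l, U l)) L"
  proof (rule inj_onI)
    fix l m assume lm: "l \<in> L" "m \<in> L" "(col l, U l) = (col m, U m)"
    then have "f (U l) l = f (U l) m" "l \<in> F (U l)" "m \<in> F (U l)" by (auto simp: col_def F_def)
    then show "l = m" using bij_betw_imp_inj_on[OF f, of "U l"] by (simp add: inj_on_def)
  qed
  have col: "col l \<in> {1..n} \<and> (col l = n \<longrightarrow> snd l \<in> Z)" if "l \<in> L" for l
  proof -
    have "col l \<in> {1..card (F (U l))}"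
      using bij_betw_apply[OF f, of l "U l"] that by (simp add: col_def F_def)
    then show ?thesis using cardF[of "U l"] that by (auto simp: Z_def)
  qed
  have Zst: "U m \<in> par (st z)" if z: "z \<in> Z" and m: "m \<in> L" for z m
  proof -
    obtain l where l: "l \<in> L" "snd l = z" "card (F (U l)) = n" using z by (auto simp: Z_def)
    have "fst ` F (U l) = VD"
      using card_image[OF injF] l(3) n by (intro card_subset_eq[OF fin(1) subF]) simp
    then have ex: "\<exists>v. (x, v) \<in> F (U l)" if "x \<in> VD" for x using that by (metis imageE prod.collapse)
    obtain v0 where "(x0, v0) \<in> F (U l)" using ex x0 by blast
    then have v0: "(x0, v0) \<in> L" "U (x0, v0) = U l" by (simp_all add: F_def)
    then have "U l = gen z" using norm[OF v0(1)] snd_eq[OF v0(1) l(1)] l(2) by simp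
    obtain x v where xv: "m = (x, v)" by (cases m)
    obtain v' where "(x, v') \<in> F (U l)" using ex m L xv by blast
    then have "comm (U m) (U l)" using clique[of x v v'] m xv by (simp add: F_def)
    then show ?thesis using \<open>U l = gen z\<close> centralizer_gen_iff by metis
  qed
  have "\<exists>h. h \<in> par (VG - Z) \<and> U l = cj h (gen (snd l))" if l: "l \<in> L" for l
  proof -
    let ?Y = "VG \<inter> (\<Inter>z\<in>Z. st z)"
    have UY: "U l \<in> par ?Y"
    proof (rule par_Int)
      show "U l \<in> par VG" using form[of "fst l" "snd l"] l by simp
      show "U l \<in> par (\<Inter>z\<in>Z. st z)"
      proof (rule par_avoid)
        fix a assume "a \<notin> (\<Inter>z\<in>Z. st z)"
        then obtain z where z: "z \<in> Z" "a \<notin> st z" by blast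
        show "U l \<in> par (- {a})" using Zst[OF z(1) l] by (rule par_mono) (use z in blast)
      qed
    qed
    have v: "snd l \<in> ?Y" using expo_par[OF UY, of "snd l"] expoU[OF l, of "snd l"] by (metis zero_neq_one)
    obtain h where h: "U l = cj h (gen (snd l))" using form[of "fst l" "snd l"] l by auto
    have "rho ?Y (U l) = cj (rho ?Y h) (gen (snd l))" unfolding h using v by simp
    then have "U l = cj (rho ?Y h) (gen (snd l))" using UY by (simp only: rho_par)
    also have "\<dots> = cj (rho (- Z) (rho ?Y h)) (gen (snd l))"
      using v by (intro cj_drop_central[symmetric, of _ ?Y]) auto
    finally have "U l = cj (rho (- Z) (rho ?Y h)) (gen (snd l))" .
    moreover have "rho (- Z) (rho ?Y h) \<in> par (VG - Z)"
      unfolding rho_rho by (rule par_mono[OF par_simps(2)]) blast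
    ultimately show ?thesis by blast
  qed
  then obtain h where "\<And>l. l \<in> L \<Longrightarrow> h l \<in> par (VG - Z) \<and> U l = cj (h l) (gen (snd l))" by metis
  then show ?thesis using that inj col by blast
qed

section \<open>Inflations\<close>

text \<open>Adjacency of coloured elements. Colours are ignored, so the same element in two colours
  gives two adjacent vertices, as the inflation requires.\<close>

definition commR :: "nat \<times> 'v::graph raag \<Rightarrow> nat \<times> 'v raag \<Rightarrow> bool" where
  "commR p q \<longleftrightarrow> comm (snd p) (snd q)"

text \<open>Conjugating by \<open>- g\<close> makes this a left action. Vertices with another
  adjacency relation share the type and are left fixed.\<close>

fun ext_vertex :: "'v::graph raag \<Rightarrow> (nat \<times> 'v raag) uv \<Rightarrow> (nat \<times> 'v raag) uv" where
  "ext_vertex g (UV R (c, u)) = UV R (if R = commR then (c, cj (- g) u) else (c, u))"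

definition ext_act :: "'v::graph raag \<Rightarrow> (nat \<times> 'v raag) uv raag \<Rightarrow> (nat \<times> 'v raag) uv raag" where
  "ext_act g = lift (\<lambda>p. gen (ext_vertex g p))"

lemma ext_vertex_adj: "adj p q \<Longrightarrow> adj (ext_vertex g p) (ext_vertex g q)"
proof -
  obtain R c u where p: "p = UV R (c, u)" by (cases p) auto
  obtain S d v where q: "q = UV S (d, v)" by (cases q) auto
  assume "adj p q"
  then show ?thesis by (auto simp: p q commR_def)
qed

lemma ext_vertex_plus: "ext_vertex (g + h) p = ext_vertex g (ext_vertex h p)"
proof -
  obtain R c u where p: "p = UV R (c, u)" by (cases p) auto
  show ?thesis by (simp add: p minus_add)
qed

lemma ext_vertex_zero: "ext_vertex 0 p = p"
proof -
  obtain R c u where p: "p = UV R (c, u)" by (cases p) auto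
  show ?thesis by (simp add: p)
qed

lemma ext_act_simps [simp]:
  "ext_act g 0 = 0" "ext_act g (a + b) = ext_act g a + ext_act g b" "ext_act g (- a) = - ext_act g a"
  "ext_act g (gen p) = gen (ext_vertex g p)" "ext_act g (signed a s) = signed (ext_act g a) s"
proof -
  have "adj_compatible (\<lambda>p. gen (ext_vertex g p))"
    by (simp add: adj_compatible_def comm_gen ext_vertex_adj)
  then show "ext_act g 0 = 0" "ext_act g (a + b) = ext_act g a + ext_act g b"
    "ext_act g (- a) = - ext_act g a" "ext_act g (gen p) = gen (ext_vertex g p)"
    "ext_act g (signed a s) = signed (ext_act g a) s"
    by (simp_all add: ext_act_def lift_simps)
qed

lemma ext_act_plus: "ext_act (g + h) k = ext_act g (ext_act h k)"
  by (induction k rule: raag_induct) (simp_all add: ext_vertex_plus)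

lemma ext_act_zero: "ext_act 0 k = k"
  by (induction k rule: raag_induct) (simp_all add: ext_vertex_zero)

locale inflation_graph =
  fixes VG :: "'v::graph set" and n :: nat and em :: "'v \<Rightarrow> nat \<Rightarrow> 'w::graph"
  assumes em_inj: "v \<in> VG \<Longrightarrow> v' \<in> VG \<Longrightarrow> c \<in> {1..n} \<Longrightarrow> c' \<in> {1..n} \<Longrightarrow> em v c = em v' c' \<Longrightarrow> v = v' \<and> c = c'"
    and em_adj: "v \<in> VG \<Longrightarrow> v' \<in> VG \<Longrightarrow> c \<in> {1..n} \<Longrightarrow> c' \<in> {1..n} \<Longrightarrow>
      adj (em v c) (em v' c') \<longleftrightarrow> (v = v' \<and> c \<noteq> c') \<or> adj v v'"
begin

lemma comm_em_st:
  assumes "v \<in> VG" "c \<in> {1..n}" "w \<in> VG" "c' \<in> {1..n}" "w \<in> st v"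
  shows "comm (gen (em w c')) (gen (em v c))"
proof (cases "em w c' = em v c")
  case False
  then have "adj (em w c') (em v c)"
    using assms em_adj[of w v c' c] adj_sym[of v w] by (auto simp: st_def lk_def)
  then show ?thesis by (rule comm_gen)
qed simp

definition dec :: "'w \<Rightarrow> 'v \<times> nat" where
  "dec p = (SOME (v, c). v \<in> VG \<and> c \<in> {1..n} \<and> p = em v c)"

lemma dec_em: "v \<in> VG \<Longrightarrow> c \<in> {1..n} \<Longrightarrow> dec (em v c) = (v, c)"
  unfolding dec_def using em_inj by (intro some_equality) auto

end

locale inflation = inflation_graph VG n em
  for VG :: "'v::graph set" and n and em :: "'v \<Rightarrow> nat \<Rightarrow> 'w::graph" +
  assumes n: "n \<ge> 1"
begin

definition ke :: "'v raag \<Rightarrow> 'w raag" where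
  "ke = lift (\<lambda>v. if v \<in> VG then gen (em v n) else 0)"

lemma ke_simps [simp]:
  "ke 0 = 0" "ke (a + b) = ke a + ke b" "ke (- a) = - ke a" "ke (signed a s) = signed (ke a) s"
  "ke (gen v) = (if v \<in> VG then gen (em v n) else 0)"
proof -
  have "adj_compatible (\<lambda>v. if v \<in> VG then gen (em v n) else 0)"
    using n by (auto simp: adj_compatible_def em_adj intro!: comm_gen)
  then show "ke 0 = 0" "ke (a + b) = ke a + ke b" "ke (- a) = - ke a" "ke (signed a s) = signed (ke a) s"
    "ke (gen v) = (if v \<in> VG then gen (em v n) else 0)"
    by (simp_all add: ke_def lift_simps)
qed

lemma comm_ke_st:
  assumes "v \<in> VG" "c \<in> {1..n}" "e \<in> par (st v)"
  shows "comm (ke e) (gen (em v c))"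
  using assms(3)
proof (induction rule: par_induct)
  case (plus w b e)
  then show ?case using n assms by (auto intro!: comm_plus comm_em_st)
qed simp

text \<open>After a conjugation, \<open>gen v\<close> commutes with \<open>cj k (gen v')\<close>.
  Then \<open>v'\<close> is in the star of \<open>v\<close>, and \<open>k\<close> is the sum of an
  element of \<open>par (st v')\<close> and the element \<open>k0\<close> of
  \<open>par (st v)\<close>. By \<open>comm_ke_st\<close> the images of both summands commute with
  the respective vertex in any colour, so the commutation survives in the inflation.\<close>

lemma comm_inflate:
  assumes v: "v \<in> VG" "c \<in> {1..n}" and v': "v' \<in> VG" "c' \<in> {1..n}"
    and comm: "comm (cj h (gen v)) (cj h' (gen v'))"
  shows "comm (cj (ke h) (gen (em v c))) (cj (ke h') (gen (em v' c')))"
proof -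
  define k where "k = h' + - h"
  have "comm (cj (- h) (cj h (gen v))) (cj (- h) (cj h' (gen v')))" using comm by (simp only: comm_cj)
  then have "comm (gen v) (cj k (gen v'))" by (simp add: k_def)
  then have "comm (cj k (gen v')) (gen v)" by (rule comm_sym)
  then have kst: "cj k (gen v') \<in> par (st v)" by (simp only: centralizer_gen_iff)
  have v'st: "v' \<in> st v"
  proof (rule ccontr)
    assume "v' \<notin> st v"
    from expo_par[OF kst this] show False by simp
  qed
  define k0 where "k0 = rho (st v) k"
  have "cj k (gen v') = rho (st v) (cj k (gen v'))" using kst by (simp only: rho_par)
  also have "\<dots> = cj k0 (gen v')" using v'st by (simp add: k0_def)
  finally have "cj (- k0) (cj k (gen v')) = gen v'" by simp
  then have "comm (gen v') (k + - k0)" by (simp add: comm_iff_cj)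
  then have "k + - k0 \<in> par (st v')" using comm_sym by (simp only: centralizer_gen_iff[symmetric])
  then have "comm (ke (k + - k0)) (gen (em v' c'))" by (rule comm_ke_st[OF v'])
  then have "cj (ke (k + - k0)) (gen (em v' c')) = gen (em v' c')" by (rule cj_comm[OF comm_sym])
  then have "cj (ke k0) (cj (ke (k + - k0)) (gen (em v' c'))) = cj (ke k0) (gen (em v' c'))" by simp
  then have e: "cj (ke k) (gen (em v' c')) = cj (ke k0) (gen (em v' c'))" by (simp add: add.assoc)
  have "comm (ke k0) (gen (em v c))" by (rule comm_ke_st[OF v]) (simp add: k0_def)
  moreover have "comm (gen (em v' c')) (gen (em v c))" by (rule comm_em_st[OF v v' v'st])
  ultimately have "comm (cj (ke k0) (gen (em v' c'))) (gen (em v c))"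
    by (simp add: cj_def comm_plus)
  then have "comm (cj (ke h) (cj (ke k) (gen (em v' c')))) (cj (ke h) (gen (em v c)))"
    unfolding e by (simp only: comm_cj)
  then have "comm (cj (ke h') (gen (em v' c'))) (cj (ke h) (gen (em v c)))"
    by (simp add: k_def add.assoc)
  then show ?thesis by (rule comm_sym)
qed

text \<open>The group of the inflation acts on pairs as the semidirect product of the group on the
  (coloured) conjugates of vertices with the group on \<open>VG\<close>: a letter of colour \<open>n\<close> outside \<open>Z\<close> acts by
  conjugation, every other letter is itself a coloured vertex.\<close>

definition pair_letter :: "'v set \<Rightarrow> 'w \<Rightarrow> bool \<Rightarrow> (nat \<times> 'v raag) uv raag \<times> 'v raag
    \<Rightarrow> (nat \<times> 'v raag) uv raag \<times> 'v raag" where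
  "pair_letter Z p s = (\<lambda>(k, g).
     if \<exists>v\<in>VG. \<exists>c\<in>{1..n}. p = em v c then
       (let (v, c) = dec p in
        if c = n \<and> v \<notin> Z then (ext_act (signed (gen v) s) k, signed (gen v) s + g)
        else (signed (gen (UV commR (c, gen v))) s + k, g))
     else (k, g))"

lemma pair_letter_em:
  assumes "v \<in> VG" "c \<in> {1..n}"
  shows "pair_letter Z (em v c) s (k, g) =
    (if c = n \<and> v \<notin> Z then (ext_act (signed (gen v) s) k, signed (gen v) s + g)
     else (signed (gen (UV commR (c, gen v))) s + k, g))"
proof -
  have "\<exists>v'\<in>VG. \<exists>c'\<in>{1..n}. em v c = em v' c'" using assms by blast
  then show ?thesis unfolding pair_letter_def by (simp only: prod.case if_True Let_def dec_em[OF assms])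
qed

lemma pair_letter_other: "\<not> (\<exists>v\<in>VG. \<exists>c\<in>{1..n}. p = em v c) \<Longrightarrow> pair_letter Z p s x = x"
  by (cases x) (simp add: pair_letter_def)

text \<open>The relation that mixes the two kinds of letters holds because a vertex commuting with
  \<open>w\<close> acts trivially on the coloured vertices \<open>(c, gen w)\<close>.\<close>

lemma pair_action: "letter_action (pair_letter Z) UNIV"
proof
  fix x and p :: 'w and b
  show "pair_letter Z p b (pair_letter Z p (\<not> b) x) = x"
  proof (cases "\<exists>v\<in>VG. \<exists>c\<in>{1..n}. p = em v c")
    case True
    then obtain v c where vc: "v \<in> VG" "c \<in> {1..n}" "p = em v c" by blast
    obtain k g where x: "x = (k, g)" by (cases x)
    have "ext_act (signed (gen v) b) (ext_act (signed (gen v) (\<not> b)) k) = k"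
      using ext_act_plus[of "signed (gen v) b" "signed (gen v) (\<not> b)" k] by (simp add: ext_act_zero)
    then show ?thesis unfolding x vc(3) using vc(1,2) by (simp add: pair_letter_em)
  qed (simp add: pair_letter_other)
next
  fix x and p q :: 'w and b c assume adj: "adj p q"
  show "pair_letter Z p b (pair_letter Z q c x) = pair_letter Z q c (pair_letter Z p b x)"
  proof (cases "(\<exists>v\<in>VG. \<exists>c\<in>{1..n}. p = em v c) \<and> (\<exists>v\<in>VG. \<exists>c\<in>{1..n}. q = em v c)")
    case False
    then show ?thesis by (auto simp: pair_letter_other)
  next
    case True
    then obtain v i w j where p: "v \<in> VG" "i \<in> {1..n}" "p = em v i" and q: "w \<in> VG" "j \<in> {1..n}" "q = em w j"
      by blast
    obtain k g where x: "x = (k, g)" by (cases x)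
    have vw: "(v = w \<and> i \<noteq> j) \<or> adj v w" using adj em_adj[OF p(1) q(1) p(2) q(2)] p q by simp
    then have cvw: "comm (gen v) (gen w)" by (auto intro: comm_gen)
    then have cs: "comm (signed (gen v) b) (signed (gen w) c)" by simp
    have inv: "ext_act (signed (gen v) s) (gen (UV commR (m, gen w))) = gen (UV commR (m, gen w))"
      "ext_act (signed (gen w) s) (gen (UV commR (m, gen v))) = gen (UV commR (m, gen v))" for s m
      using cvw comm_sym[OF cvw] by (simp_all add: cj_comm)
    have ce: "comm (signed (gen (UV commR (i, gen v))) b) (signed (gen (UV commR (j, gen w))) c)"
      using vw cvw comm_sym[OF cvw] by (auto simp: commR_def intro!: comm_gen)
    show ?thesis unfolding x p(3) q(3)
      using p(1,2) q(1,2) cs ce inv ext_act_plus[of "signed (gen v) b" "signed (gen w) c" k]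
        ext_act_plus[of "signed (gen w) c" "signed (gen v) b" k]
      by (auto simp: pair_letter_em comm_def add.assoc[symmetric] simp del: ext_vertex.simps)
  qed
qed simp

lemma pair_act_ke:
  assumes "h \<in> par (VG - Z)"
  shows "raag_act (pair_letter Z) (ke h) (k, g) = (ext_act h k, h + g)"
proof -
  interpret letter_action "pair_letter Z" UNIV by (rule pair_action)
  show ?thesis using assms
  proof (induction rule: par_induct)
    case zero
    show ?case by (simp add: raag_act_zero ext_act_zero)
  next
    case (plus v b h)
    then have v: "v \<in> VG" "v \<notin> Z" by auto
    then show ?case using n plus(3)
      by (simp add: raag_act_plus raag_act_signed_gen pair_letter_em ext_act_plus add.assoc)
  qed
qed

text \<open>The conjugator acts on the first component by an automorphism; conjugating the left
  addition of a coloured vertex by it gives the left addition of the image vertex.\<close>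

lemma pair_act_conjugate:
  assumes "h \<in> par (VG - Z)" "v \<in> VG" "c \<in> {1..n}" "c = n \<longrightarrow> v \<in> Z"
  shows "raag_act (pair_letter Z) (signed (cj (ke h) (gen (em v c))) s) (k, g)
    = (signed (gen (UV commR (c, cj h (gen v)))) s + k, g)"
proof -
  interpret letter_action "pair_letter Z" UNIV by (rule pair_action)
  have "signed (cj (ke h) (gen (em v c))) s = ke (- h) + (signed (gen (em v c)) s + ke h)"
    unfolding cj_signed[symmetric] by (simp add: cj_def add.assoc)
  moreover have "ext_act (- h) (ext_act h k) = k" using ext_act_plus[of "- h" h k] by (simp add: ext_act_zero)
  moreover have "- h \<in> par (VG - Z)" using assms by simp
  ultimately show ?thesis
    using assms pair_act_ke[of "- h" Z]
    by (auto simp: raag_act_plus pair_act_ke raag_act_signed_gen pair_letter_em simp del: ke_simps(3))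
qed

end

section \<open>Independence of the coloured conjugates\<close>

locale coloured_family = inflation VG n em
  for VG :: "'v::graph set" and n and em :: "'v \<Rightarrow> nat \<Rightarrow> 'w::graph" +
  fixes L :: "'l set" and U h :: "'l \<Rightarrow> 'v raag" and vt :: "'l \<Rightarrow> 'v" and col :: "'l \<Rightarrow> nat" and Z :: "'v set"
  assumes vt: "l \<in> L \<Longrightarrow> vt l \<in> VG"
    and inj: "inj_on (\<lambda>l. (col l, U l)) L"
    and col: "l \<in> L \<Longrightarrow> col l \<in> {1..n} \<and> (col l = n \<longrightarrow> vt l \<in> Z)"
    and U: "l \<in> L \<Longrightarrow> h l \<in> par (VG - Z) \<and> U l = cj (h l) (gen (vt l))"
begin

definition Uh :: "'l \<Rightarrow> 'w raag" where
  "Uh l = cj (ke (h l)) (gen (em (vt l) (col l)))"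

definition R :: "'l \<Rightarrow> 'l \<Rightarrow> bool" where
  "R l m \<longleftrightarrow> l \<in> L \<and> m \<in> L \<and> comm (U l) (U m)"

lemma comm_Uh: "l \<in> L \<Longrightarrow> m \<in> L \<Longrightarrow> comm (U l) (U m) \<Longrightarrow> comm (Uh l) (Uh m)"
  unfolding Uh_def using U vt col by (intro comm_inflate) auto

lemma pair_act_Uh:
  assumes "l \<in> L"
  shows "raag_act (pair_letter Z) (signed (Uh l) s) (k, g) = (signed (gen (UV commR (col l, U l))) s + k, g)"
  using assms U vt col unfolding Uh_def by (subst pair_act_conjugate) auto

lemma pair_act_word:
  assumes "set p \<subseteq> L \<times> UNIV"
  shows "raag_act (pair_letter Z) (word_sum Uh p) (0, 0) = (word_sum (\<lambda>l. gen (UV commR (col l, U l))) p, 0)"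
proof -
  interpret letter_action "pair_letter Z" UNIV by (rule pair_action)
  show ?thesis using assms
  proof (induction p)
    case (Cons a p)
    obtain l s where "a = (l, s)" by (cases a)
    then show ?case using Cons by (simp add: raag_act_plus pair_act_Uh)
  qed (simp add: raag_act_zero)
qed

lemma inj_Uh: "inj_on Uh L"
proof (rule inj_onI)
  fix l m assume lm: "l \<in> L" "m \<in> L" "Uh l = Uh m"
  then have "(signed (gen (UV commR (col l, U l))) True + 0, 0 :: 'v raag)
      = (signed (gen (UV commR (col m, U m))) True + 0, 0)"
    by (metis pair_act_Uh)
  then have "(col l, U l) = (col m, U m)" by (simp add: signed_def)
  then show "l = m" using inj lm by (simp add: inj_on_def)
qed

text \<open>Evaluating the pair action at \<open>(0, 0)\<close> turns a relation among the
  \<open>Uh l\<close> into the same relation among the vertices \<open>(col l, U l)\<close>, which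
  are distinct for distinct \<open>l\<close>. Killing all other vertices and renaming these by
  \<open>l\<close> gives the relation over \<open>R\<close>; so the \<open>Uh l\<close> satisfy no
  relations beyond those forced by their commutations.\<close>

lemma word_sum_Uh_eq_zero:
  assumes p: "set p \<subseteq> L \<times> UNIV" and z: "word_sum Uh p = 0"
  shows "word_sum (\<lambda>l. gen (UV R l)) p = 0"
proof -
  interpret letter_action "pair_letter Z" UNIV by (rule pair_action)
  have ext: "word_sum (\<lambda>l. gen (UV commR (col l, U l))) p = 0"
    using pair_act_word[OF p] by (simp add: z raag_act_zero)
  define unlab where "unlab q = (case q of UV S cu \<Rightarrow>
      if S = commR \<and> cu \<in> (\<lambda>l. (col l, U l)) ` L then gen (UV R (inv_into L (\<lambda>l. (col l, U l)) cu)) else 0)"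
    for q
  have unlab: "unlab (UV commR (col l, U l)) = gen (UV R l)" if "l \<in> L" for l
    using that inv_into_f_f[OF inj that] by (auto simp: unlab_def)
  have compat: "adj_compatible unlab"
    unfolding adj_compatible_def
  proof (intro allI impI)
    fix q q' :: "(nat \<times> 'v raag) uv" assume a: "adj q q'"
    obtain S cu S' cu' where q: "q = UV S cu" "q' = UV S' cu'" by (cases q; cases q')
    show "comm (unlab q) (unlab q')"
    proof (cases "S = commR \<and> cu \<in> (\<lambda>l. (col l, U l)) ` L \<and> cu' \<in> (\<lambda>l. (col l, U l)) ` L")
      case True
      then obtain l m where lm: "l \<in> L" "m \<in> L" "cu = (col l, U l)" "cu' = (col m, U m)" by blast
      have S': "S' = commR" using a True by (simp add: q)
      have "adj (UV R l) (UV R m)" using a lm True by (auto simp: q R_def commR_def)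
      then show ?thesis using True S' lm unlab by (simp add: q comm_gen)
    next
      case False
      then show ?thesis using a by (auto simp: q unlab_def)
    qed
  qed
  have "word_sum (\<lambda>l. gen (UV R l)) p = lift unlab (word_sum (\<lambda>l. gen (UV commR (col l, U l))) p)"
    using p by (induction p) (auto simp: lift_simps[OF compat] unlab)
  then show ?thesis by (simp add: ext lift_simps[OF compat])
qed

end

section \<open>Discrimination\<close>

lemma par_single:
  assumes "g \<in> par {v}"
  obtains m e where "g = npow m (signed (gen v) e)"
proof -
  have "\<exists>m e. g = npow m (signed (gen v) e)" using assms
  proof (induction rule: par_induct)
    case zero
    show ?case by (metis npow_0)
  next
    case (plus w b g)
    then obtain m e where g: "g = npow m (signed (gen v) e)" and w: "w = v" by blast
    show ?case
    proof (cases "b = e")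
      case True
      then have "signed (gen w) b + g = npow (Suc m) (signed (gen v) e)" using w g by (simp add: npow_Suc)
      then show ?thesis by blast
    next
      case False
      then have e: "e = (\<not> b)" by auto
      show ?thesis
      proof (cases m)
        case 0
        then have "signed (gen w) b + g = npow 1 (signed (gen v) b)" using g w by simp
        then show ?thesis by blast
      next
        case (Suc k)
        then have "signed (gen w) b + g = npow k (signed (gen v) e)" using g w e by (simp add: npow_Suc)
        then show ?thesis by blast
      qed
    qed
  qed
  then show ?thesis using that by blast
qed

text \<open>The parabolic on a clique is free abelian, with the exponent sums as
  coordinates.\<close>

lemma clique_expo_zero:
  assumes "finite Y" "\<And>a b. a \<in> Y \<Longrightarrow> b \<in> Y \<Longrightarrow> a \<noteq> b \<Longrightarrow> adj a b" "g \<in> par Y"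
    "\<And>a. a \<in> Y \<Longrightarrow> expo a g = 0"
  shows "g = 0"
  using assms
proof (induction Y arbitrary: g rule: finite_induct)
  case empty
  then show ?case by (simp add: par_empty)
next
  case (insert a Y)
  have j: "joined {a} Y" using insert by (auto simp: joined_def)
  have g: "g = rho {a} g + rho Y g" using insert.prems(2) by (intro joined_split[OF j]) simp
  have ex: "expo b g = expo b (rho {a} g) + expo b (rho Y g)" for b
    using expo_simps(2)[of b "rho {a} g" "rho Y g"] g by simp
  have "rho Y g = 0"
  proof (rule insert.IH)
    fix b assume b: "b \<in> Y"
    then have "expo b (rho {a} g) = 0" using insert(2) by (intro expo_par[of _ "{a}"]) auto
    then show "expo b (rho Y g) = 0" using ex[of b] insert.prems(3)[of b] b by simp
  qed (use insert.prems(1) in auto)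
  moreover obtain m e where m: "rho {a} g = npow m (signed (gen a) e)"
    using par_single[OF par_simps(2)] by metis
  ultimately have "int m * (if e then 1 else -1) = 0"
    using insert.prems(3)[of a] ex[of a] by (simp split: if_splits)
  then have "m = 0" by (simp split: if_splits)
  then show ?case using g m \<open>rho Y g = 0\<close> by simp
qed

text \<open>The elements whose normal form begins with a power of \<open>t\<close>. It plays the
  role of a ping-pong set: a base element outside \<open>par (lk t)\<close> followed on the left by
  a nontrivial power of \<open>t\<close> of either sign leads back into it.\<close>

definition starts_at :: "'v::graph \<Rightarrow> 'v raag set" where
  "starts_at t = {g. \<exists>e s. tact t g [] = (0, e) # s}"

lemma tact_npow_gen:
  assumes s: "valid t s" "\<And>s' e. s \<noteq> (0, e) # s'"
  shows "\<exists>s'. tact t (npow (Suc m) (signed (gen t) e)) s = (0, e) # s'"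
proof (induction m)
  case 0
  have "shift e s = (0, e) # s"
  proof (cases s)
    case (Cons x u)
    then show ?thesis using s(2)[of "snd x" u] by (cases x) auto
  qed simp
  then show ?case using s(1) by (simp add: tact_signed_gen tletter_def)
next
  case (Suc m)
  then obtain s' where s': "tact t (npow (Suc m) (signed (gen t) e)) s = (0, e) # s'" by blast
  have "valid t ((0, e) # s')"
    using tact_valid[OF s(1), of "npow (Suc m) (signed (gen t) e)"] by (simp only: s')
  then have "tact t (npow (Suc (Suc m)) (signed (gen t) e)) s = shift e ((0, e) # s')"
    using s unfolding npow_Suc[of "Suc m"]
    by (simp add: tact_plus tact_signed_gen tletter_def s' del: valid.simps)
  then show ?case by simp
qed

lemma starts_at_single: 
  assumes "h \<in> par {t}" "h \<noteq> 0" "b \<in> par (- {t})"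
  shows "h + b \<in> starts_at t"
proof -
  obtain m e where h: "h = npow m (signed (gen t) e)" using assms(1) by (rule par_single)
  then obtain m' where "m = Suc m'" using assms(2) by (cases m) auto
  then have "\<exists>s'. tact t h [] = (0, e) # s'" using h tact_npow_gen[of t "[]" m' e] by simp
  then show ?thesis using assms(3) by (auto simp: starts_at_def tact_plus tact_base)
qed

lemma starts_at_step:
  assumes "h \<in> par {t}" "h \<noteq> 0" "b \<in> par (- {t})" "b \<notin> par (lk t)" "d \<in> starts_at t"
  shows "h + (b + d) \<in> starts_at t"
proof -
  obtain m e where h: "h = npow m (signed (gen t) e)" using assms(1) by (rule par_single)
  then obtain m' where m': "m = Suc m'" using assms(2) by (cases m) auto
  obtain e' s where d: "tact t d [] = (0, e') # s" using assms(5) by (auto simp: starts_at_def)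
  have v: "valid t ((0, e') # s)" using tact_valid[of t "[]" d] d by simp
  let ?s = "base_act t b ((0, e') # s)"
  have vs: "valid t ?s" using v assms(3) by (rule base_act_valid)
  have bd: "tact t (b + d) [] = ?s" using assms(3) v by (simp add: tact_plus d tact_base)
  have "?s \<noteq> (0, e'') # s'" for e'' s' using assms(4) by (simp add: crep_eq_zero_iff)
  then obtain s' where "tact t h ?s = (0, e) # s'"
    using tact_npow_gen[OF vs, of m' e] unfolding h m' by blast
  then have "tact t (h + (b + d)) [] = (0, e) # s'" using tact_plus[of t "[]" h "b + d"] bd by simp
  then show ?thesis by (simp add: starts_at_def)
qed

lemma starts_at_nonzero:
  assumes "b \<in> par (- {t})" "d \<in> starts_at t"
  shows "b + d \<noteq> 0"
proof -
  obtain e' s where d: "tact t d [] = (0, e') # s" using assms(2) by (auto simp: starts_at_def)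
  have v: "valid t ((0, e') # s)" using tact_valid[of t "[]" d] d by simp
  have "tact t (b + d) [] = base_act t b ((0, e') # s)" using assms(1) v by (simp add: tact_plus d tact_base)
  then show ?thesis by (auto simp: tact_zero)
qed

section \<open>Collapsing the colours to powers\<close>

context inflation_graph
begin

text \<open>The exponents \<open>N ^ c\<close> turn exponent sums into polynomials in
  \<open>N\<close> whose coefficients are the exponent sums of the separate colours.\<close>

definition collapse :: "nat \<Rightarrow> 'w raag \<Rightarrow> 'v raag" where
  "collapse N = lift (\<lambda>p. if \<exists>v\<in>VG. \<exists>c\<in>{1..n}. p = em v c
      then npow (N ^ snd (dec p)) (gen (fst (dec p))) else 0)"

lemma collapse_compatible: "adj_compatible (\<lambda>p. if \<exists>v\<in>VG. \<exists>c\<in>{1..n}. p = em v c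
      then npow (N ^ snd (dec p)) (gen (fst (dec p))) else 0)"
  unfolding adj_compatible_def
proof (intro allI impI)
  fix p q :: 'w assume adj: "adj p q"
  let ?f = "\<lambda>p. if \<exists>v\<in>VG. \<exists>c\<in>{1..n}. p = em v c then npow (N ^ snd (dec p)) (gen (fst (dec p))) else 0"
  show "comm (?f p) (?f q)"
  proof (cases "(\<exists>v\<in>VG. \<exists>c\<in>{1..n}. p = em v c) \<and> (\<exists>v\<in>VG. \<exists>c\<in>{1..n}. q = em v c)")
    case True
    then obtain v i w j where p: "v \<in> VG" "i \<in> {1..n}" "p = em v i" and q: "w \<in> VG" "j \<in> {1..n}" "q = em w j"
      by blast
    have "v = w \<or> adj v w" using adj em_adj[OF p(1) q(1) p(2) q(2)] p q by auto
    then have "comm (gen v) (gen w)" by (auto intro: comm_gen)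
    then have "comm (npow (N ^ i) (gen v)) (npow (N ^ j) (gen w))"
      by (intro comm_npow comm_sym[OF comm_npow] comm_sym[of "gen v" "gen w"])
    moreover have "?f p = npow (N ^ i) (gen v)" "?f q = npow (N ^ j) (gen w)"
      using True dec_em[OF p(1,2)] dec_em[OF q(1,2)] unfolding p(3) q(3) by auto
    ultimately show ?thesis by (simp only:)
  next
    case False
    then show ?thesis by auto
  qed
qed

lemma collapse_simps [simp]:
  "collapse N 0 = 0" "collapse N (a + b) = collapse N a + collapse N b" "collapse N (- a) = - collapse N a" "collapse N (signed a s) = signed (collapse N a) s"
  using lift_simps[OF collapse_compatible] by (simp_all add: collapse_def)

lemma collapse_em: "v \<in> VG \<Longrightarrow> c \<in> {1..n} \<Longrightarrow> collapse N (gen (em v c)) = npow (N ^ c) (gen v)"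
proof -
  assume v: "v \<in> VG" "c \<in> {1..n}"
  then have "\<exists>v'\<in>VG. \<exists>c'\<in>{1..n}. em v c = em v' c'" by blast
  then show ?thesis unfolding collapse_def lift_gen[OF collapse_compatible] dec_em[OF v] by simp
qed

definition W :: "'v set \<Rightarrow> 'w set" where
  "W X = (\<lambda>(v, c). em v c) ` (X \<times> {1..n})"

lemma W_iff: "p \<in> W X \<longleftrightarrow> (\<exists>v\<in>X. \<exists>c\<in>{1..n}. p = em v c)"
  by (auto simp: W_def)

lemma W_mono: "X \<subseteq> Y \<Longrightarrow> W X \<subseteq> W Y"
  by (auto simp: W_def)

lemma em_in_W: "v \<in> VG \<Longrightarrow> c \<in> {1..n} \<Longrightarrow> X \<subseteq> VG \<Longrightarrow> em v c \<in> W X \<longleftrightarrow> v \<in> X"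
  unfolding W_iff using em_inj by blast

lemma collapse_par: "X \<subseteq> VG \<Longrightarrow> g \<in> par (W X) \<Longrightarrow> collapse N g \<in> par X"
proof -
  assume X: "X \<subseteq> VG" and "g \<in> par (W X)"
  from this(2) show ?thesis
  proof (induction rule: par_induct)
    case (plus p b g)
    then obtain v c where "v \<in> X" "c \<in> {1..n}" "p = em v c" unfolding W_iff by blast
    then show ?case using plus X by (simp add: collapse_em subset_iff)
  qed simp
qed

lemma collapse_rho: "X \<subseteq> VG \<Longrightarrow> g \<in> par (W VG) \<Longrightarrow> collapse N (rho (W X) g) = rho X (collapse N g)"
proof -
  assume X: "X \<subseteq> VG" and "g \<in> par (W VG)"
  from this(2) show ?thesis
  proof (induction rule: par_induct)
    case (plus p b g)
    then obtain v c where v: "v \<in> VG" "c \<in> {1..n}" "p = em v c" unfolding W_iff by blast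
    have "p \<in> W X \<longleftrightarrow> v \<in> X" using em_in_W[OF v(1,2) X] v(3) by simp
    moreover have "collapse N (gen p) = npow (N ^ c) (gen v)" using v collapse_em by simp
    ultimately show ?case using plus by simp
  qed simp
qed

text \<open>Vanishing forces \<open>N\<close> to be a root of the polynomial formed from the
  exponent sums of \<open>h\<close>. These are not all zero, because the copies of \<open>v\<close>
  form a clique and \<open>h\<close> is nonzero.\<close>

lemma finite_collapse_single:
  assumes v: "v \<in> VG" and h: "h \<in> par (W {v})" "h \<noteq> 0"
  shows "finite {N. collapse N h = 0}"
proof -
  \<comment> \<open>Colours start at \<open>1\<close>, so the constant coefficient is padded with
    \<open>0\<close> to obtain a sum over \<open>c \<le> n\<close>.\<close>
  define a :: "nat \<Rightarrow> real" where "a c = (if c \<in> {1..n} then of_int (expo (em v c) h) else 0)" for c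
  have ex: "expo v (collapse N g) = (\<Sum>c\<in>{1..n}. expo (em v c) g * int N ^ c)" if "g \<in> par (W {v})" for g N
    using that
  proof (induction rule: par_induct)
    case (plus p b g)
    then obtain c where c: "c \<in> {1..n}" "p = em v c" unfolding W_iff by blast
    have "(if em v c = em v i then 1 else 0) * int N ^ i = (if i = c then int N ^ c else 0)" if "i \<in> {1..n}" for i
      using em_inj[OF v v c(1) that] by auto
    then have "(\<Sum>i\<in>{1..n}. (if em v c = em v i then 1 else 0) * int N ^ i)
        = (\<Sum>i\<in>{1..n}. if i = c then int N ^ c else 0)" by (intro sum.cong) auto
    also have "\<dots> = int N ^ c" using c(1) by (subst sum.delta) auto
    finally have s: "(\<Sum>i\<in>{1..n}. (if em v c = em v i then 1 else 0) * int N ^ i) = int N ^ c" .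
    have "expo (em v i) (signed (gen p) b + g) * int N ^ i
        = (if b then 1 else - 1) * ((if em v c = em v i then 1 else 0) * int N ^ i) + expo (em v i) g * int N ^ i" for i
      by (simp add: c algebra_simps)
    then have "(\<Sum>i\<in>{1..n}. expo (em v i) (signed (gen p) b + g) * int N ^ i)
        = (if b then 1 else - 1) * int N ^ c + (\<Sum>i\<in>{1..n}. expo (em v i) g * int N ^ i)"
      by (simp only: sum.distrib sum_distrib_left[symmetric] s)
    then show ?case using plus c v by (simp add: collapse_em)
  qed simp
  have "\<exists>c\<in>{1..n}. expo (em v c) h \<noteq> 0"
  proof (rule ccontr)
    assume "\<not> ?thesis"
    moreover have "adj p q" if pq: "p \<in> W {v}" "q \<in> W {v}" "p \<noteq> q" for p q
    proof -
      obtain c c' where "c \<in> {1..n}" "p = em v c" "c' \<in> {1..n}" "q = em v c'"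
        using pq(1,2) unfolding W_iff by blast
      then show ?thesis using em_adj[OF v v, of c c'] pq(3) by auto
    qed
    moreover have "finite (W {v})" by (simp add: W_def)
    moreover have "expo p h = 0" if p: "p \<in> W {v}" for p
      using p \<open>\<not> (\<exists>c\<in>{1..n}. expo (em v c) h \<noteq> 0)\<close> unfolding W_iff by blast
    ultimately have "h = 0" using clique_expo_zero[OF _ _ h(1)] by blast
    then show False using h(2) by blast
  qed
  then obtain c where "c \<in> {1..n}" "expo (em v c) h \<noteq> 0" by blast
  then have "c \<le> n \<and> a c \<noteq> 0" by (simp add: a_def)
  then have "\<exists>c\<le>n. a c \<noteq> 0" by blast
  then have fin: "finite {x. (\<Sum>c\<le>n. a c * x ^ c) = 0}" by (simp add: polyfun_finite_roots)
  have "(\<Sum>c\<le>n. a c * real N ^ c) = of_int (expo v (collapse N h))" for N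
  proof -
    have "(\<Sum>c\<le>n. a c * real N ^ c) = (\<Sum>c\<in>{1..n}. a c * real N ^ c)"
      by (rule sum.mono_neutral_right) (auto simp: a_def)
    also have "\<dots> = of_int (\<Sum>c\<in>{1..n}. expo (em v c) h * int N ^ c)"
      by (simp add: a_def)
    finally show ?thesis using ex[OF h(1)] by simp
  qed
  then have "real ` {N. collapse N h = 0} \<subseteq> {x. (\<Sum>c\<le>n. a c * x ^ c) = 0}" by auto
  then have "finite (real ` {N. collapse N h = 0})" using fin finite_subset by blast
  then show ?thesis by (rule finite_imageD) (simp add: inj_on_def)
qed

text \<open>Britton normal forms for the splitting of the group on \<open>insert v X\<close> over the link of \<open>v\<close>.\<close>

inductive_set alt :: "'v \<Rightarrow> 'v set \<Rightarrow> 'w raag set" for v X where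
  single: "h \<in> par (W {v}) \<Longrightarrow> h \<noteq> 0 \<Longrightarrow> b \<in> par (W X) \<Longrightarrow> h + b \<in> alt v X"
| step: "h \<in> par (W {v}) \<Longrightarrow> h \<noteq> 0 \<Longrightarrow> b \<in> par (W X) \<Longrightarrow> b \<notin> par (W (X \<inter> lk v)) \<Longrightarrow> d \<in> alt v X
    \<Longrightarrow> h + (b + d) \<in> alt v X"

text \<open>A base element from the link commutes with \<open>h'\<close>, so \<open>h'\<close>
  passes it and merges with the next syllable, possibly cancelling it; a base element outside the
  link separates them, and \<open>h'\<close> opens a new syllable. Allowing a free base element in
  front makes the form stable under both.\<close>

lemma alt_closed:
  assumes vX: "v \<in> VG" "X \<subseteq> VG" and h': "h' \<in> par (W {v})" and g: "g \<in> par (W X) \<or> (\<exists>b\<in>par (W X). \<exists>d\<in>alt v X. g = b + d)"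
  shows "h' + g \<in> par (W X) \<or> (\<exists>b\<in>par (W X). \<exists>d\<in>alt v X. h' + g = b + d)"
proof (cases "h' = 0")
  case False
  have zero: "0 \<in> par (W X)" by simp
  from g show ?thesis
  proof
    assume "g \<in> par (W X)"
    then have "h' + g \<in> alt v X" using h' False by (intro alt.single)
    then show ?thesis using zero by (metis add_0)
  next
    assume "\<exists>b\<in>par (W X). \<exists>d\<in>alt v X. g = b + d"
    then obtain b d where b: "b \<in> par (W X)" and d: "d \<in> alt v X" and g: "g = b + d" by blast
    show ?thesis
    proof (cases "b \<in> par (W (X \<inter> lk v))")
      case False
      then have "h' + (b + d) \<in> alt v X" using h' \<open>h' \<noteq> 0\<close> b d by (intro alt.step)
      then show ?thesis using zero g by (metis add_0)
    next
      case True
      have "joined (W (X \<inter> lk v)) (W {v})"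
        unfolding joined_def
      proof (intro ballI)
        fix p q assume "p \<in> W (X \<inter> lk v)" "q \<in> W {v}"
        then obtain w c c' where w: "w \<in> X" "adj v w" "c \<in> {1..n}" "p = em w c" "c' \<in> {1..n}" "q = em v c'"
          unfolding W_iff lk_def by blast
        then show "adj p q" using em_adj[of w v c c'] vX adj_sym[of v w] by auto
      qed
      then have "comm b h'" using True h' by (rule comm_joined)
      then have bh: "h' + (b + x) = b + (h' + x)" for x by (simp add: comm_def add.assoc[symmetric])
      from d show ?thesis
      proof cases
        case (single h b1)
        show ?thesis
        proof (cases "h' + h = 0")
          case True
          moreover have "h' + g = b + ((h' + h) + b1)" by (simp add: g single bh add.assoc)
          ultimately have "h' + g = b + b1" by simp
          then show ?thesis using b single by simp
        next
          case False
          then have "(h' + h) + b1 \<in> alt v X" using single h' by (intro alt.single) auto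
          moreover have "h' + g = b + ((h' + h) + b1)" by (simp add: g single bh add.assoc)
          ultimately show ?thesis using b by blast
        qed
      next
        case (step h b1 d1)
        show ?thesis
        proof (cases "h' + h = 0")
          case True
          moreover have "h' + g = b + ((h' + h) + (b1 + d1))" by (simp add: g step bh add.assoc)
          ultimately have "h' + g = (b + b1) + d1" by (simp add: add.assoc)
          moreover have "b + b1 \<in> par (W X)" using b step by simp
          ultimately show ?thesis using step(6) by blast
        next
          case False
          then have "(h' + h) + (b1 + d1) \<in> alt v X" using step h' by (intro alt.step) auto
          moreover have "h' + g = b + ((h' + h) + (b1 + d1))" by (simp add: g step bh add.assoc)
          ultimately show ?thesis using b by blast
        qed
      qed
    qed
  qed
qed (use g in simp)

lemma alt_form:
  assumes vX: "v \<in> VG" "X \<subseteq> VG" and g: "g \<in> par (W (insert v X))"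
  shows "g \<in> par (W X) \<or> (\<exists>b\<in>par (W X). \<exists>d\<in>alt v X. g = b + d)"
  using g
proof (induction rule: par_induct)
  case (plus p s g)
  consider "p \<in> W {v}" | "p \<in> W X" using plus(1) by (auto simp: W_iff)
  then show ?case
  proof cases
    case 1
    then show ?thesis using plus(3) by (intro alt_closed[OF vX]) simp_all
  next
    case 2
    then have p: "signed (gen p) s \<in> par (W X)" by simp
    from plus(3) show ?thesis
    proof
      assume "\<exists>b\<in>par (W X). \<exists>d\<in>alt v X. g = b + d"
      then obtain b d where "b \<in> par (W X)" "d \<in> alt v X" "g = b + d" by blast
      then have "signed (gen p) s + b \<in> par (W X)" "d \<in> alt v X" "signed (gen p) s + g = (signed (gen p) s + b) + d"
        using p by (simp_all add: add.assoc)
      then show ?thesis by blast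
    qed (use p in simp)
  qed
qed simp

text \<open>For almost all \<open>N\<close> the syllables on \<open>v\<close> survive by the
  polynomial argument, and the separating base elements stay outside the link by the induction
  hypothesis. The image is then alternating as well, and the ping-pong in the tree of
  \<open>v\<close> shows that it is nonzero.\<close>

theorem discriminate:
  assumes "finite X" "X \<subseteq> VG" "g \<in> par (W X)" "g \<noteq> 0"
  shows "finite {N. collapse N g = 0}"
  using assms
proof (induction X arbitrary: g rule: finite_induct)
  case empty
  then show ?case by (simp add: W_def par_empty)
next
  case (insert v X)
  have v: "v \<in> VG" and X: "X \<subseteq> VG" using insert by auto
  have Xv: "X \<subseteq> - {v}" using insert(2) by blast
  have lkX: "X \<inter> lk v \<subseteq> VG" using X by blast
  have base: "collapse N b \<in> par (- {v})" if "b \<in> par (W X)" for b N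
    using collapse_par[OF X that] by (rule par_mono) (rule Xv)
  have link: "finite {N. collapse N b \<in> par (lk v)}" if b: "b \<in> par (W X)" "b \<notin> par (W (X \<inter> lk v))" for b
  proof -
    \<comment> \<open>This element turns membership in the link into vanishing, to which the
      induction hypothesis applies: it is nonzero because \<open>b\<close> is outside the link part,
      and its collapse is zero whenever the collapse of \<open>b\<close> falls into the
      link.\<close>
    let ?c = "- b + rho (W (X \<inter> lk v)) b"
    have bVG: "b \<in> par (W VG)" using b(1) by (rule par_mono) (rule W_mono[OF X])
    have "?c \<noteq> 0"
    proof
      assume "?c = 0"
      then have "b + ?c = b" by simp
      then have "b = rho (W (X \<inter> lk v)) b" by simp
      then show False using b(2) by (metis par_simps(2))
    qed
    moreover have "?c \<in> par (W X)"
      using b(1) par_mono[OF par_simps(2) W_mono[OF Int_lower1], of X "lk v" b] by (intro par_plus) simp_all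
    ultimately have "finite {N. collapse N ?c = 0}" using insert.IH X by blast
    moreover have "collapse N ?c = 0" if N: "collapse N b \<in> par (lk v)" for N
    proof -
      have "collapse N b \<in> par (X \<inter> lk v)" using par_Int[OF collapse_par[OF X b(1)] N] .
      then show ?thesis using collapse_rho[OF lkX bVG, of N] by (simp add: rho_par)
    qed
    ultimately have "{N. collapse N b \<in> par (lk v)} \<subseteq> {N. collapse N ?c = 0}" by blast
    then show ?thesis using \<open>finite {N. collapse N ?c = 0}\<close> by (rule finite_subset)
  qed
  have alt: "finite {N. collapse N d \<notin> starts_at v}" if "d \<in> alt v X" for d
    using that
  proof induction
    case (single h b)
    have "{N. collapse N (h + b) \<notin> starts_at v} \<subseteq> {N. collapse N h = 0}"
      using starts_at_single[of "collapse _ h" v "collapse _ b"] collapse_par[of "{v}" h] base single v by auto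
    then show ?case using finite_collapse_single[OF v single(1,2)] finite_subset by blast
  next
    case (step h b d)
    have "{N. collapse N (h + (b + d)) \<notin> starts_at v}
        \<subseteq> {N. collapse N h = 0} \<union> {N. collapse N b \<in> par (lk v)} \<union> {N. collapse N d \<notin> starts_at v}"
      using starts_at_step[of "collapse _ h" v "collapse _ b" "collapse _ d"] collapse_par[of "{v}" h] base step v by auto
    then show ?case using finite_collapse_single[OF v step(1,2)] link[OF step(3,4)] step(6) finite_subset by blast
  qed
  from alt_form[OF v X insert.prems(2)] show ?case
  proof
    assume "g \<in> par (W X)"
    then show ?thesis using insert.IH X insert.prems by blast
  next
    assume "\<exists>b\<in>par (W X). \<exists>d\<in>alt v X. g = b + d"
    then obtain b d where b: "b \<in> par (W X)" and d: "d \<in> alt v X" and g: "g = b + d" by blast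
    have "{N. collapse N g = 0} \<subseteq> {N. collapse N d \<notin> starts_at v}"
      using starts_at_nonzero[of "collapse _ b" v "collapse _ d"] base[OF b] by (auto simp: g)
    then show ?thesis using alt[OF d] finite_subset by blast
  qed
qed

end

section \<open>The presented group as a subgroup\<close>

definition vals :: "('a \<Rightarrow> 'a \<Rightarrow> bool) \<Rightarrow> ('a \<times> bool) list \<Rightarrow> 'a uv raag" where
  "vals E = word_sum (\<lambda>v. gen (UV E v))"

lemma vals_simps [simp]:
  "vals E [] = 0" "vals E ((v, b) # p) = signed (gen (UV E v)) b + vals E p" "vals E (p @ q) = vals E p + vals E q"
  by (simp_all add: vals_def)

text \<open>Deletes the letters foreign to the given presentation. It undoes the labelling of words
  and sends each elementary move to a move or to an equality.\<close>

definition strip :: "'a set \<Rightarrow> ('a \<Rightarrow> 'a \<Rightarrow> bool) \<Rightarrow> ('a uv \<times> bool) list \<Rightarrow> ('a \<times> bool) list" where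
  "strip V E P = concat (map (\<lambda>(u, b). case u of UV F v \<Rightarrow> if F = E \<and> v \<in> V then [(v, b)] else []) P)"

lemma strip_simps [simp]:
  "strip V E [] = []" "strip V E (P @ Q) = strip V E P @ strip V E Q"
  "strip V E ((UV F v, b) # P) = (if F = E \<and> v \<in> V then (v, b) # strip V E P else strip V E P)"
  by (simp_all add: strip_def)

lemma strip_words: "strip V E P \<in> raag_words V"
proof (induction P)
  case (Cons a P)
  obtain F v b where "a = (UV F v, b)" by (metis surj_pair uv.exhaust)
  then show ?case using Cons by (auto simp: raag_words_def)
qed (simp add: raag_words_def)

lemma raag_words_append [simp]: "p @ q \<in> raag_words V \<longleftrightarrow> p \<in> raag_words V \<and> q \<in> raag_words V"
  and raag_words_Nil [simp]: "[] \<in> raag_words V"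
  and raag_words_Cons [simp]: "(v, b) # p \<in> raag_words V \<longleftrightarrow> v \<in> V \<and> p \<in> raag_words V"
  by (auto simp: raag_words_def)

lemma strip_step:
  assumes "raag_step adj P Q"
  shows "strip V E P = strip V E Q \<or> raag_step E (strip V E P) (strip V E Q)"
  using assms
proof (induction rule: raag_step.induct)
  case (cancel xs u b ys)
  obtain F v where u: "u = UV F v" by (cases u)
  show ?case
  proof (cases "F = E \<and> v \<in> V")
    case True
    then show ?thesis using raag_step.cancel[of E "strip V E xs" v b "strip V E ys"] by (simp add: u)
  qed (auto simp: u)
next
  case (commute u w xs b c ys)
  obtain F v F' v' where u: "u = UV F v" "w = UV F' v'" by (cases u; cases w)
  show ?case
  proof (cases "F = E \<and> v \<in> V \<and> F' = E \<and> v' \<in> V")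
    case True
    then show ?thesis using commute raag_step.commute[of E v v' "strip V E xs" b c "strip V E ys"] by (simp add: u)
  qed (auto simp: u)
qed

lemma strip_lift: "p \<in> raag_words V \<Longrightarrow> strip V E (map (\<lambda>(v, b). (UV E v, b)) p) = p"
proof (induction p)
  case (Cons a p)
  then show ?case by (cases a) simp
qed simp

lemma vals_alt: "vals E p = word_sum gen (map (\<lambda>(v, b). (UV E v, b)) p)"
proof (induction p)
  case (Cons a p)
  then show ?case by (cases a) simp
qed simp

lemma vals_step: "simple_graph V E \<Longrightarrow> raag_step E p q \<Longrightarrow> vals E p = vals E q"
proof -
  assume g: "simple_graph V E" and "raag_step E p q"
  from this(2) show ?thesis
  proof (induction rule: raag_step.induct)
    case (commute v w xs b c ys)
    then have "adj (UV E v) (UV E w)" using g by (auto simp: simple_graph_def)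
    then have "comm (signed (gen (UV E v)) b) (signed (gen (UV E w)) c)" by (simp add: comm_gen)
    then have "signed (gen (UV E v)) b + (signed (gen (UV E w)) c + x)
        = signed (gen (UV E w)) c + (signed (gen (UV E v)) b + x)" for x
      by (simp add: comm_def add.assoc[symmetric])
    then show ?case by simp
  qed simp
qed

text \<open>The point is that equality in the ambient group implies equality in the presentation: a
  chain of moves may pass through letters outside \<open>V\<close>, and \<open>strip\<close>
  projects it to a chain of words over \<open>V\<close>.\<close>

lemma raag_eq_iff:
  assumes g: "simple_graph V E"
  shows "(p, q) \<in> raag_eq V E \<longleftrightarrow> p \<in> raag_words V \<and> q \<in> raag_words V \<and> vals E p = vals E q"
proof -
  define R where "R = {(p, q). p \<in> raag_words V \<and> q \<in> raag_words V \<and> raag_step E p q}"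
  have eq: "raag_eq V E = (R \<union> R\<inverse>)\<^sup>* \<inter> (raag_words V \<times> raag_words V)"
    by (simp add: raag_eq_def R_def Let_def)
  have 1: "vals E p = vals E q" if "(p, q) \<in> (R \<union> R\<inverse>)\<^sup>*" for p q
    using that
  proof (induction rule: rtrancl_induct)
    case (step y z)
    then show ?case using vals_step[OF g] by (auto simp: R_def)
  qed simp
  have 2: "(strip V E P, strip V E Q) \<in> (R \<union> R\<inverse>)\<^sup>*" if "word_equiv P Q" for P Q
    using that
  proof (induction rule: word_equiv_induct)
    case (step P Q S)
    have "strip V E Q = strip V E S \<or> (strip V E Q, strip V E S) \<in> R \<union> R\<inverse>"
      using strip_step[OF step(2), of V E] strip_words by (auto simp: R_def)
    then show ?case using step(1) by (auto intro: rtrancl_into_rtrancl)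
  next
    case (sym_step P Q S)
    have "strip V E Q = strip V E S \<or> (strip V E Q, strip V E S) \<in> R \<union> R\<inverse>"
      using strip_step[OF sym_step(2), of V E] strip_words by (auto simp: R_def)
    then show ?case using sym_step(1) by (auto intro: rtrancl_into_rtrancl)
  qed simp
  have 3: "(p, q) \<in> (R \<union> R\<inverse>)\<^sup>*" if "p \<in> raag_words V" "q \<in> raag_words V" "vals E p = vals E q"
    using 2[of "map (\<lambda>(v, b). (UV E v, b)) p" "map (\<lambda>(v, b). (UV E v, b)) q"] that
    by (simp add: strip_lift vals_alt word_sum_gen_eq_iff)
  show ?thesis unfolding eq using 1 3 by blast
qed

definition ival :: "('a \<Rightarrow> 'a \<Rightarrow> bool) \<Rightarrow> ('a \<times> bool) list set \<Rightarrow> 'a uv raag" where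
  "ival E A = vals E (SOME p. p \<in> A)"

locale presented =
  fixes V :: "'a set" and E
  assumes graph: "simple_graph V E"
begin

abbreviation "G \<equiv> RAAG V E"
abbreviation "cls p \<equiv> raag_eq V E `` {p}"

lemmas raag_eq_pair [simp] = raag_eq_iff[OF graph]

lemma cls_iff: "q \<in> cls p \<longleftrightarrow> p \<in> raag_words V \<and> q \<in> raag_words V \<and> vals E p = vals E q"
  by (simp add: raag_eq_iff[OF graph])

lemma carrier_iff: "A \<in> carrier G \<longleftrightarrow> (\<exists>p\<in>raag_words V. A = cls p)"
  by (auto simp: RAAG_def quotient_def)

lemma cls_eq_iff: "p \<in> raag_words V \<Longrightarrow> q \<in> raag_words V \<Longrightarrow> cls p = cls q \<longleftrightarrow> vals E p = vals E q"
  using cls_iff[of q p] cls_iff[of q q] cls_iff[of _ p] cls_iff[of _ q] by auto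

lemma ival_cls: "p \<in> raag_words V \<Longrightarrow> ival E (cls p) = vals E p"
proof -
  assume p: "p \<in> raag_words V"
  then have "p \<in> cls p" by (simp add: cls_iff)
  then have "(SOME q. q \<in> cls p) \<in> cls p" by (rule someI)
  then have "vals E p = vals E (SOME q. q \<in> cls p)" using cls_iff[of "SOME q. q \<in> cls p" p] by blast
  then show ?thesis unfolding ival_def by (rule sym)
qed

lemma mult_cls:
  assumes "p \<in> raag_words V" "q \<in> raag_words V"
  shows "cls p \<otimes>\<^bsub>G\<^esub> cls q = cls (p @ q)"
proof -
  have ab: "cls (a @ b) = cls (p @ q)" if "a \<in> cls p" "b \<in> cls q" for a b
    using that assms by (subst cls_eq_iff) simp_all
  have ne: "cls p \<noteq> {}" "cls q \<noteq> {}" using assms cls_iff by blast+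
  have "cls p \<otimes>\<^bsub>G\<^esub> cls q = (\<Union>a\<in>cls p. \<Union>b\<in>cls q. cls (a @ b))" by (simp only: RAAG_def monoid.simps)
  also have "\<dots> = (\<Union>a\<in>cls p. \<Union>b\<in>cls q. cls (p @ q))" by (intro SUP_cong refl ab)
  also have "\<dots> = cls (p @ q)" using ne by (simp only: UN_constant if_False)
  finally show ?thesis .
qed

lemma one_cls: "\<one>\<^bsub>G\<^esub> = cls []"
  by (simp add: RAAG_def)

lemma inv_word_words: "p \<in> raag_words V \<Longrightarrow> inv_word p \<in> raag_words V"
  by (auto simp: raag_words_def inv_word_def)

lemma vals_inv_word: "vals E (inv_word p) = - vals E p"
proof (induction p)
  case (Cons a p)
  then show ?case by (cases a) (simp add: inv_word_Cons minus_add)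
qed simp

lemma ival_mult: "A \<in> carrier G \<Longrightarrow> B \<in> carrier G \<Longrightarrow> ival E (A \<otimes>\<^bsub>G\<^esub> B) = ival E A + ival E B"
  by (auto simp: carrier_iff mult_cls ival_cls)

lemma ival_inj: "A \<in> carrier G \<Longrightarrow> B \<in> carrier G \<Longrightarrow> ival E A = ival E B \<longleftrightarrow> A = B"
  by (auto simp: carrier_iff ival_cls cls_eq_iff)

lemma group_G: "group G"
proof (rule groupI)
  show "A \<otimes>\<^bsub>G\<^esub> B \<in> carrier G" if "A \<in> carrier G" "B \<in> carrier G" for A B
  proof -
    obtain p q where "p \<in> raag_words V" "q \<in> raag_words V" "A = cls p" "B = cls q"
      using \<open>A \<in> carrier G\<close> \<open>B \<in> carrier G\<close> unfolding carrier_iff by blast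
    then have "A \<otimes>\<^bsub>G\<^esub> B = cls (p @ q)" "p @ q \<in> raag_words V" by (simp_all add: mult_cls)
    then show ?thesis unfolding carrier_iff by blast
  qed
  show "\<one>\<^bsub>G\<^esub> \<in> carrier G" unfolding carrier_iff one_cls by (intro bexI[of _ "[]"]) auto
  show "A \<otimes>\<^bsub>G\<^esub> B \<otimes>\<^bsub>G\<^esub> C = A \<otimes>\<^bsub>G\<^esub> (B \<otimes>\<^bsub>G\<^esub> C)"
    if "A \<in> carrier G" "B \<in> carrier G" "C \<in> carrier G" for A B C
    using that by (auto simp: carrier_iff mult_cls)
  show "\<one>\<^bsub>G\<^esub> \<otimes>\<^bsub>G\<^esub> A = A" if "A \<in> carrier G" for A
    using that by (auto simp: carrier_iff one_cls mult_cls)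
  show "\<exists>B\<in>carrier G. B \<otimes>\<^bsub>G\<^esub> A = \<one>\<^bsub>G\<^esub>" if "A \<in> carrier G" for A
  proof -
    obtain p where p: "p \<in> raag_words V" "A = cls p" using \<open>A \<in> carrier G\<close> by (auto simp: carrier_iff)
    then have "cls (inv_word p) \<otimes>\<^bsub>G\<^esub> A = cls (inv_word p @ p)" by (simp add: mult_cls inv_word_words)
    also have "\<dots> = \<one>\<^bsub>G\<^esub>" unfolding one_cls using p
      by (subst cls_eq_iff) (simp_all add: inv_word_words vals_inv_word)
    finally have "cls (inv_word p) \<otimes>\<^bsub>G\<^esub> A = \<one>\<^bsub>G\<^esub>" .
    moreover have "cls (inv_word p) \<in> carrier G"
      unfolding carrier_iff using inv_word_words[OF p(1)] by (rule bexI[of _ "inv_word p", OF refl])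
    ultimately show ?thesis by (rule bexI)
  qed
qed

lemma ival_one [simp]: "ival E \<one>\<^bsub>G\<^esub> = 0"
  by (simp add: one_cls ival_cls)

lemma ival_inv: "A \<in> carrier G \<Longrightarrow> ival E (inv\<^bsub>G\<^esub> A) = - ival E A"
proof -
  interpret group G by (rule group_G)
  assume A: "A \<in> carrier G"
  then have "ival E (A \<otimes>\<^bsub>G\<^esub> inv\<^bsub>G\<^esub> A) = ival E A + ival E (inv\<^bsub>G\<^esub> A)" by (simp only: ival_mult inv_closed)
  then have "ival E A + ival E (inv\<^bsub>G\<^esub> A) = 0" using A by simp
  then show ?thesis using minus_unique by metis
qed

lemma ival_range: "ival E ` carrier G = par (UV E ` V)"
proof
  have "vals E p \<in> par (UV E ` V)" if "p \<in> raag_words V" for p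
    using that
  proof (induction p)
    case (Cons a p)
    then show ?case by (cases a) auto
  qed simp
  then show "ival E ` carrier G \<subseteq> par (UV E ` V)" by (auto simp: carrier_iff ival_cls)
  have "\<exists>p\<in>raag_words V. g = vals E p" if "g \<in> par (UV E ` V)" for g
    using that
  proof (induction rule: par_induct)
    case (plus u b g)
    then obtain v p where "u = UV E v" "v \<in> V" "p \<in> raag_words V" "g = vals E p" by blast
    then have "(v, b) # p \<in> raag_words V" "signed (gen u) b + g = vals E ((v, b) # p)" by simp_all
    then show ?case by blast
  qed (auto intro: bexI[of _ "[]"])
  then show "par (UV E ` V) \<subseteq> ival E ` carrier G"
    by (metis carrier_iff image_eqI ival_cls subsetI)
qed

lemma raag_gen_carrier: "v \<in> V \<Longrightarrow> raag_gen V E v \<in> carrier G"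
  and ival_raag_gen: "v \<in> V \<Longrightarrow> ival E (raag_gen V E v) = gen (UV E v)"
proof -
  assume v: "v \<in> V"
  then have w: "[(v, True)] \<in> raag_words V" by simp
  then show "raag_gen V E v \<in> carrier G" unfolding carrier_iff raag_gen_def by blast
  show "ival E (raag_gen V E v) = gen (UV E v)"
    unfolding raag_gen_def ival_cls[OF w] by (simp add: signed_def)
qed

definition jval :: "'a uv raag \<Rightarrow> ('a \<times> bool) list set" where
  "jval = inv_into (carrier G) (ival E)"

lemma jval: "g \<in> par (UV E ` V) \<Longrightarrow> jval g \<in> carrier G" "g \<in> par (UV E ` V) \<Longrightarrow> ival E (jval g) = g"
  unfolding jval_def ival_range[symmetric] by (simp_all add: inv_into_into f_inv_into_f)

lemma ival_gprod: "set ys \<subseteq> carrier G \<Longrightarrow> gprod G ys \<in> carrier G \<and> ival E (gprod G ys) = sum_list (map (ival E) ys)"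
proof (induction ys)
  case Nil
  interpret group G by (rule group_G)
  show ?case by (simp add: gprod_def)
next
  case (Cons y ys)
  interpret group G by (rule group_G)
  have "gprod G (y # ys) = y \<otimes>\<^bsub>G\<^esub> gprod G ys" by (simp add: gprod_def)
  then show ?case using Cons by (simp add: ival_mult)
qed

lemma tame_factor_one:
  assumes "v \<in> V" "g \<in> carrier G"
  shows "tame_factor V E (v, 1, g) = tame_conj V E (v, 1, g)" "tame_conj V E (v, k, g) \<in> carrier G"
    "ival E (tame_conj V E (v, k, g)) = cj (ival E g) (gen (UV E v))"
proof -
  interpret group G by (rule group_G)
  note v = raag_gen_carrier[OF assms(1)]
  show "tame_factor V E (v, 1, g) = tame_conj V E (v, 1, g)"
    using v int_pow_1[OF v] by (simp add: tame_factor_def tame_conj_def)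
  show "tame_conj V E (v, k, g) \<in> carrier G" using v assms(2) by (simp add: tame_conj_def)
  show "ival E (tame_conj V E (v, k, g)) = cj (ival E g) (gen (UV E v))"
    using v assms by (simp add: tame_conj_def ival_mult ival_inv ival_raag_gen cj_def)
qed

end

section \<open>Universal formulas\<close>

fun evT :: "(nat \<Rightarrow> 'g::group_add) \<Rightarrow> gterm \<Rightarrow> 'g" where
  "evT s (Var i) = s i"
| "evT s One = 0"
| "evT s (Mul t u) = evT s t + evT s u"
| "evT s (Inv t) = - evT s t"

fun satT :: "(nat \<Rightarrow> 'g::group_add) \<Rightarrow> gform \<Rightarrow> bool" where
  "satT s (Eq t u) \<longleftrightarrow> evT s t = evT s u"
| "satT s (Neg f) \<longleftrightarrow> \<not> satT s f"
| "satT s (Conj f g) \<longleftrightarrow> satT s f \<and> satT s g"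
| "satT s (Disj f g) \<longleftrightarrow> satT s f \<or> satT s g"

lemma (in group) eval_gterm_closed: "(\<And>i. s i \<in> carrier G) \<Longrightarrow> eval_gterm G s t \<in> carrier G"
  by (induction t) auto

lemma (in group) eval_gterm_hom:
  fixes \<psi> :: "'a \<Rightarrow> 'g::group_add"
  assumes s: "\<And>i. s i \<in> carrier G"
    and h: "\<And>a b. a \<in> carrier G \<Longrightarrow> b \<in> carrier G \<Longrightarrow> \<psi> (a \<otimes> b) = \<psi> a + \<psi> b"
  shows "\<psi> (eval_gterm G s t) = evT (\<lambda>i. \<psi> (s i)) t"
proof -
  have one: "\<psi> \<one> = 0" using h[of \<one> \<one>] add_left_cancel[of "\<psi> \<one>" "\<psi> \<one>" 0] by simp
  have inv: "\<psi> (inv a) = - \<psi> a" if "a \<in> carrier G" for a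
  proof -
    have "\<psi> a + \<psi> (inv a) = 0" using h[of a "inv a"] that one by simp
    then show ?thesis using minus_unique by metis
  qed
  show ?thesis
    by (induction t) (simp_all add: one inv h eval_gterm_closed s)
qed

lemma (in group) sat_gform_hom:
  fixes \<psi> :: "'a \<Rightarrow> 'g::group_add"
  assumes s: "\<And>i. s i \<in> carrier G"
    and h: "\<And>a b. a \<in> carrier G \<Longrightarrow> b \<in> carrier G \<Longrightarrow> \<psi> (a \<otimes> b) = \<psi> a + \<psi> b"
    and inj: "inj_on \<psi> (carrier G)"
  shows "sat_gform G s f \<longleftrightarrow> satT (\<lambda>i. \<psi> (s i)) f"
  using inj_onD[OF inj] eval_gterm_closed[OF s]
  by (induction f) (auto simp: eval_gterm_hom[OF s h, symmetric])

lemma (in presented) holds_universally_iff: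
  "holds_universally G f \<longleftrightarrow> (\<forall>s. (\<forall>i. s i \<in> par (UV E ` V)) \<longrightarrow> satT s f)"
proof -
  interpret group G by (rule group_G)
  have sat: "sat_gform G s f \<longleftrightarrow> satT (\<lambda>i. ival E (s i)) f" if "\<And>i. s i \<in> carrier G" for s
    using that by (intro sat_gform_hom) (auto simp: ival_mult ival_inj inj_on_def)
  show ?thesis
  proof
    assume h: "holds_universally G f"
    show "\<forall>s. (\<forall>i. s i \<in> par (UV E ` V)) \<longrightarrow> satT s f"
    proof (intro allI impI)
      fix s :: "nat \<Rightarrow> 'a uv raag" assume "\<forall>i. s i \<in> par (UV E ` V)"
      then have "jval (s i) \<in> carrier G" "ival E (jval (s i)) = s i" for i by (simp_all add: jval)
      then show "satT s f" using h sat[of "\<lambda>i. jval (s i)"] by (simp add: holds_universally_def)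
    qed
  next
    assume h: "\<forall>s. (\<forall>i. s i \<in> par (UV E ` V)) \<longrightarrow> satT s f"
    show "holds_universally G f"
      unfolding holds_universally_def
    proof (intro allI impI)
      fix s :: "nat \<Rightarrow> ('a \<times> bool) list set" assume s: "\<forall>i. s i \<in> carrier G"
      then have "ival E (s i) \<in> par (UV E ` V)" for i unfolding ival_range[symmetric] by simp
      then show "sat_gform G s f" using sat[of s] h s by simp
    qed
  qed
qed

section \<open>Quantifier-free formulas as finite systems of equations and inequations\<close>

fun atoms :: "gform \<Rightarrow> (gterm \<times> gterm) set" where
  "atoms (Eq t u) = {(t, u)}"
| "atoms (Neg f) = atoms f"
| "atoms (Conj f g) = atoms f \<union> atoms g"
| "atoms (Disj f g) = atoms f \<union> atoms g"

lemma finite_atoms: "finite (atoms f)"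
  by (induction f) auto

lemma satT_cong_atoms:
  assumes "\<And>t u. (t, u) \<in> atoms f \<Longrightarrow> evT s t = evT s u \<longleftrightarrow> evT s' t = evT s' u"
  shows "satT s f \<longleftrightarrow> satT s' f"
  using assms by (induction f) auto

definition conjs :: "gform list \<Rightarrow> gform" where
  "conjs fs = foldr Conj fs (Eq One One)"

lemma satT_conjs: "satT s (conjs fs) \<longleftrightarrow> (\<forall>f\<in>set fs. satT s f)"
  by (induction fs) (auto simp: conjs_def)

definition word_term :: "('a \<Rightarrow> nat) \<Rightarrow> ('a \<times> bool) list \<Rightarrow> gterm" where
  "word_term ix w = foldr (\<lambda>(v, b) t. Mul (if b then Var (ix v) else Inv (Var (ix v))) t) w One"

lemma evT_word_term: "evT s (word_term ix w) = word_sum (\<lambda>v. s (ix v)) w"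
proof (induction w)
  case (Cons a w)
  then show ?case by (cases a) (simp add: word_term_def signed_def)
qed (simp add: word_term_def)

text \<open>\<open>F\<close> is the finite system of edge commutations and nonvanishing words.
  \<open>y\<close> solves it in \<open>P\<close>, so the universal sentence \<open>Neg F\<close>
  fails there and, by contraposition of \<open>univ\<close>, fails in \<open>Q\<close> as
  well.\<close>

lemma realize_words:
  fixes y :: "'a \<Rightarrow> 'g::group_add" and P :: "'g set" and Q :: "'h::group_add set"
  assumes fin: "finite V" "finite S" and E: "\<And>x x'. E x x' \<Longrightarrow> x \<in> V \<and> x' \<in> V"
    and y: "\<And>x. x \<in> V \<Longrightarrow> y x \<in> P" "0 \<in> P" "\<And>x x'. E x x' \<Longrightarrow> comm (y x) (y x')"
      "\<And>w. w \<in> S \<Longrightarrow> w \<in> raag_words V \<and> word_sum y w \<noteq> 0"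
    and univ: "\<And>f. (\<forall>s. (\<forall>i. s i \<in> Q) \<longrightarrow> satT s f) \<Longrightarrow> (\<forall>s. (\<forall>i. s i \<in> P) \<longrightarrow> satT s f)"
  obtains z :: "'a \<Rightarrow> 'h" where "\<And>x. z x \<in> Q" "\<And>x x'. E x x' \<Longrightarrow> comm (z x) (z x')"
    "\<And>w. w \<in> S \<Longrightarrow> word_sum z w \<noteq> 0"
proof -
  obtain ix :: "'a \<Rightarrow> nat" where ix: "inj_on ix V" using finite_imp_inj_to_nat_seg[OF fin(1)] by metis
  obtain es where es: "set es = {(x, x'). E x x'}"
  proof -
    have "{(x, x'). E x x'} \<subseteq> V \<times> V" using E by blast
    then have "finite {(x, x'). E x x'}" using fin(1) by (metis finite_SigmaI finite_subset)
    then show ?thesis using finite_list that by blast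
  qed
  obtain ws where ws: "set ws = S" using finite_list[OF fin(2)] by blast
  define F where "F = conjs (map (\<lambda>(x, x'). Eq (Mul (Var (ix x)) (Var (ix x'))) (Mul (Var (ix x')) (Var (ix x)))) es
      @ map (\<lambda>w. Neg (Eq (word_term ix w) One)) ws)"
  have F: "satT s F \<longleftrightarrow> (\<forall>x x'. E x x' \<longrightarrow> comm (s (ix x)) (s (ix x')))
      \<and> (\<forall>w\<in>S. word_sum (\<lambda>x. s (ix x)) w \<noteq> 0)" for s :: "nat \<Rightarrow> 'k::group_add"
    using es unfolding F_def satT_conjs by (auto simp: ball_Un comm_def evT_word_term ws)
  \<comment> \<open>Variables that encode no vertex receive \<open>0\<close>, which keeps the
    assignment inside \<open>P\<close>.\<close>
  define s where "s i = (if i \<in> ix ` V then y (inv_into V ix i) else 0)" for i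
  have sx: "s (ix x) = y x" if "x \<in> V" for x using that ix by (simp add: s_def)
  have sP: "s i \<in> P" for i using y(1,2) by (auto simp: s_def inv_into_into)
  have sw: "word_sum (\<lambda>x. s (ix x)) w = word_sum y w" if "w \<in> raag_words V" for w
    using that
  proof (induction w)
    case (Cons a w)
    then show ?case by (cases a) (simp add: sx)
  qed simp
  have "satT s F"
    unfolding F
  proof (intro conjI allI impI ballI)
    show "comm (s (ix x)) (s (ix x'))" if "E x x'" for x x'
      using y(3)[OF that] E[OF that] by (simp add: sx)
    show "word_sum (\<lambda>x. s (ix x)) w \<noteq> 0" if "w \<in> S" for w
      using y(4)[OF that] by (simp add: sw)
  qed
  then have "\<not> (\<forall>s. (\<forall>i. s i \<in> P) \<longrightarrow> satT s (Neg F))" using sP by auto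
  then have "\<not> (\<forall>s. (\<forall>i. s i \<in> Q) \<longrightarrow> satT s (Neg F))" using univ[of "Neg F"] by blast
  then obtain z where z: "\<And>i. z i \<in> Q" "satT z F" by auto
  show ?thesis by (rule that[of "\<lambda>x. z (ix x)"]) (use z F[of z] in auto)
qed

section \<open>Inflations of presented graphs\<close>

fun unUV :: "'a uv \<Rightarrow> 'a" where "unUV (UV F v) = v"

definition infl :: "'b set \<Rightarrow> ('b \<Rightarrow> 'b \<Rightarrow> bool) \<Rightarrow> nat \<Rightarrow> 'b uv \<Rightarrow> nat \<Rightarrow> ('b \<times> nat) uv" where
  "infl V E n v c = UV (inflate_E V E n) (unUV v, c)"

lemma simple_graph_inflate:
  assumes "simple_graph V E"
  shows "simple_graph (inflate_V V n) (inflate_E V E n)"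
  using assms unfolding simple_graph_def inflate_E_def inflate_V_def by auto

lemma inflation_graph_infl:
  assumes "simple_graph V E"
  shows "inflation_graph (UV E ` V) n (infl V E n)"
proof
  fix v v' c c' assume v: "v \<in> UV E ` V" "v' \<in> UV E ` V" and c: "c \<in> {1..n}" "c' \<in> {1..n}"
  obtain a a' where a: "v = UV E a" "a \<in> V" "v' = UV E a'" "a' \<in> V" using v by blast
  show "v = v' \<and> c = c'" if "infl V E n v c = infl V E n v' c'" using that by (simp add: infl_def a)
  have "(a, c) \<in> inflate_V V n" "(a', c') \<in> inflate_V V n" using a c by (simp_all add: inflate_V_def)
  moreover have "E a a' \<longleftrightarrow> E a' a" "\<not> E a a" using assms by (auto simp: simple_graph_def)
  ultimately show "adj (infl V E n v c) (infl V E n v' c') \<longleftrightarrow> (v = v' \<and> c \<noteq> c') \<or> adj v v'"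
    by (auto simp: infl_def a inflate_E_def)
qed

lemma W_infl:
  assumes "simple_graph V E"
  shows "inflation_graph.W n (infl V E n) (UV E ` V) = UV (inflate_E V E n) ` inflate_V V n"
  unfolding inflation_graph.W_def[OF inflation_graph_infl[OF assms]]
  by (force simp: infl_def inflate_V_def)

text \<open>\<open>f\<close> compares finitely many pairs of terms. By \<open>discriminate\<close>,
  one \<open>N\<close> keeps all nonzero differences in the inflation nonzero, so collapsing gives
  an assignment over \<open>VG\<close> under which \<open>f\<close> has the same truth
  value.\<close>

theorem embedding_transfers_universal:
  assumes gD: "simple_graph VD ED" and gG: "simple_graph VG EG"
    and hom: "\<phi> \<in> hom (RAAG VD ED) (RAAG (inflate_V VG n) (inflate_E VG EG n))"
    and inj: "inj_on \<phi> (carrier (RAAG VD ED))"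
    and f: "holds_universally (RAAG VG EG) f"
  shows "holds_universally (RAAG VD ED) f"
  unfolding holds_universally_def
proof (intro allI impI)
  interpret D: presented VD ED by standard (rule gD)
  interpret G: presented VG EG by standard (rule gG)
  interpret I: presented "inflate_V VG n" "inflate_E VG EG n"
    by standard (rule simple_graph_inflate[OF gG])
  interpret J: inflation_graph "UV EG ` VG" n "infl VG EG n" by (rule inflation_graph_infl[OF gG])
  interpret DG: group "RAAG VD ED" by (rule D.group_G)
  fix s :: "nat \<Rightarrow> ('a \<times> bool) list set" assume s: "\<forall>i. s i \<in> carrier (RAAG VD ED)"
  let ?iv = "ival (inflate_E VG EG n)"
  define u where "u i = ?iv (\<phi> (s i))" for i
  have \<phi>c: "\<phi> a \<in> carrier I.G" if "a \<in> carrier D.G" for a using hom that by (auto simp: hom_def)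
  have sat: "sat_gform D.G s f \<longleftrightarrow> satT u f"
    unfolding u_def
  proof (rule DG.sat_gform_hom)
    show "s i \<in> carrier D.G" for i using s by blast
    show "?iv (\<phi> (a \<otimes>\<^bsub>D.G\<^esub> b))
        = ?iv (\<phi> a) + ?iv (\<phi> b)"
      if "a \<in> carrier D.G" "b \<in> carrier D.G" for a b
      using hom_mult[OF hom that] I.ival_mult[OF \<phi>c \<phi>c] that by simp
    show "inj_on (\<lambda>a. ?iv (\<phi> a)) (carrier D.G)"
    proof (rule inj_onI)
      fix a b assume ab: "a \<in> carrier D.G" "b \<in> carrier D.G"
        "?iv (\<phi> a) = ?iv (\<phi> b)"
      then have "\<phi> a = \<phi> b" using I.ival_inj[OF \<phi>c[OF ab(1)] \<phi>c[OF ab(2)]] by simp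
      then show "a = b" using ab(1,2) by (rule inj_onD[OF inj])
    qed
  qed
  have "?iv (\<phi> (s i)) \<in> par (UV (inflate_E VG EG n) ` inflate_V VG n)" for i
    unfolding I.ival_range[symmetric] using \<phi>c s by blast
  then have uW: "u i \<in> par (J.W (UV EG ` VG))" for i by (simp add: u_def W_infl[OF gG])
  have evW: "evT u t \<in> par (J.W (UV EG ` VG))" for t by (induction t) (simp_all add: uW)
  have ev: "evT (\<lambda>i. J.collapse N (u i)) t = J.collapse N (evT u t)" for N t by (induction t) simp_all
  define diff where "diff p = - evT u (fst p) + evT u (snd p)" for p
  have diff0: "diff (t, t') = 0 \<longleftrightarrow> evT u t = evT u t'" for t t'
  proof
    assume "diff (t, t') = 0"
    then have "evT u t + diff (t, t') = evT u t" by simp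
    then show "evT u t = evT u t'" by (simp add: diff_def)
  qed (simp add: diff_def)
  have "finite (UV EG ` VG)" using gG by (simp add: simple_graph_def)
  then have "finite {N. J.collapse N (diff p) = 0}" if "diff p \<noteq> 0" for p
    using evW that by (intro J.discriminate[of "UV EG ` VG"]) (simp_all add: diff_def)
  then have "finite (\<Union>p\<in>{p\<in>atoms f. diff p \<noteq> 0}. {N. J.collapse N (diff p) = 0})"
    using finite_atoms by (intro finite_UN_I) auto
  from ex_new_if_finite[OF infinite_UNIV_nat this]
  obtain N where N: "\<And>p. p \<in> atoms f \<Longrightarrow> diff p \<noteq> 0 \<Longrightarrow> J.collapse N (diff p) \<noteq> 0" by blast
  have "satT u f \<longleftrightarrow> satT (\<lambda>i. J.collapse N (u i)) f"
  proof (rule satT_cong_atoms)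
    fix t t' assume tt: "(t, t') \<in> atoms f"
    show "evT u t = evT u t' \<longleftrightarrow> evT (\<lambda>i. J.collapse N (u i)) t = evT (\<lambda>i. J.collapse N (u i)) t'"
    proof
      assume "evT (\<lambda>i. J.collapse N (u i)) t = evT (\<lambda>i. J.collapse N (u i)) t'"
      then have "J.collapse N (diff (t, t')) = 0" by (simp add: ev diff_def)
      then show "evT u t = evT u t'" using N[OF tt] diff0 by blast
    qed (simp add: ev)
  qed
  moreover have "satT (\<lambda>i. J.collapse N (u i)) f"
    using f J.collapse_par[OF subset_refl uW] by (simp add: G.holds_universally_iff)
  ultimately show "sat_gform D.G s f" using sat by blast
qed

section \<open>Construction of tame embeddings\<close>

lemma word_sum_positive: "word_sum \<psi> (map (\<lambda>l. (l, True)) xs) = sum_list (map \<psi> xs)"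
  by (induction xs) (simp_all add: signed_def)

lemma word_sum_negative: "word_sum \<psi> (rev (map (\<lambda>l. (l, False)) xs)) = - sum_list (map \<psi> xs)"
  by (induction xs) (simp_all add: signed_def minus_add)

text \<open>Each letter is replaced by its list of blocks. Keeping this as a word, not a group
  element, lets the same word be evaluated on \<open>Uh\<close> and on the vertices of the
  commutation graph.\<close>

definition expand :: "('a \<Rightarrow> 'l list) \<Rightarrow> ('a \<times> bool) list \<Rightarrow> ('l \<times> bool) list" where
  "expand ls p = concat (map (\<lambda>(x, b). if b then map (\<lambda>l. (l, True)) (ls x)
      else rev (map (\<lambda>l. (l, False)) (ls x))) p)"

lemma word_sum_expand: "word_sum \<psi> (expand ls p) = word_sum (\<lambda>x. sum_list (map \<psi> (ls x))) p"
proof (induction p)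
  case (Cons a p)
  then show ?case
    by (cases a) (simp add: expand_def word_sum_positive word_sum_negative signed_def)
qed (simp add: expand_def)

lemma set_expand: "set (expand ls p) \<subseteq> (\<Union>x\<in>fst ` set p. set (ls x)) \<times> UNIV"
  by (auto simp: expand_def split: if_splits)

lemma lift_of_word_sum: "adj_compatible \<phi> \<Longrightarrow> lift \<phi> (word_sum \<psi> p) = word_sum (\<lambda>x. lift \<phi> (\<psi> x)) p"
proof (induction p)
  case (Cons a p)
  then show ?case by (cases a) (simp add: lift_simps)
qed (simp add: lift_simps)

lemma lift_sum_list: "adj_compatible \<phi> \<Longrightarrow> lift \<phi> (sum_list xs) = sum_list (map (lift \<phi>) xs)"
  by (induction xs) (simp_all add: lift_simps)

lemma word_sum_cong:
  "p \<in> raag_words V \<Longrightarrow> (\<And>x. x \<in> V \<Longrightarrow> \<psi> x = \<psi>' x) \<Longrightarrow> word_sum \<psi> p = word_sum \<psi>' p"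
proof (induction p)
  case (Cons a p)
  then show ?case by (cases a) simp
qed simp

lemma comm_sum_list: "(\<And>a. a \<in> set xs \<Longrightarrow> comm a c) \<Longrightarrow> comm (sum_list xs) c"
  by (induction xs) (simp_all add: comm_plus)

definition canonical :: "'v list \<Rightarrow> ('a \<times> 'v) set \<Rightarrow> ('a \<times> 'v \<Rightarrow> 'a \<times> 'v \<Rightarrow> bool) \<Rightarrow> 'a \<Rightarrow> ('a \<times> 'v) uv raag" where
  "canonical vl L R x = sum_list (map (\<lambda>v. gen (UV R (x, v))) (filter (\<lambda>v. (x, v) \<in> L) vl))"

text \<open>There are finitely many possible commutation graphs \<open>(L, R)\<close> of blocks, so finitely many words witness
  all failures of injectivity of the canonical maps.\<close>

lemma separating_family:
  fixes VG :: "'v::graph set"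
  assumes gD: "simple_graph VD ED" and fin: "finite VG" and vl: "set vl = VG"
    and univ: "\<And>f. (\<forall>s. (\<forall>i. s i \<in> par VG) \<longrightarrow> satT s f)
      \<Longrightarrow> (\<forall>s. (\<forall>i. s i \<in> par (UV ED ` VD)) \<longrightarrow> satT s f)"
  obtains y :: "'a \<Rightarrow> 'v raag" where "\<forall>x. y x \<in> par VG" "\<forall>x x'. ED x x' \<longrightarrow> comm (y x) (y x')"
    "\<forall>L R. L \<subseteq> VD \<times> VG \<longrightarrow> (\<forall>l m. R l m \<longrightarrow> l \<in> L \<and> m \<in> L) \<longrightarrow>
      (\<forall>w\<in>raag_words VD. word_sum (canonical vl L R) w = 0 \<longrightarrow> word_sum y w = 0) \<longrightarrow>
      (\<forall>w\<in>raag_words VD. word_sum (canonical vl L R) w = 0 \<longrightarrow> vals ED w = 0)"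
proof -
  let ?M = "VD \<times> VG"
  have finD: "finite VD" using gD by (simp add: simple_graph_def)
  define T where "T = Pow ?M \<times> (\<lambda>Q l m. (l, m) \<in> Q) ` Pow (?M \<times> ?M)"
  have "finite T" using finD fin by (simp add: T_def)
  define kills where "kills \<tau> w \<longleftrightarrow>
      w \<in> raag_words VD \<and> vals ED w \<noteq> 0 \<and> word_sum (canonical vl (fst \<tau>) (snd \<tau>)) w = 0" for \<tau> w
  define S where "S = (\<lambda>\<tau>. SOME w. kills \<tau> w) ` {\<tau>\<in>T. \<exists>w. kills \<tau> w}"
  have "finite S" using \<open>finite T\<close> by (simp add: S_def)
  have S: "w \<in> raag_words VD \<and> word_sum (\<lambda>x. gen (UV ED x)) w \<noteq> 0" if wS: "w \<in> S" for w
  proof -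
    obtain \<tau> where "\<exists>w. kills \<tau> w" "w = (SOME w. kills \<tau> w)" using wS unfolding S_def by blast
    then have "kills \<tau> w" by (metis someI_ex)
    then show ?thesis by (simp add: kills_def vals_def)
  qed
  have E: "x \<in> VD \<and> x' \<in> VD" if "ED x x'" for x x' using gD that by (auto simp: simple_graph_def)
  have cE: "comm (gen (UV ED x)) (gen (UV ED x'))" if "ED x x'" for x x'
    using gD that by (intro comm_gen) (auto simp: simple_graph_def)
  obtain y :: "'a \<Rightarrow> 'v raag" where y: "\<And>x. y x \<in> par VG" "\<And>x x'. ED x x' \<Longrightarrow> comm (y x) (y x')"
    "\<And>w. w \<in> S \<Longrightarrow> word_sum y w \<noteq> 0"
    by (rule realize_words[OF finD \<open>finite S\<close> E _ _ cE S univ]) auto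
  have "vals ED w = 0"
    if L: "L \<subseteq> ?M" and R: "\<forall>l m. R l m \<longrightarrow> l \<in> L \<and> m \<in> L"
      and fac: "\<forall>w\<in>raag_words VD. word_sum (canonical vl L R) w = 0 \<longrightarrow> word_sum y w = 0"
      and w: "w \<in> raag_words VD" "word_sum (canonical vl L R) w = 0" for L R w
  proof (rule ccontr)
    have "R = (\<lambda>l m. (l, m) \<in> {(l, m). R l m})" by simp
    moreover have "{(l, m). R l m} \<in> Pow (?M \<times> ?M)" using R L by blast
    ultimately have "R \<in> (\<lambda>Q l m. (l, m) \<in> Q) ` Pow (?M \<times> ?M)" by (rule image_eqI)
    then have LR: "(L, R) \<in> T" using L by (simp add: T_def)
    assume "vals ED w \<noteq> 0"
    then have kw: "kills (L, R) w" using w by (simp add: kills_def)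
    then have k: "kills (L, R) (SOME w. kills (L, R) w)" by (rule someI)
    have "(SOME w. kills (L, R) w) \<in> S" using LR kw unfolding S_def by blast
    then have "word_sum y (SOME w. kills (L, R) w) \<noteq> 0" by (rule y(3))
    then show False using fac k unfolding kills_def by simp
  qed
  then show ?thesis using that[of y] y(1,2) by blast
qed

text \<open>Treated apart because there is then no \<open>x0\<close> to normalise and, with
  \<open>n = 0\<close>, no colour for conjugators.\<close>

lemma tame_embedding_empty:
  assumes "simple_graph VL EL"
  shows "\<exists>\<phi>. tame_embedding {} ED VL EL \<phi>"
proof -
  interpret presented VL EL by standard (rule assms)
  interpret group G by (rule group_G)
  have "carrier (RAAG {} ED) = {raag_eq {} ED `` {[]}}"
    by (simp add: RAAG_def raag_words_def quotient_def)
  then show ?thesis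
    by (intro exI[of _ "\<lambda>_. \<one>\<^bsub>G\<^esub>"]) (simp add: tame_embedding_def hom_def)
qed

text \<open>The embedding sends \<open>x\<close> to the product of the coloured conjugates of its
  blocks. Commutations pass from \<open>y\<close> to \<open>U\<close> by \<open>comm_U\<close> and
  from there to \<open>Uh\<close> by \<open>comm_inflate\<close>.\<close>

theorem universal_imp_tame_embedding:
  assumes gD: "simple_graph VD ED" and gG: "simple_graph VG EG" and n: "card VD = n"
    and univ: "\<And>f. holds_universally (RAAG VG EG) f \<Longrightarrow> holds_universally (RAAG VD ED) f"
  shows "\<exists>\<phi>. tame_embedding VD ED (inflate_V VG n) (inflate_E VG EG n) \<phi>"
proof (cases "VD = {}")
  case True
  then show ?thesis using tame_embedding_empty[OF simple_graph_inflate[OF gG]] by simp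
next
  case False
  then obtain x0 where x0: "x0 \<in> VD" by blast
  have finD: "finite VD" and finG: "finite (UV EG ` VG)" using gD gG by (simp_all add: simple_graph_def)
  have n1: "n \<ge> 1" using n x0 finD by (metis One_nat_def Suc_leI card_gt_0_iff empty_iff)
  interpret D: presented VD ED by standard (rule gD)
  interpret G: presented VG EG by standard (rule gG)
  interpret I: presented "inflate_V VG n" "inflate_E VG EG n"
    by standard (rule simple_graph_inflate[OF gG])
  let ?EI = "inflate_E VG EG n"
  let ?PI = "par (UV ?EI ` inflate_V VG n)"
  let ?tf = "tame_factor (inflate_V VG n) ?EI" and ?tc = "tame_conj (inflate_V VG n) ?EI"
  interpret J: inflation_graph "UV EG ` VG" n "infl VG EG n" by (rule inflation_graph_infl[OF gG])
  obtain vl where vl: "set vl = UV EG ` VG" "distinct vl" using finite_distinct_list[OF finG] by blast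
  have univ': "\<forall>s. (\<forall>i. s i \<in> par (UV ED ` VD)) \<longrightarrow> satT s f"
    if "\<forall>s. (\<forall>i. s i \<in> par (UV EG ` VG)) \<longrightarrow> satT s f" for f
    using univ[of f] that unfolding D.holds_universally_iff G.holds_universally_iff .
  obtain y :: "'a \<Rightarrow> 'b uv raag" where y1: "\<forall>x. y x \<in> par (UV EG ` VG)"
    and y2: "\<forall>x x'. ED x x' \<longrightarrow> comm (y x) (y x')"
    and sep: "\<forall>L R. L \<subseteq> VD \<times> UV EG ` VG \<longrightarrow> (\<forall>l m. R l m \<longrightarrow> l \<in> L \<and> m \<in> L) \<longrightarrow>
      (\<forall>w\<in>raag_words VD. word_sum (canonical vl L R) w = 0 \<longrightarrow> word_sum y w = 0) \<longrightarrow>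
      (\<forall>w\<in>raag_words VD. word_sum (canonical vl L R) w = 0 \<longrightarrow> vals ED w = 0)"
    using separating_family[OF gD finG vl(1) univ'] .
  note y = y1[rule_format] y2[rule_format]
  obtain L :: "('a \<times> 'b uv) set" and U b where L: "L \<subseteq> VD \<times> set vl"
    and form: "\<And>x v. (x, v) \<in> L \<Longrightarrow> U (x, v) \<in> par (set vl) \<and> (\<exists>h. U (x, v) = cj h (gen v))"
    and sum: "\<And>x. x \<in> VD \<Longrightarrow> y x = sum_list (map (\<lambda>v. b (x, v)) (filter (\<lambda>v. (x, v) \<in> L) vl))"
    and comm_b: "\<And>l m. l \<in> L \<Longrightarrow> m \<in> L \<Longrightarrow> comm (U l) (U m) \<Longrightarrow> comm (b l) (b m)"
    and comm_U: "\<And>x v x' v'. (x, v) \<in> L \<Longrightarrow> (x', v') \<in> L \<Longrightarrow> comm (y x) (y x') \<Longrightarrow> comm (U (x, v)) (U (x', v'))"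
    and norm: "\<And>v. (x0, v) \<in> L \<Longrightarrow> U (x0, v) = gen v"
    by (rule resolution[OF finD vl(2), of y x0]) (use y(1) vl(1) in auto)
  have clique: "comm (U (x, v)) (U (x, v'))" if "(x, v) \<in> L" "(x, v') \<in> L" for x v v'
    using comm_U[OF that] by simp
  have "\<exists>Z col h. inj_on (\<lambda>l. (col l, U l)) L
      \<and> (\<forall>l\<in>L. col l \<in> {1..n} \<and> (col l = n \<longrightarrow> snd l \<in> Z))
      \<and> (\<forall>l\<in>L. h l \<in> par (set vl - Z) \<and> U l = cj (h l) (gen (snd l)))"
  proof (rule colouring[OF finD finite_set n x0 L form clique norm])
    fix Z col h
    assume "inj_on (\<lambda>l. (col l, U l)) L"
      "\<And>l. l \<in> L \<Longrightarrow> col l \<in> {1..n} \<and> (col l = n \<longrightarrow> snd l \<in> Z)"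
      "\<And>l. l \<in> L \<Longrightarrow> h l \<in> par (set vl - Z) \<and> U l = cj (h l) (gen (snd l))"
    then show ?thesis by (intro exI[of _ Z] exI[of _ col] exI[of _ h] conjI ballI) blast+
  qed
  then obtain Z col h where col: "inj_on (\<lambda>l. (col l, U l)) L"
    "\<And>l. l \<in> L \<Longrightarrow> col l \<in> {1..n} \<and> (col l = n \<longrightarrow> snd l \<in> Z)"
    "\<And>l. l \<in> L \<Longrightarrow> h l \<in> par (set vl - Z) \<and> U l = cj (h l) (gen (snd l))"
    by blast
  interpret F: coloured_family "UV EG ` VG" n "infl VG EG n" L U h snd col Z
  proof
    show "1 \<le> n" by (rule n1)
    show "snd l \<in> UV EG ` VG" if "l \<in> L" for l using that L vl(1) by auto
  qed (use col vl(1) in auto)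
  let ?vs = "\<lambda>x. filter (\<lambda>v. (x, v) \<in> L) vl"
  \<comment> \<open>Sending each vertex of the commutation graph to its block respects adjacency by
    \<open>comm_b\<close>, so \<open>y\<close> is the canonical map followed by
    \<open>lift \<beta>\<close>. This is the hypothesis of \<open>sep\<close> for the graph at
    hand.\<close>
  have factor: "word_sum y w = 0" if "w \<in> raag_words VD"
    "word_sum (canonical vl L F.R) w = 0" for w
  proof -
    define \<beta> where "\<beta> p = (case p of UV Q l \<Rightarrow> if Q = F.R \<and> l \<in> L then b l else 0)" for p
    have \<beta>: "adj_compatible \<beta>"
      unfolding adj_compatible_def
    proof (intro allI impI)
      fix p q :: "('a \<times> 'b uv) uv" assume a: "adj p q"
      obtain Q l Q' m where pq: "p = UV Q l" "q = UV Q' m" by (cases p; cases q)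
      show "comm (\<beta> p) (\<beta> q)"
      proof (cases "Q = F.R \<and> l \<in> L \<and> m \<in> L")
        case True
        then have "comm (U l) (U m)" using a by (simp add: pq F.R_def)
        then show ?thesis using True a comm_b by (simp add: pq \<beta>_def)
      next
        case False
        then show ?thesis using a by (auto simp: pq \<beta>_def)
      qed
    qed
    have "lift \<beta> (canonical vl L F.R x) = y x" if "x \<in> VD" for x
    proof -
      have "map (\<lambda>v. lift \<beta> (gen (UV F.R (x, v)))) (?vs x) = map (\<lambda>v. b (x, v)) (?vs x)"
        by (rule map_cong) (auto simp: lift_gen[OF \<beta>] \<beta>_def)
      then show ?thesis by (simp only: canonical_def lift_sum_list[OF \<beta>] sum[OF that] map_map o_def)
    qed
    then have "word_sum y w = lift \<beta> (word_sum (canonical vl L F.R) w)"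
      unfolding lift_of_word_sum[OF \<beta>] using that(1) by (intro word_sum_cong[of w VD]) auto
    then show ?thesis using that(2) by (simp add: lift_zero[OF \<beta>])
  qed
  define yh where "yh x = sum_list (map (\<lambda>v. F.Uh (x, v)) (?vs x))" for x
  define \<theta> where "\<theta> p = (case p of UV Q x \<Rightarrow> if Q = ED \<and> x \<in> VD then yh x else 0)" for p
  have comm_yh: "comm (yh x) (yh x')" if "comm (y x) (y x')" for x x'
  proof -
    have *: "comm (F.Uh (x, v)) (F.Uh (x', v'))" if "v \<in> set (?vs x)" "v' \<in> set (?vs x')" for v v'
      using that \<open>comm (y x) (y x')\<close> by (intro F.comm_Uh comm_U) auto
    have "comm (F.Uh (x, v)) (yh x')" if "v \<in> set (?vs x)" for v
    proof -
      have "comm (yh x') (F.Uh (x, v))"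
        unfolding yh_def using *[OF that] comm_sym by (intro comm_sum_list) auto
      then show ?thesis by (rule comm_sym)
    qed
    then show ?thesis unfolding yh_def[of x] by (intro comm_sum_list) auto
  qed
  have \<theta>: "adj_compatible \<theta>"
    unfolding adj_compatible_def
  proof (intro allI impI)
    fix p q :: "'a uv" assume a: "adj p q"
    obtain Q x Q' x' where pq: "p = UV Q x" "q = UV Q' x'" by (cases p; cases q)
    show "comm (\<theta> p) (\<theta> q)" using a y(2) comm_yh by (auto simp: pq \<theta>_def)
  qed
  have \<theta>_vals: "lift \<theta> (vals ED p) = word_sum yh p" if "p \<in> raag_words VD" for p
    unfolding vals_def lift_of_word_sum[OF \<theta>]
    by (rule word_sum_cong[OF that]) (simp add: lift_gen[OF \<theta>] \<theta>_def)
  \<comment> \<open>A relation among the \<open>yh x\<close> is a relation among the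
    \<open>Uh l\<close>; by their independence the canonical map kills the word, and
    \<open>sep\<close> then makes it trivial.\<close>
  have \<theta>_inj: "vals ED p = 0" if p: "p \<in> raag_words VD" and z: "word_sum yh p = 0" for p
  proof -
    let ?ls = "\<lambda>x. map (\<lambda>v. (x, v)) (?vs x)"
    have 1: "word_sum F.Uh (expand ?ls p) = 0"
      using z by (simp add: word_sum_expand yh_def[abs_def] o_def)
    have "set (expand ?ls p) \<subseteq> L \<times> UNIV" using set_expand[of ?ls p] by auto
    from F.word_sum_Uh_eq_zero[OF this 1]
    have "word_sum (canonical vl L F.R) p = 0"
      by (simp add: word_sum_expand canonical_def[abs_def] o_def)
    moreover have "\<forall>l m. F.R l m \<longrightarrow> l \<in> L \<and> m \<in> L" by (simp add: F.R_def)
    ultimately show ?thesis using sep L vl(1) factor p by metis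
  qed
  have inI: "infl VG EG n v c \<in> UV ?EI ` inflate_V VG n" if "v \<in> UV EG ` VG" "c \<in> {1..n}" for v c
    using that by (auto simp: infl_def inflate_V_def)
  have ke: "F.ke g \<in> ?PI" for g
  proof (induction g rule: raag_induct)
    case (plus v s g)
    then show ?case using n1 inI[of v n] by (cases "v \<in> UV EG ` VG") simp_all
  qed simp
  have vcol: "(unUV v, col (x, v)) \<in> inflate_V VG n" if "(x, v) \<in> L" for x v
    using that F.vt[OF that] col(2)[OF that] by (auto simp: inflate_V_def)
  have UhI: "F.Uh l \<in> ?PI" if "l \<in> L" for l
    using inI[OF F.vt[OF that], of "col l"] col(2)[OF that] ke unfolding F.Uh_def by simp
  have yhI: "yh x \<in> ?PI" for x
  proof -
    have sl: "sum_list xs \<in> par X" if "set xs \<subseteq> par X" for xs :: "('b \<times> nat) uv raag list" and X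
      using that by (induction xs) auto
    show ?thesis unfolding yh_def by (rule sl) (use UhI in auto)
  qed
  have \<theta>I: "lift \<theta> g \<in> ?PI" for g
  proof (induction g rule: raag_induct)
    case (plus v s g)
    have "\<theta> v \<in> ?PI" by (cases v) (simp add: \<theta>_def yhI)
    then show ?case using plus by (simp add: lift_simps[OF \<theta>])
  qed (simp add: lift_zero[OF \<theta>])
  define \<phi> where "\<phi> A = I.jval (lift \<theta> (ival ED A))" for A
  have \<phi>I: "\<phi> A \<in> carrier I.G" "ival ?EI (\<phi> A) = lift \<theta> (ival ED A)" for A
    using I.jval[OF \<theta>I] by (simp_all add: \<phi>_def)
  have \<phi>_hom: "\<phi> \<in> hom D.G I.G"
  proof (rule homI)
    interpret IG: group I.G by (rule I.group_G)
    fix A B assume AB: "A \<in> carrier D.G" "B \<in> carrier D.G"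
    have "ival ?EI (\<phi> (A \<otimes>\<^bsub>D.G\<^esub> B)) = ival ?EI (\<phi> A \<otimes>\<^bsub>I.G\<^esub> \<phi> B)"
      using AB by (simp add: \<phi>I I.ival_mult D.ival_mult lift_plus[OF \<theta>])
    then show "\<phi> (A \<otimes>\<^bsub>D.G\<^esub> B) = \<phi> A \<otimes>\<^bsub>I.G\<^esub> \<phi> B" using \<phi>I by (subst (asm) I.ival_inj) auto
  qed (rule \<phi>I)
  have \<phi>_inj: "inj_on \<phi> (carrier D.G)"
  proof (rule inj_onI)
    fix A B assume AB: "A \<in> carrier D.G" "B \<in> carrier D.G" "\<phi> A = \<phi> B"
    obtain p q where p: "p \<in> raag_words VD" "A = D.cls p" and q: "q \<in> raag_words VD" "B = D.cls q"
      using AB(1,2) unfolding D.carrier_iff by blast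
    have "lift \<theta> (ival ED A) = lift \<theta> (ival ED B)" using AB(3) \<phi>I(2) by metis
    then have "lift \<theta> (vals ED p) = lift \<theta> (vals ED q)" using p q by (simp only: D.ival_cls)
    then have "lift \<theta> (vals ED (p @ inv_word q)) = 0"
      by (simp add: D.vals_inv_word lift_simps[OF \<theta>])
    moreover have w: "p @ inv_word q \<in> raag_words VD" using p q D.inv_word_words by simp
    ultimately have "vals ED (p @ inv_word q) = 0" using \<theta>_inj \<theta>_vals by metis
    then have "vals ED p + - vals ED q = 0" by (simp add: D.vals_inv_word)
    then have "vals ED p = vals ED q" by (metis add.assoc add.right_neutral add.left_neutral left_minus)
    then show "A = B" using p q D.cls_eq_iff by metis
  qed
  \<comment> \<open>Every block has been replaced by a conjugate of a vertex itself, so all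
    exponents are \<open>1\<close> and the tame factors coincide with the tame conjugates.\<close>
  define LL where "LL x = map (\<lambda>v. ((unUV v, col (x, v)), 1 :: int, I.jval (F.ke (h (x, v))))) (?vs x)" for x
  have conj: "?tc (LL x ! j) \<in> carrier I.G"
    "?tf (LL x ! j) = ?tc (LL x ! j)"
    "ival ?EI (?tc (LL x ! j)) = F.Uh (x, ?vs x ! j)" "(x, ?vs x ! j) \<in> L"
    if j: "j < length (LL x)" for x j
  proof -
    let ?v = "?vs x ! j"
    have "?v \<in> set (?vs x)" using j by (intro nth_mem) (simp add: LL_def)
    then show vL: "(x, ?v) \<in> L" by simp
    have e: "LL x ! j = ((unUV ?v, col (x, ?v)), 1, I.jval (F.ke (h (x, ?v))))" using j by (simp add: LL_def)
    note t = I.tame_factor_one[OF vcol[OF vL] I.jval(1)[OF ke[of "h (x, ?v)"]]]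
    show "?tc (LL x ! j) \<in> carrier I.G"
      "?tf (LL x ! j) = ?tc (LL x ! j)"
      unfolding e by (rule t)+
    show "ival ?EI (?tc (LL x ! j)) = F.Uh (x, ?v)"
      unfolding e t(3) I.jval(2)[OF ke] F.Uh_def by (simp only: infl_def[of VG EG n ?v] snd_conv)
  qed
  have t1: "\<forall>(x', k, g)\<in>set (LL x). x' \<in> inflate_V VG n \<and> g \<in> carrier I.G" for x
    using vcol I.jval(1)[OF ke] by (auto simp: LL_def)
  have t2: "\<phi> (raag_gen VD ED x) = gprod I.G (map (?tf) (LL x))" if x: "x \<in> VD" for x
  proof -
    let ?ys = "map (?tf) (LL x)"
    have ys: "set ?ys \<subseteq> carrier I.G"
    proof
      fix a assume "a \<in> set ?ys"
      then obtain q where q: "q \<in> set (LL x)" "a = ?tf q"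
        unfolding set_map by blast
      then obtain j where "j < length (LL x)" "q = LL x ! j" by (auto simp only: in_set_conv_nth)
      then show "a \<in> carrier I.G" using conj(1,2)[of j x] q(2) by simp
    qed
    have "map (ival ?EI) ?ys = map (\<lambda>v. F.Uh (x, v)) (?vs x)"
    proof (rule nth_equalityI)
      show "length (map (ival ?EI) ?ys) = length (map (\<lambda>v. F.Uh (x, v)) (?vs x))" by (simp add: LL_def)
      fix j assume "j < length (map (ival ?EI) ?ys)"
      then have "j < length (LL x)" "j < length (?vs x)" by (simp_all add: LL_def)
      then show "map (ival ?EI) ?ys ! j = map (\<lambda>v. F.Uh (x, v)) (?vs x) ! j"
        using conj(2,3)[of j x] by simp
    qed
    then have "ival ?EI (gprod I.G ?ys) = yh x" using I.ival_gprod[OF ys] by (simp add: yh_def)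
    moreover have "ival ?EI (\<phi> (raag_gen VD ED x)) = yh x"
      using x by (simp add: \<phi>I D.ival_raag_gen lift_gen[OF \<theta>] \<theta>_def)
    ultimately show ?thesis using I.ival_inj[OF \<phi>I(1)] I.ival_gprod[OF ys] by metis
  qed
  have t3: "\<forall>j<length (LL x). \<forall>l<length (LL x).
        ?tf (LL x ! j) \<otimes>\<^bsub>I.G\<^esub> ?tf (LL x ! l) =
        ?tf (LL x ! l) \<otimes>\<^bsub>I.G\<^esub> ?tf (LL x ! j)" for x
  proof (intro allI impI)
      interpret IG: group I.G by (rule I.group_G)
      fix j l assume jl: "j < length (LL x)" "l < length (LL x)"
      have "comm (F.Uh (x, ?vs x ! j)) (F.Uh (x, ?vs x ! l))"
        using conj(4)[OF jl(1)] conj(4)[OF jl(2)] by (intro F.comm_Uh comm_U) auto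
      then show "?tf (LL x ! j) \<otimes>\<^bsub>I.G\<^esub> ?tf (LL x ! l) =
        ?tf (LL x ! l) \<otimes>\<^bsub>I.G\<^esub> ?tf (LL x ! j)"
        using conj[OF jl(1)] conj[OF jl(2)] by (subst I.ival_inj[symmetric]) (simp_all add: I.ival_mult comm_def)
  qed
  \<comment> \<open>Distinctness over all pairs is what the colours are for: different blocks with
    equal \<open>U\<close> have different colours, and \<open>F.inj_Uh\<close> separates
    them.\<close>
  have t4: "inj_on (\<lambda>(x, j). ?tc (LL x ! j)) {(x, j). x \<in> VD \<and> j < length (LL x)}"
  proof (rule inj_onI, clarify)
      fix x j x' j' assume j: "j < length (LL x)" "j' < length (LL x')"
        and eq: "?tc (LL x ! j) = ?tc (LL x' ! j')"
      have "F.Uh (x, ?vs x ! j) = F.Uh (x', ?vs x' ! j')"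
        using arg_cong[OF eq, of "ival ?EI"] conj(3)[OF j(1)] conj(3)[OF j(2)] by simp
      then have e: "(x, ?vs x ! j) = (x', ?vs x' ! j')"
        using inj_onD[OF F.inj_Uh _ conj(4)[OF j(1)] conj(4)[OF j(2)]] by blast
      moreover have "distinct (?vs x)" using vl(2) by simp
      ultimately show "x = x' \<and> j = j'" using j nth_eq_iff_index_eq[of "?vs x" j j'] by (auto simp: LL_def)
  qed
  have "tame_embedding VD ED (inflate_V VG n) ?EI \<phi>"
    unfolding tame_embedding_def
    by (intro conjI exI[of _ LL] \<phi>_hom \<phi>_inj t4) (use t1 t2 t3 in blast)
  then show ?thesis by blast
qed

theorem theorem4p13:
  fixes VD :: "'a set" and ED :: "'a \<Rightarrow> 'a \<Rightarrow> bool"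
    and VG :: "'b set" and EG :: "'b \<Rightarrow> 'b \<Rightarrow> bool"
    and n m :: nat
  assumes "simple_graph VD ED" and "simple_graph VG EG"
    and "card VD = n" and "card VG = m"
  shows "universally_equivalent (RAAG VD ED) (RAAG VG EG) \<longleftrightarrow>
    (\<exists>\<phi>. tame_embedding VD ED (inflate_V VG n) (inflate_E VG EG n) \<phi>) \<and>
    (\<exists>\<psi>. tame_embedding VG EG (inflate_V VD m) (inflate_E VD ED m) \<psi>)"
proof
  assume "universally_equivalent (RAAG VD ED) (RAAG VG EG)"
  then show "(\<exists>\<phi>. tame_embedding VD ED (inflate_V VG n) (inflate_E VG EG n) \<phi>) \<and>
    (\<exists>\<psi>. tame_embedding VG EG (inflate_V VD m) (inflate_E VD ED m) \<psi>)"
    using assms unfolding universally_equivalent_def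
    by (intro conjI universal_imp_tame_embedding) simp_all
next
  assume "(\<exists>\<phi>. tame_embedding VD ED (inflate_V VG n) (inflate_E VG EG n) \<phi>) \<and>
    (\<exists>\<psi>. tame_embedding VG EG (inflate_V VD m) (inflate_E VD ED m) \<psi>)"
  then show "universally_equivalent (RAAG VD ED) (RAAG VG EG)"
    using embedding_transfers_universal[OF assms(1,2)] embedding_transfers_universal[OF assms(2,1)]
    unfolding universally_equivalent_def tame_embedding_def by blast
qed

end
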